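(* Let the loss $\ell$ and the data distribution $\mathbb P$ satisfy the assumptions on loss, data and compatibility stated in the context. Let $\pi_0\in\mathcal P_2(\overline\Theta)$ be omni-directional, let $(\pi_t)_{t\ge 0}$ be the Wasserstein gradient flow of $\mathcal R$ starting at $\pi_0$, and assume that the Morse-Sard condition stated in the context holds. Let $\Omega^{lim}$ be the set of all pairs $(g,V)$ for which there exist $t_n\to\infty$ such that $\delta_\pi\mathcal R(\pi_{t_n},\cdot)\to g$ and $\nabla_\theta\delta_\pi\mathcal R(\pi_{t_n},\cdot)\to V$ locally uniformly. Assume in addition that the second moments $N(\pi_t)$ remain uniformly bounded (at least along a subsequence of times $t_n\to\infty$) and that $|\Omega^{lim}|=1$. Then there exists a measure $\pi_\infty\in\mathcal P_2(\overline\Theta)$ such that $f_{\pi_\infty}=f^*$ ($\overline{\mathbb P}$-almost everywhere), i.e. a risk minimizing measure.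
   Context: **Network.** Let $\Theta=\{(a,w,b)\in\mathbb R\times\mathbb R^d\times\mathbb R: a^2<|w|^2+b^2\}$, with closure $\overline\Theta\subset\mathbb R^{d+2}$; write $\theta=(a,w,b)$. Let $\sigma(z)=\max\{z,0\}$, $\sigma'(z)=1_{\{z>0\}}$, $\phi(\theta;x)=a\,\sigma(w^Tx+b)$ and $\nabla_\theta\phi(\theta;x)=\big(\sigma(w^Tx+b),\,a\,\sigma'(w^Tx+b)\,x,\,a\,\sigma'(w^Tx+b)\big)$ for $x\in\mathbb R^d$. $\mathcal P_2(\overline\Theta)$ is the set of Borel probability measures on $\overline\Theta$ with finite second moment $N(\pi)=\int|\theta|^2\,\pi(d\theta)$, and $f_\pi(x)=\int_{\overline\Theta}\phi(\theta;x)\,\pi(d\theta)$. **Loss.** $\ell:\mathbb R\times\mathbb R\to[0,\infty)$ is jointly continuous, continuously differentiable in the first argument with $|\partial_1\ell|\le C_\ell$ for some constant $C_\ell>0$, and $y\mapsto\ell(y,\bar y)$ is convex for every $\bar y\in\mathbb R$. **Data.** $\mathbb P$ is a Borel probability measure on $\mathbb R^d\times\mathbb R$ with $\int(|x|+|y|)\,d\mathbb P<\infty$; $\overline{\mathbb P}$ is its marginal on $\mathbb R^d$ and $\mathbb P^x$ are the conditional distributions of $y$ given $x$. The span of the functions $\phi(\theta;\cdot)$ is dense in $L^1(\overline{\mathbb P})$, and the map $S^d\to L^1(\sqrt{1+|x|^2}\cdot\overline{\mathbb P})$, $(w,b)\mapsto 1_{\{x\,:\,w^Tx+b>0\}}$,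 is Lipschitz continuous (here $S^d\subset\mathbb R^{d+1}$ is the unit sphere and $h\cdot\mu$ is the measure with density $h$ with respect to $\mu$). **Compatibility.** With $L_x(\alpha)=\int_{\mathbb R}\ell(\alpha,y)\,\mathbb P^x(dy)$: $\lim_{|\alpha|\to\infty}L_x(\alpha)=\infty$ for $\overline{\mathbb P}$-a.e. $x$, and $\int\ell(0,y)\,\mathbb P(dx\otimes dy)<\infty$. Under these conditions there is a $\overline{\mathbb P}$-measurable function $f^*:\mathbb R^d\to\mathbb R$ with $f^*(x)\in\operatorname{argmin}_{\alpha\in\mathbb R} L_x(\alpha)$ for $\overline{\mathbb P}$-a.e. $x$; it is assumed that there exists a version of $f^*$ in $L^1(\overline{\mathbb P})$. **Risk and gradient flow.** $\mathcal R(\pi)=\int\ell(f_\pi(x),y)\,\mathbb P(dx\otimes dy)$; a risk minimizing measure is a minimizer of $\mathcal R$. Further, $\delta_\pi\mathcal R(\pi,\theta)=\int(\partial_1\ell)(f_\pi(x),y)\,\phi(\theta;x)\,\mathbb P(dx\otimes dy)$ and $\nabla_\theta\delta_\pi\mathcal R(\pi,\theta)=\int(\partial_1\ell)(f_\pi(x),y)\,\nabla_\theta\phi(\theta;x)\,\mathbb P(dx\otimes dy)$. The (2-)Wasserstein gradient flow $\pi_t\in\mathcal P_2(\overline\Theta)$ of $\mathcal R$ starting at $\pi_0$ is described by the continuity equation $\frac{d}{dt}\pi_t=\mathrm{div}_\theta(\pi_t\nabla_\theta\delta_\pi\mathcal R(\pi_t,\cdot))$ in the distributional sense, i.e. $\frac{d}{dt}\int_\Theta\psi\,d\pi_t=-\int_\Theta\langle\nabla\psi,\nabla_\theta\delta_\pi\mathcal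 R(\pi_t,\cdot)\rangle\,d\pi_t$ for $\psi\in C_c^\infty(\Theta)$; under the assumptions above it exists and is unique for every $\pi_0\in\mathcal P_2(\overline\Theta)$. **Omni-directional.** A probability measure is omni-directional if every (nonempty) open cone in $\Theta$ has positive measure. **Morse-Sard condition.** Whenever $t_n\to\infty$, $\delta_\pi\mathcal R(\pi_{t_n},\cdot)\to g$ and $\nabla_\theta\delta_\pi\mathcal R(\pi_{t_n},\cdot)\to V$ locally uniformly on $\overline\Theta$, the restriction of $g$ to the unit sphere $S^{d+1}=\{a^2+|w|^2+b^2=1\}$ has the property that the gradient tangent to the sphere, $\nabla^Sg(\theta)=(I-\theta\otimes\theta)V(\theta)$, does not vanish anywhere on the level set $\{g=s\}$ for Lebesgue-almost every $s$.
   Formalization: Since the loss is only convex, f* need not be unique and the claim fails for an arbitrary fixed f* (e.g. a discontinuous one); it is stated as: f_{π_∞} equals almost everywhere some L^1 function minimizing L_x for a.e. x, and π_∞ minimizes the risk. *)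

theory Defs
  imports "HOL-Probability.Probability"
begin

section \<open>The network\<close>

text \<open>Parameters are triples \<open>(a, w, b)\<close>. The norm and the inner product of the product type are
  the Euclidean ones, so \<open>(norm (a, w, b))\<^sup>2 = a\<^sup>2 + (norm w)\<^sup>2 + b\<^sup>2\<close>.\<close>

type_synonym 'n param = "real \<times> (real ^ 'n) \<times> real"

definition Theta :: "('n::finite) param set" where
  "Theta = {(a, w, b). a\<^sup>2 < (norm w)\<^sup>2 + b\<^sup>2}"

abbreviation Theta_bar :: "('n::finite) param set" where
  "Theta_bar \<equiv> closure Theta"

definition relu :: "real \<Rightarrow> real" where
  "relu z = max z 0"

definition relu' :: "real \<Rightarrow> real" where
  "relu' z = indicator {0<..} z"

definition phi :: "('n::finite) param \<Rightarrow> real ^ 'n \<Rightarrow> real" where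
  "phi = (\<lambda>(a, w, b) x. a * relu (w \<bullet> x + b))"

definition grad_phi :: "('n::finite) param \<Rightarrow> real ^ 'n \<Rightarrow> 'n param" where
  "grad_phi = (\<lambda>(a, w, b) x.
     (relu (w \<bullet> x + b), (a * relu' (w \<bullet> x + b)) *\<^sub>R x, a * relu' (w \<bullet> x + b)))"

definition P2 :: "('n::finite) param measure set" where
  "P2 = {\<mu>. prob_space \<mu> \<and> sets \<mu> = sets (restrict_space borel Theta_bar)
             \<and> integrable \<mu> (\<lambda>\<theta>. (norm \<theta>)\<^sup>2)}"

definition second_moment :: "('n::finite) param measure \<Rightarrow> real" where
  "second_moment \<mu> = (LINT \<theta>|\<mu>. (norm \<theta>)\<^sup>2)"

definition network :: "('n::finite) param measure \<Rightarrow> real ^ 'n \<Rightarrow> real" where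
  "network \<mu> x = (LINT \<theta>|\<mu>. phi \<theta> x)"


section \<open>Loss, data and compatibility\<close>

definition partial1 :: "(real \<Rightarrow> real \<Rightarrow> real) \<Rightarrow> real \<Rightarrow> real \<Rightarrow> real" where
  "partial1 \<l> u y = deriv (\<lambda>u. \<l> u y) u"

definition loss_assumption :: "(real \<Rightarrow> real \<Rightarrow> real) \<Rightarrow> bool" where
  "loss_assumption \<l> \<longleftrightarrow>
     (\<forall>u y. 0 \<le> \<l> u y) \<and>
     continuous_on UNIV (\<lambda>(u, y). \<l> u y) \<and>
     (\<forall>u y. (\<lambda>u. \<l> u y) field_differentiable at u) \<and>
     (\<forall>y. continuous_on UNIV (\<lambda>u. partial1 \<l> u y)) \<and>
     (\<exists>C>0. \<forall>u y. \<bar>partial1 \<l> u y\<bar> \<le> C) \<and>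
     (\<forall>y. convex_on UNIV (\<lambda>u. \<l> u y))"

definition marginal :: "((real ^ 'n::finite) \<times> real) measure \<Rightarrow> (real ^ 'n) measure" where
  "marginal P = distr P borel fst"

definition conditional_distribution ::
  "((real ^ 'n::finite) \<times> real) measure \<Rightarrow> (real ^ 'n \<Rightarrow> real measure) \<Rightarrow> bool" where
  "conditional_distribution P \<kappa> \<longleftrightarrow>
     \<kappa> \<in> borel \<rightarrow>\<^sub>M prob_algebra borel \<and>
     (\<forall>A\<in>sets borel. \<forall>B\<in>sets borel.
        emeasure P (A \<times> B) = (\<integral>\<^sup>+x\<in>A. emeasure (\<kappa> x) B \<partial>marginal P))"

definition phi_span_dense :: "((real ^ 'n::finite) \<times> real) measure \<Rightarrow> bool" where
  "phi_span_dense P \<longleftrightarrow>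
     (\<forall>h. integrable (marginal P) h \<longrightarrow>
       (\<forall>e>0. \<exists>T c. finite T \<and> T \<subseteq> Theta_bar \<and>
          (LINT x|marginal P. \<bar>h x - (\<Sum>\<theta>\<in>T. c \<theta> * phi \<theta> x)\<bar>) < e))"

definition halfspace :: "real ^ ('n::finite) \<Rightarrow> real \<Rightarrow> (real ^ 'n) set" where
  "halfspace w b = {x. w \<bullet> x + b > 0}"

definition halfspaces_lipschitz :: "((real ^ 'n::finite) \<times> real) measure \<Rightarrow> bool" where
  "halfspaces_lipschitz P \<longleftrightarrow>
     (\<exists>K. \<forall>w b w' b'. (w, b) \<in> sphere 0 1 \<longrightarrow> (w', b') \<in> sphere 0 1 \<longrightarrow>
        (LINT x|density (marginal P) (\<lambda>x. ennreal (sqrt (1 + (norm x)\<^sup>2))).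
           \<bar>indicator (halfspace w b) x - indicator (halfspace w' b') x\<bar>)
        \<le> K * dist (w, b) (w', b'))"

definition data_assumption :: "((real ^ 'n::finite) \<times> real) measure \<Rightarrow> bool" where
  "data_assumption P \<longleftrightarrow>
     prob_space P \<and> sets P = sets borel \<and>
     integrable P (\<lambda>(x, y). norm x + \<bar>y\<bar>) \<and>
     phi_span_dense P \<and> halfspaces_lipschitz P"

text \<open>Valued in \<^typ>\<open>ennreal\<close>: a non-integrable \<open>\<l> \<alpha>\<close> has conditional risk \<open>\<infinity>\<close>.\<close>

definition cond_risk ::
  "(real \<Rightarrow> real \<Rightarrow> real) \<Rightarrow> (real ^ ('n::finite) \<Rightarrow> real measure) \<Rightarrow> real ^ 'n \<Rightarrow> real \<Rightarrow> ennreal" where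
  "cond_risk \<l> \<kappa> x \<alpha> = (\<integral>\<^sup>+y. ennreal (\<l> \<alpha> y) \<partial>\<kappa> x)"

text \<open>\<open>f\<close> is a (version of) \<open>f\<^sup>*\<close> in \<open>L\<^sup>1\<close>. The loss need not be strictly convex, so such functions need
  not agree almost everywhere.\<close>

definition L1_optimal_predictor ::
  "(real \<Rightarrow> real \<Rightarrow> real) \<Rightarrow> ((real ^ 'n::finite) \<times> real) measure \<Rightarrow> (real ^ 'n \<Rightarrow> real measure) \<Rightarrow>
   (real ^ 'n \<Rightarrow> real) \<Rightarrow> bool" where
  "L1_optimal_predictor \<l> P \<kappa> f \<longleftrightarrow>
     integrable (marginal P) f \<and>
     (AE x in marginal P. is_arg_min (cond_risk \<l> \<kappa> x) (\<lambda>_. True) (f x))"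

definition compatibility ::
  "(real \<Rightarrow> real \<Rightarrow> real) \<Rightarrow> ((real ^ 'n::finite) \<times> real) measure \<Rightarrow> (real ^ 'n \<Rightarrow> real measure) \<Rightarrow> bool"
  where
  "compatibility \<l> P \<kappa> \<longleftrightarrow>
     (AE x in marginal P. (cond_risk \<l> \<kappa> x \<longlongrightarrow> \<infinity>) at_infinity) \<and>
     (\<integral>\<^sup>+(x, y). ennreal (\<l> 0 y) \<partial>P) < \<infinity> \<and>
     (\<exists>f. L1_optimal_predictor \<l> P \<kappa> f)"


section \<open>Risk and its Wasserstein gradient flow\<close>

definition risk ::
  "(real \<Rightarrow> real \<Rightarrow> real) \<Rightarrow> ((real ^ 'n::finite) \<times> real) measure \<Rightarrow> 'n param measure \<Rightarrow> ennreal" where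
  "risk \<l> P \<mu> = (\<integral>\<^sup>+(x, y). ennreal (\<l> (network \<mu> x) y) \<partial>P)"

definition risk_minimizing ::
  "(real \<Rightarrow> real \<Rightarrow> real) \<Rightarrow> ((real ^ 'n::finite) \<times> real) measure \<Rightarrow> 'n param measure \<Rightarrow> bool" where
  "risk_minimizing \<l> P \<mu> \<longleftrightarrow> is_arg_min (risk \<l> P) (\<lambda>\<nu>. \<nu> \<in> P2) \<mu>"

definition delta_risk ::
  "(real \<Rightarrow> real \<Rightarrow> real) \<Rightarrow> ((real ^ 'n::finite) \<times> real) measure \<Rightarrow> 'n param measure \<Rightarrow>
   'n param \<Rightarrow> real" where
  "delta_risk \<l> P \<mu> \<theta> = (LINT (x, y)|P. partial1 \<l> (network \<mu> x) y * phi \<theta> x)"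

definition grad_delta_risk ::
  "(real \<Rightarrow> real \<Rightarrow> real) \<Rightarrow> ((real ^ 'n::finite) \<times> real) measure \<Rightarrow> 'n param measure \<Rightarrow>
   'n param \<Rightarrow> 'n param" where
  "grad_delta_risk \<l> P \<mu> \<theta> = (LINT (x, y)|P. partial1 \<l> (network \<mu> x) y *\<^sub>R grad_phi \<theta> x)"

text \<open>\<open>k\<close> times continuously differentiable on the whole space, by iterated directional
  derivatives.\<close>

primrec C_k :: "nat \<Rightarrow> ('a::euclidean_space \<Rightarrow> real) \<Rightarrow> bool" where
  "C_k 0 f \<longleftrightarrow> continuous_on UNIV f"
| "C_k (Suc k) f \<longleftrightarrow>
     (\<forall>x. f differentiable at x) \<and> (\<forall>v. C_k k (\<lambda>x. frechet_derivative f (at x) v))"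

definition test_functions :: "('a::euclidean_space) set \<Rightarrow> ('a \<Rightarrow> real) set" where
  "test_functions U =
     {\<psi>. (\<forall>k. C_k k \<psi>) \<and> compact (closure {x. \<psi> x \<noteq> 0}) \<and> closure {x. \<psi> x \<noteq> 0} \<subseteq> U}"

definition grad :: "('a::euclidean_space \<Rightarrow> real) \<Rightarrow> 'a \<Rightarrow> 'a" where
  "grad f x = (\<Sum>e\<in>Basis. frechet_derivative f (at x) e *\<^sub>R e)"

definition couplings :: "'a measure \<Rightarrow> 'a measure \<Rightarrow> ('a \<times> 'a) measure set" where
  "couplings \<mu> \<nu> = {\<gamma>. sets \<gamma> = sets (\<mu> \<Otimes>\<^sub>M \<nu>) \<and> distr \<gamma> \<mu> fst = \<mu> \<and> distr \<gamma> \<nu> snd = \<nu>}"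

text \<open>Meaningful for measures with finite second moment, where every coupling has finite cost.\<close>

definition wasserstein2 :: "('a::euclidean_space) measure \<Rightarrow> 'a measure \<Rightarrow> real" where
  "wasserstein2 \<mu> \<nu> = sqrt (INF \<gamma>\<in>couplings \<mu> \<nu>. LINT (\<theta>, \<eta>)|\<gamma>. (dist \<theta> \<eta>)\<^sup>2)"

text \<open>Only times \<open>t \<ge> 0\<close> are relevant (the derivative at \<open>t = 0\<close> is one-sided). Being a curve in Wasserstein
  space, the flow is continuous in the Wasserstein distance. With this continuity, the
  right-hand side of the continuity equation is continuous in \<open>t\<close>, so that the time derivative
  exists classically.\<close>

definition wasserstein_gradient_flow ::
  "(real \<Rightarrow> real \<Rightarrow> real) \<Rightarrow> ((real ^ 'n::finite) \<times> real) measure \<Rightarrow> 'n param measure \<Rightarrow>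
   (real \<Rightarrow> 'n param measure) \<Rightarrow> bool" where
  "wasserstein_gradient_flow \<l> P \<pi>0 \<pi> \<longleftrightarrow>
     \<pi> 0 = \<pi>0 \<and>
     (\<forall>t\<ge>0. \<pi> t \<in> P2) \<and>
     (\<forall>t\<ge>0. ((\<lambda>s. wasserstein2 (\<pi> s) (\<pi> t)) \<longlongrightarrow> 0) (at t within {0..})) \<and>
     (\<forall>\<psi>\<in>test_functions Theta. \<forall>t\<ge>0.
        ((\<lambda>s. LINT \<theta>:Theta|\<pi> s. \<psi> \<theta>) has_real_derivative
           - (LINT \<theta>:Theta|\<pi> t. grad \<psi> \<theta> \<bullet> grad_delta_risk \<l> P (\<pi> t) \<theta>)) (at t within {0..}))"

text \<open>Cones are closed under multiplication by positive scalars. The library's \<^const>\<open>cone\<close> also demands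
  \<open>0\<close>, which no subset of \<^const>\<open>Theta\<close> contains.\<close>

definition omni_directional :: "('n::finite) param measure \<Rightarrow> bool" where
  "omni_directional \<mu> \<longleftrightarrow>
     (\<forall>C. open C \<and> C \<noteq> {} \<and> C \<subseteq> Theta \<and> (\<forall>\<theta>\<in>C. \<forall>r>0. r *\<^sub>R \<theta> \<in> C) \<longrightarrow> measure \<mu> C > 0)"

text \<open>\<^const>\<open>Theta_bar\<close> is locally compact: locally uniform convergence is uniform convergence on
  compact subsets.\<close>

definition locally_uniform_limit ::
  "('a::metric_space) set \<Rightarrow> (nat \<Rightarrow> 'a \<Rightarrow> 'b::metric_space) \<Rightarrow> ('a \<Rightarrow> 'b) \<Rightarrow> bool" where
  "locally_uniform_limit S F g \<longleftrightarrow>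
     (\<forall>K. compact K \<and> K \<subseteq> S \<longrightarrow> uniform_limit K F g sequentially)"

text \<open>The limits are functions on \<^const>\<open>Theta_bar\<close> only; they are taken \<^const>\<open>extensional\<close> so that
  the number of pairs is not affected by values elsewhere.\<close>

definition limit_pairs ::
  "(real \<Rightarrow> real \<Rightarrow> real) \<Rightarrow> ((real ^ 'n::finite) \<times> real) measure \<Rightarrow> (real \<Rightarrow> 'n param measure) \<Rightarrow>
   (('n param \<Rightarrow> real) \<times> ('n param \<Rightarrow> 'n param)) set" where
  "limit_pairs \<l> P \<pi> =
     {(g, V). g \<in> extensional Theta_bar \<and> V \<in> extensional Theta_bar \<and>
        (\<exists>t. (\<forall>n. 0 \<le> t n) \<and> filterlim t at_top sequentially \<and>
           locally_uniform_limit Theta_bar (\<lambda>n. delta_risk \<l> P (\<pi> (t n))) g \<and>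
           locally_uniform_limit Theta_bar (\<lambda>n. grad_delta_risk \<l> P (\<pi> (t n))) V)}"

definition morse_sard_condition ::
  "(real \<Rightarrow> real \<Rightarrow> real) \<Rightarrow> ((real ^ 'n::finite) \<times> real) measure \<Rightarrow> (real \<Rightarrow> 'n param measure) \<Rightarrow> bool"
  where
  "morse_sard_condition \<l> P \<pi> \<longleftrightarrow>
     (\<forall>(g, V)\<in>limit_pairs \<l> P \<pi>. AE s in lborel.
        \<forall>\<theta>\<in>sphere 0 1 \<inter> Theta_bar. g \<theta> = s \<longrightarrow> V \<theta> - (\<theta> \<bullet> V \<theta>) *\<^sub>R \<theta> \<noteq> 0)"

end

theory Submission
  imports Defs "HOL-Complex_Analysis.Great_Picard" "HOL-Real_Asymp.Real_Asymp"
begin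

text \<open>Since there is only one limit pair, compactness (Arzela-Ascoli on the unit sphere, extended by
  homogeneity) makes the gradients \<open>V t\<close> of the first variation converge, as \<open>t \<rightarrow> \<infinity>\<close>, to a field \<open>W\<close> with
  potential \<open>g \<theta> = \<theta> \<bullet> W \<theta> / 2\<close>. Suppose that \<open>g\<close> does not vanish. As \<open>g\<close> is odd in the output weight, it is
  negative somewhere, and the Morse-Sard condition provides a regular level \<open>s < 0\<close>. The open cone
  \<open>g \<theta> < s |\<theta>|\<^sup>2\<close> is eventually invariant under the trajectories of \<open>- V t\<close>, which grow exponentially inside.
  By omni-directionality a positive amount of mass enters this cone, so the second moment tends
  to infinity, contrary to assumption. Hence \<open>g = 0\<close>. Along times with bounded second moments the networks
  converge pointwise to the network of a measure whose first variation then vanishes, and density of the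
  span together with convexity of the loss yields optimality.\<close>

section \<open>Ordinary differential equations\<close>

text \<open>The flow is given only by the continuity equation tested on \<open>Theta\<close> and by
  continuity in \<open>wasserstein2\<close>; no map carrying \<open>\<pi> 0\<close> to
  \<open>\<pi> t\<close> is at hand. Mass is therefore followed from below only, by test functions
  that do not decrease along trajectories. Trajectories exist because a^2 - |w|^2 - b^2 is constant
  along them, so that they never reach the boundary of \<open>Theta\<close>, and because |a| \<le>
  |(w, b)| compensates the irregularity of halfspaces near (w, b) = 0, which makes the averaged
  gradient Lipschitz although \<open>grad_phi\<close> jumps. A regular level s makes the cone
  stable: on its boundary the limit field pushes inward with a strength bounded below by
  compactness, and this beats the deviation of \<open>V t\<close> from its limit for large t. At a
  critical level the push could vanish. Bounded second moments do not prevent quadratic mass from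
  escaping to infinity, so the measures need not converge in \<open>P2\<close>. Convergence of their
  networks suffices, as the first variation depends on a measure only through its network.\<close>

lemma nonincreasing_within:
  fixes u :: "real \<Rightarrow> real"
  assumes "a \<le> b"
    and u: "\<And>s. s \<in> {a..b} \<Longrightarrow> (u has_real_derivative u' s) (at s within {a..b})"
    and neg: "\<And>s. s \<in> {a..b} \<Longrightarrow> u' s \<le> 0"
  shows "u b \<le> u a"
proof (rule DERIV_nonpos_imp_decreasing_open[OF \<open>a \<le> b\<close>])
  show "\<exists>y. (u has_real_derivative y) (at x) \<and> y \<le> 0" if "a < x" "x < b" for x
    using u[of x] neg[of x] that at_within_Icc_at[of a x b] by auto
  show "continuous_on {a..b} u"
    using u by (rule DERIV_continuous_on)
qed

lemma gronwall_upper: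
  fixes u :: "real \<Rightarrow> real"
  assumes "a \<le> b"
    and u: "\<And>s. s \<in> {a..b} \<Longrightarrow> (u has_real_derivative u' s) (at s within {a..b})"
    and le: "\<And>s. s \<in> {a..b} \<Longrightarrow> u' s \<le> k * u s"
  shows "u b \<le> exp (k * (b - a)) * u a"
proof -
  have "exp (- k * b) * u b \<le> exp (- k * a) * u a"
  proof (rule nonincreasing_within[OF \<open>a \<le> b\<close>])
    show "((\<lambda>s. exp (- k * s) * u s) has_real_derivative exp (- k * s) * (u' s - k * u s))
        (at s within {a..b})" if "s \<in> {a..b}" for s
      using u[OF that] by (auto intro!: derivative_eq_intros simp: algebra_simps)
    show "exp (- k * s) * (u' s - k * u s) \<le> 0" if "s \<in> {a..b}" for s
      using le[OF that] by (simp add: mult_le_0_iff)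
  qed
  then have "exp (k * b) * (exp (- k * b) * u b) \<le> exp (k * b) * (exp (- k * a) * u a)"
    by (rule mult_left_mono) simp
  moreover have "exp (k * b) * exp (- k * b) = 1" "exp (k * b) * exp (- k * a) = exp (k * (b - a))"
    by (simp_all add: mult_exp_exp right_diff_distrib)
  ultimately show ?thesis
    by (metis mult.assoc mult_1)
qed

lemma gronwall_lower:
  fixes u :: "real \<Rightarrow> real"
  assumes "a \<le> b"
    and u: "\<And>s. s \<in> {a..b} \<Longrightarrow> (u has_real_derivative u' s) (at s within {a..b})"
    and le: "\<And>s. s \<in> {a..b} \<Longrightarrow> k * u s \<le> u' s"
  shows "exp (k * (b - a)) * u a \<le> u b"
proof -
  have "- u b \<le> exp (k * (b - a)) * - u a"
    by (rule gronwall_upper[OF \<open>a \<le> b\<close> DERIV_minus[OF u]]) (use le in simp_all)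
  then show ?thesis by simp
qed

text \<open>At the first zero \<open>e\<close> arrives from below, so its derivative there cannot be
  negative. The sign of \<open>e'\<close> is demanded at zeros only, because both applications
  control the derivative only at contact with the barrier.\<close>

lemma strict_barrier:
  fixes e :: "real \<Rightarrow> real"
  assumes e: "\<And>s. s \<in> {a..b} \<Longrightarrow> (e has_real_derivative e' s) (at s within {a..b})"
    and "e a < 0"
    and neg: "\<And>s. s \<in> {a..b} \<Longrightarrow> e s = 0 \<Longrightarrow> e' s < 0"
    and s: "s \<in> {a..b}"
  shows "e s < 0"
proof (rule ccontr)
  assume "\<not> e s < 0"
  have cont: "continuous_on {a..b} e"
    using e by (rule DERIV_continuous_on)
  \<comment> \<open>The set of bad times is compact, so there is a first one; by the intermediate
    value theorem \<open>e\<close> vanishes there.\<close>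
  define Z where "Z = {a..b} \<inter> e -` {0..}"
  have "closed Z"
    unfolding Z_def by (intro continuous_closed_preimage[OF cont]) auto
  then have "compact Z"
    using compact_Int_closed[OF compact_Icc, of Z a b] by (simp add: Z_def inf_absorb2 Int_assoc[symmetric])
  moreover have "s \<in> Z" using s \<open>\<not> e s < 0\<close> by (simp add: Z_def)
  ultimately obtain \<tau> where \<tau>: "\<tau> \<in> Z" "\<And>r. r \<in> Z \<Longrightarrow> \<tau> \<le> r"
    using compact_attains_inf[of Z] by blast
  have "a < \<tau>" "\<tau> \<le> b" using \<tau>(1) \<open>e a < 0\<close> by (auto simp: Z_def order_le_less)
  have "e \<tau> = 0"
  proof (rule ccontr)
    assume "e \<tau> \<noteq> 0"
    then have "e \<tau> > 0" using \<tau>(1) by (auto simp: Z_def)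
    moreover have "continuous_on {a..\<tau>} e"
      using cont by (rule continuous_on_subset) (use \<open>\<tau> \<le> b\<close> in auto)
    ultimately obtain r where "a \<le> r" "r \<le> \<tau>" "e r = 0"
      using IVT'[of e a 0 \<tau>] \<open>e a < 0\<close> \<open>a < \<tau>\<close> by auto
    then show False
      using \<tau>(2)[of r] \<open>e \<tau> > 0\<close> \<open>\<tau> \<le> b\<close> by (auto simp: Z_def)
  qed
  moreover have \<tau>': "\<tau> \<in> {a..b}" using \<tau>(1) by (simp add: Z_def)
  ultimately obtain d where d: "d > 0" "\<And>h. h > 0 \<Longrightarrow> \<tau> - h \<in> {a..b} \<Longrightarrow> h < d \<Longrightarrow> e \<tau> < e (\<tau> - h)"
    using has_real_derivative_neg_dec_left[OF e[OF \<tau>'] neg[OF \<tau>']] by blast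
  define h where "h = min (d/2) (\<tau> - a)"
  have h: "h > 0" "h < d" "\<tau> - h \<in> {a..b}"
    using d(1) \<open>a < \<tau>\<close> \<open>\<tau> \<le> b\<close> by (auto simp: h_def)
  then have "\<tau> - h \<in> Z" using d(2)[of h] \<open>e \<tau> = 0\<close> by (auto simp: Z_def)
  then show False using \<tau>(2)[of "\<tau> - h"] h(1) by simp
qed

lemma inner_has_real_derivative:
  fixes c d :: "real \<Rightarrow> 'a::euclidean_space"
  assumes "(c has_vector_derivative c') (at s within S)"
    and "(d has_vector_derivative d') (at s within S)"
  shows "((\<lambda>s. c s \<bullet> d s) has_real_derivative (c s \<bullet> d' + c' \<bullet> d s)) (at s within S)"
  using bounded_bilinear.has_vector_derivative[OF bounded_bilinear_inner assms]
  by (simp add: has_real_derivative_iff_has_vector_derivative)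

text \<open>Continuity in time for each fixed point and a Lipschitz bound in space, uniform in time,
  replace joint continuity. The gradient field \<open>V\<close> is known to be continuous in exactly
  this form.\<close>

lemma lipschitz_composition_continuous:
  fixes F :: "real \<Rightarrow> 'a::real_normed_vector \<Rightarrow> 'a"
  assumes cont: "\<And>x. x \<in> D \<Longrightarrow> continuous_on S (\<lambda>s. F s x)"
    and lip: "\<And>s x y. s \<in> S \<Longrightarrow> x \<in> D \<Longrightarrow> y \<in> D \<Longrightarrow> norm (F s x - F s y) \<le> L * norm (x - y)"
    and c: "continuous_on S c" "c ` S \<subseteq> D"
  shows "continuous_on S (\<lambda>s. F s (c s))"
  unfolding continuous_on_def
proof
  fix s assume s: "s \<in> S"
  have "((\<lambda>r. L * norm (c r - c s) + norm (F r (c s) - F s (c s))) \<longlongrightarrow> L * norm (c s - c s) + norm (F s (c s) - F s (c s))) (at s within S)"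
    using c s cont[of "c s"] by (intro tendsto_intros) (auto simp: continuous_on_def)
  then have "((\<lambda>r. L * norm (c r - c s) + norm (F r (c s) - F s (c s))) \<longlongrightarrow> 0) (at s within S)"
    by simp
  moreover have "\<forall>\<^sub>F r in at s within S. norm (F r (c r) - F s (c s))
      \<le> L * norm (c r - c s) + norm (F r (c s) - F s (c s))"
    unfolding eventually_at_filter
  proof (rule always_eventually, intro allI impI)
    fix r assume "r \<in> S"
    then show "norm (F r (c r) - F s (c s)) \<le> L * norm (c r - c s) + norm (F r (c s) - F s (c s))"
      using lip[of r "c r" "c s"] norm_triangle_ineq[of "F r (c r) - F r (c s)" "F r (c s) - F s (c s)"]
        c s by (auto simp: image_subset_iff)
  qed
  ultimately show "((\<lambda>r. F r (c r)) \<longlongrightarrow> F s (c s)) (at s within S)"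
    by (rule LIM_zero_cancel[OF Lim_null_comparison[rotated]])
qed

text \<open>Banach's fixed point theorem for the integral equation. The unknown is exp(-2 L s) c(s)
  rather than c(s), so no subdivision of the time interval is required.\<close>

lemma picard_lindelof:
  fixes F :: "real \<Rightarrow> 'a::euclidean_space \<Rightarrow> 'a"
  assumes T: "0 \<le> T" and L: "0 < L"
    and cont: "\<And>x. continuous_on {0..T} (\<lambda>s. F s x)"
    and lip: "\<And>s x y. s \<in> {0..T} \<Longrightarrow> norm (F s x - F s y) \<le> L * norm (x - y)"
  obtains c where "c 0 = x0"
    "\<And>s. s \<in> {0..T} \<Longrightarrow> (c has_vector_derivative F s (c s)) (at s within {0..T})"
proof -
  have contF: "continuous_on {0..T} (\<lambda>s. F s (c s))" if "continuous_on {0..T} c" for c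
    using lipschitz_composition_continuous[of UNIV "{0..T}" F L c] cont lip that by auto
  define f where "f y s = F s (exp (2 * L * s) *\<^sub>R apply_bcontfun y s)" for y s
  have contf: "continuous_on {0..T} (f y)" for y
    unfolding f_def by (intro contF continuous_intros continuous_on_apply_bcontfun)
  have intf: "f y integrable_on {0..s}" if "s \<in> {0..T}" for y s
    using contf[of y] that by (intro integrable_continuous_interval) (auto intro: continuous_on_subset)
  \<comment> \<open>With the weight \<open>exp (2 * L * s)\<close> the Picard operator is a contraction on all of \<open>[0, T]\<close>.\<close>
  define H where "H y s = exp (- (2 * L * s)) *\<^sub>R (x0 + integral {0..s} (f y))" for y s
  have contH: "continuous_on (cbox 0 T) (H y)" for y
    unfolding H_def cbox_interval
    by (intro continuous_intros indefinite_integral_continuous_1 integrable_continuous_interval contf)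
  \<comment> \<open>The complete space at hand consists of bounded continuous functions on the whole
    line; clamping time to [0, T] embeds the problem into it.\<close>
  have "\<exists>g. \<forall>s. apply_bcontfun g s = H y (clamp 0 T s)" for y
    using continuous_on_cbox_bcontfunE[OF contH[of y]] by metis
  then obtain \<Phi> where \<Phi>: "\<And>y s. apply_bcontfun (\<Phi> y) s = H y (clamp 0 T s)" by metis
  have contr: "dist (\<Phi> y) (\<Phi> z) \<le> 1/2 * dist y z" for y z
  proof (rule dist_bound)
    fix r
    define s where "s = clamp 0 T r"
    have s: "s \<in> {0..T}"
      using clamp_in_interval[of 0 T r] T unfolding s_def by (auto simp: Basis_real_def)
    define D where "D = dist y z"
    have D: "norm (apply_bcontfun y \<tau> - apply_bcontfun z \<tau>) \<le> D" for \<tau>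
      unfolding D_def dist_norm[symmetric] by (rule dist_bounded)
    \<comment> \<open>The antiderivative contributes the factor 1/(2 L), which together with the
      Lipschitz constant gives the contraction factor 1/2.\<close>
    have i: "((\<lambda>\<tau>. L * exp (2 * L * \<tau>) * D) has_integral (D / 2 * exp (2 * L * s) - D / 2 * exp (2 * L * 0))) {0..s}"
      using s L by (intro fundamental_theorem_of_calculus)
        (auto simp: has_real_derivative_iff_has_vector_derivative[symmetric] intro!: derivative_eq_intros)
    have "norm (integral {0..s} (\<lambda>\<tau>. f y \<tau> - f z \<tau>)) \<le> integral {0..s} (\<lambda>\<tau>. L * exp (2 * L * \<tau>) * D)"
    proof (rule integral_norm_bound_integral)
      show "(\<lambda>\<tau>. f y \<tau> - f z \<tau>) integrable_on {0..s}" using intf[OF s] by (intro integrable_diff)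
      show "(\<lambda>\<tau>. L * exp (2 * L * \<tau>) * D) integrable_on {0..s}" using i by blast
      fix \<tau> assume "\<tau> \<in> {0..s}"
      then have "norm (f y \<tau> - f z \<tau>) \<le> L * norm (exp (2 * L * \<tau>) *\<^sub>R (apply_bcontfun y \<tau> - apply_bcontfun z \<tau>))"
        unfolding f_def using s by (subst scaleR_diff_right) (rule lip, auto)
      also have "\<dots> \<le> L * exp (2 * L * \<tau>) * D"
        using D[of \<tau>] L by (simp add: mult_left_mono)
      finally show "norm (f y \<tau> - f z \<tau>) \<le> L * exp (2 * L * \<tau>) * D" .
    qed
    also have "\<dots> = D / 2 * (exp (2 * L * s) - 1)"
      unfolding integral_unique[OF i] by (simp add: right_diff_distrib)
    finally have *: "norm (integral {0..s} (f y) - integral {0..s} (f z)) \<le> D / 2 * (exp (2 * L * s) - 1)"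
      using intf[OF s] by (simp add: integral_diff)
    have "dist (H y s) (H z s) = exp (- (2 * L * s)) * norm (integral {0..s} (f y) - integral {0..s} (f z))"
      by (simp add: H_def dist_norm scaleR_diff_right[symmetric])
    also have "\<dots> \<le> exp (- (2 * L * s)) * (D / 2 * (exp (2 * L * s) - 1))"
      using * by (intro mult_left_mono) auto
    also have "\<dots> = D / 2 - D / 2 * exp (- (2 * L * s))"
      by (simp add: algebra_simps exp_minus)
    also have "\<dots> \<le> 1/2 * dist y z"
      by (simp add: D_def)
    finally show "dist (apply_bcontfun (\<Phi> y) r) (apply_bcontfun (\<Phi> z) r) \<le> 1/2 * dist y z"
      by (simp add: \<Phi> s_def)
  qed
  obtain y where y: "\<Phi> y = y"
    using banach_fix_type[of "1/2" \<Phi>] contr by auto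
  define c where "c s = exp (2 * L * s) *\<^sub>R apply_bcontfun y s" for s
  have c: "c s = x0 + integral {0..s} (\<lambda>\<tau>. F \<tau> (c \<tau>))" if "s \<in> {0..T}" for s
  proof -
    have "clamp 0 T s = s" using that by (auto simp: clamp_def)
    then have "apply_bcontfun y s = H y s" using \<Phi>[of y s] y by simp
    then show ?thesis
      by (simp add: c_def H_def f_def[abs_def] exp_minus)
  qed
  have contFc: "continuous_on {0..T} (\<lambda>\<tau>. F \<tau> (c \<tau>))"
    using contf[of y] unfolding f_def c_def by simp
  show ?thesis
  proof
    show "c 0 = x0" using c[of 0] T by simp
    fix s assume s: "s \<in> {0..T}"
    have "((\<lambda>r. x0 + integral {0..r} (\<lambda>\<tau>. F \<tau> (c \<tau>))) has_vector_derivative F s (c s)) (at s within {0..T})"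
      using integral_has_vector_derivative[OF contFc s]
      by (auto intro!: derivative_eq_intros)
    then show "(c has_vector_derivative F s (c s)) (at s within {0..T})"
      by (rule has_vector_derivative_transform[OF s, rotated]) (use c in auto)
  qed
qed

text \<open>Gronwall for the squared distance, which unlike the distance is differentiable where the
  curves meet. The Lipschitz bound is demanded along the two solutions only, so it may come from a
  field that is Lipschitz on \<open>Theta_bar\<close> or from a comparison with the zero
  solution.\<close>

lemma solutions_distance:
  fixes c d :: "real \<Rightarrow> 'a::euclidean_space"
  assumes "a \<le> b"
    and c: "\<And>s. s \<in> {a..b} \<Longrightarrow> (c has_vector_derivative F s (c s)) (at s within {a..b})"
    and d: "\<And>s. s \<in> {a..b} \<Longrightarrow> (d has_vector_derivative F s (d s)) (at s within {a..b})"
    and lip: "\<And>s. s \<in> {a..b} \<Longrightarrow> norm (F s (c s) - F s (d s)) \<le> L * norm (c s - d s)"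
  shows "norm (c b - d b) \<le> exp (L * (b - a)) * norm (c a - d a)"
    and "exp (- L * (b - a)) * norm (c a - d a) \<le> norm (c b - d b)"
proof -
  let ?u = "\<lambda>s. (c s - d s) \<bullet> (c s - d s)" and ?u' = "\<lambda>s. 2 * ((c s - d s) \<bullet> (F s (c s) - F s (d s)))"
  have u: "(?u has_real_derivative ?u' s) (at s within {a..b})" if "s \<in> {a..b}" for s
    using inner_has_real_derivative[OF has_vector_derivative_diff has_vector_derivative_diff,
        OF c[OF that] d[OF that] c[OF that] d[OF that]]
    by (simp add: inner_commute)
  have *: "\<bar>?u' s\<bar> \<le> 2 * L * ?u s" if "s \<in> {a..b}" for s
  proof -
    have "\<bar>(c s - d s) \<bullet> (F s (c s) - F s (d s))\<bar> \<le> norm (c s - d s) * (L * norm (c s - d s))"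
      using Cauchy_Schwarz_ineq2 lip[OF that] by (meson mult_left_mono norm_ge_zero order_trans)
    also have "\<dots> = L * ?u s" by (simp add: power2_norm_eq_inner[symmetric] power2_eq_square)
    finally show ?thesis by (simp add: abs_mult)
  qed
  have sq: "exp (k * (b - a)) * norm x = sqrt (exp (2 * k * (b - a)) * (x \<bullet> x))" for k and x :: 'a
    by (rule real_sqrt_unique[symmetric])
      (simp_all add: power_mult_distrib exp_double[symmetric] power2_norm_eq_inner mult.assoc)
  have "?u b \<le> exp (2 * L * (b - a)) * ?u a"
    using * by (intro gronwall_upper[OF \<open>a \<le> b\<close> u]) (auto simp: abs_le_iff)
  then show "norm (c b - d b) \<le> exp (L * (b - a)) * norm (c a - d a)"
    unfolding sq[of L] by (simp add: norm_eq_sqrt_inner)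
  have "exp (2 * (- L) * (b - a)) * ?u a \<le> ?u b"
  proof (rule gronwall_lower[OF \<open>a \<le> b\<close> u])
    show "2 * - L * ?u s \<le> ?u' s" if "s \<in> {a..b}" for s using *[OF that] by (simp add: abs_le_iff)
  qed auto
  then show "exp (- L * (b - a)) * norm (c a - d a) \<le> norm (c b - d b)"
    unfolding sq[of "- L"] by (simp add: norm_eq_sqrt_inner)
qed

section \<open>Smooth bump functions\<close>

text \<open>The family \<open>p (1/x) exp (-1/x)\<close>, \<open>p\<close> a polynomial, is closed under differentiation, which makes the
  following class of functions closed under directional derivatives.\<close>

definition flat :: "real poly \<Rightarrow> real \<Rightarrow> real" where
  "flat p x = (if x > 0 then poly p (1/x) * exp (- (1/x)) else 0)"

lemma flat_tendsto_0: "(flat p \<longlongrightarrow> 0) (at_right 0)"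
proof -
  have *: "((\<lambda>y::real. poly p y / exp y) \<longlongrightarrow> 0) at_top"
  proof -
    have "((\<lambda>y::real. \<Sum>i\<le>degree p. coeff p i * (y ^ i / exp y)) \<longlongrightarrow> (\<Sum>i\<le>degree p. coeff p i * 0)) at_top"
      by (intro tendsto_intros tendsto_power_div_exp_0)
    then show ?thesis by (simp add: poly_altdef sum_divide_distrib)
  qed
  have "((\<lambda>x::real. poly p (1/x) / exp (1/x)) \<longlongrightarrow> 0) (at_right 0)"
    using filterlim_compose[OF * filterlim_inverse_at_top_right]
    by (simp add: o_def inverse_eq_divide)
  moreover have "\<forall>\<^sub>F x in at_right 0. poly p (1/x) / exp (1/x) = flat p x"
    using eventually_at_right_less[of 0]
    by eventually_elim (simp add: flat_def exp_minus divide_inverse)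
  ultimately show ?thesis by (rule Lim_transform_eventually)
qed

text \<open>For x > 0 the derivative of p(1/x) exp(-1/x) is x^(-2) (p - p')(1/x) exp(-1/x); each
  \<open>pCons 0\<close> supplies one factor 1/x.\<close>

lemma flat_has_derivative:
  "(flat p has_real_derivative flat (pCons 0 (pCons 0 (p - pderiv p))) x) (at x)"
proof -
  consider "x > 0" | "x = 0" | "x < 0" by linarith
  then show ?thesis
  proof cases
    case 1
    have "((\<lambda>x. poly p (1/x) * exp (- (1/x))) has_real_derivative
            flat (pCons 0 (pCons 0 (p - pderiv p))) x) (at x)"
      using 1 by (auto intro!: derivative_eq_intros simp: flat_def field_simps power2_eq_square)
    moreover have "\<forall>\<^sub>F y in nhds x. flat p y = poly p (1/y) * exp (- (1/y))"
      using eventually_nhds_in_open[OF open_greaterThan, of x 0] 1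
      by (auto elim!: eventually_mono simp: flat_def)
    ultimately show ?thesis by (rule iffD2[OF DERIV_cong_ev[OF refl _ refl], rotated])
  next
    case 2
    have l: "((\<lambda>h. (flat p h - flat p 0) / h) \<longlongrightarrow> 0) (at_left 0)"
    proof (rule tendsto_eventually)
      show "\<forall>\<^sub>F h in at_left 0. (flat p h - flat p 0) / h = 0"
        unfolding eventually_at by (rule exI[of _ 1]) (auto simp: flat_def)
    qed
    \<comment> \<open>The difference quotient at 0 is again a function of the family, with p
      multiplied by one factor 1/x, so the derivative at 0 reduces to the limit already
      computed.\<close>
    have r: "((\<lambda>h. (flat p h - flat p 0) / h) \<longlongrightarrow> 0) (at_right 0)"
    proof (rule Lim_transform_eventually[OF flat_tendsto_0[of "pCons 0 p"]])
      show "\<forall>\<^sub>F h in at_right 0. flat (pCons 0 p) h = (flat p h - flat p 0) / h"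
        using eventually_at_right_less[of 0] by eventually_elim (simp add: flat_def)
    qed
    have "((\<lambda>h. (flat p h - flat p 0) / h) \<longlongrightarrow> 0) (at 0)"
      using l r by (simp add: filterlim_split_at_real)
    then show ?thesis unfolding 2 DERIV_def by (simp add: flat_def)
  next
    case 3
    have "((\<lambda>x. 0) has_real_derivative flat (pCons 0 (pCons 0 (p - pderiv p))) x) (at x)"
      using 3 by (auto intro!: derivative_eq_intros simp: flat_def)
    moreover have "\<forall>\<^sub>F y in nhds x. flat p y = 0"
      using eventually_nhds_in_open[OF open_lessThan, of x 0] 3
      by (auto elim!: eventually_mono simp: flat_def)
    ultimately show ?thesis by (rule iffD2[OF DERIV_cong_ev[OF refl _ refl], rotated])
  qed
qed

inductive_set smooth :: "('a::euclidean_space \<Rightarrow> real) set" where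
  const: "(\<lambda>x. c) \<in> smooth"
| inner: "(\<lambda>x. x \<bullet> v) \<in> smooth"
| add: "f \<in> smooth \<Longrightarrow> g \<in> smooth \<Longrightarrow> (\<lambda>x. f x + g x) \<in> smooth"
| mult: "f \<in> smooth \<Longrightarrow> g \<in> smooth \<Longrightarrow> (\<lambda>x. f x * g x) \<in> smooth"
| exp: "f \<in> smooth \<Longrightarrow> (\<lambda>x. exp (f x)) \<in> smooth"
| flat: "f \<in> smooth \<Longrightarrow> (\<lambda>x. flat p (f x)) \<in> smooth"

lemma smooth_sum:
  assumes "finite I" "\<And>i. i \<in> I \<Longrightarrow> f i \<in> smooth"
  shows "(\<lambda>x. \<Sum>i\<in>I. f i x) \<in> smooth"
  using assms by (induction I) (auto intro: smooth.intros)

lemma smooth_has_derivative: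
  assumes "f \<in> smooth"
  obtains D where "\<And>x. (f has_derivative D x) (at x)" "\<And>v. (\<lambda>x. D x v) \<in> smooth"
proof -
  have "\<exists>D. (\<forall>x. (f has_derivative D x) (at x)) \<and> (\<forall>v. (\<lambda>x. D x v) \<in> smooth)"
    using assms
  proof induction
    case (const c)
    show ?case by (rule exI[of _ "\<lambda>x v. 0"]) (auto intro: smooth.const)
  next
    case (inner v)
    show ?case
      by (rule exI[of _ "\<lambda>x w. w \<bullet> v"]) (auto intro: smooth.const intro!: derivative_eq_intros)
  next
    case (add f g)
    then obtain D E where
      "\<forall>x. (f has_derivative D x) (at x)" "\<forall>v. (\<lambda>x. D x v) \<in> smooth"
      "\<forall>x. (g has_derivative E x) (at x)" "\<forall>v. (\<lambda>x. E x v) \<in> smooth" by blast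
    then show ?case
      by (intro exI[of _ "\<lambda>x v. D x v + E x v"]) (auto intro: smooth.add has_derivative_add)
  next
    case (mult f g)
    then obtain D E where
      "\<forall>x. (f has_derivative D x) (at x)" "\<forall>v. (\<lambda>x. D x v) \<in> smooth"
      "\<forall>x. (g has_derivative E x) (at x)" "\<forall>v. (\<lambda>x. E x v) \<in> smooth" by blast
    with mult show ?case
      by (intro exI[of _ "\<lambda>x v. f x * E x v + D x v * g x"])
        (auto intro!: smooth.add smooth.mult has_derivative_mult)
  next
    case (exp f)
    then obtain D where
      D: "\<forall>x. (f has_derivative D x) (at x)" "\<forall>v. (\<lambda>x. D x v) \<in> smooth" by blast
    have "((\<lambda>x. exp (f x)) has_derivative (\<lambda>v. D x v * exp (f x))) (at x)" for x
      using DERIV_compose_FDERIV[OF DERIV_exp spec[OF D(1)]] .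
    with exp D show ?case
      by (intro exI[of _ "\<lambda>x v. D x v * exp (f x)"]) (auto intro!: smooth.mult smooth.exp)
  next
    case (flat f p)
    then obtain D where
      D: "\<forall>x. (f has_derivative D x) (at x)" "\<forall>v. (\<lambda>x. D x v) \<in> smooth" by blast
    have "((\<lambda>x. flat p (f x)) has_derivative
            (\<lambda>v. D x v * flat (pCons 0 (pCons 0 (p - pderiv p))) (f x))) (at x)" for x
      using DERIV_compose_FDERIV[OF flat_has_derivative spec[OF D(1)]] .
    with flat D show ?case
      by (intro exI[of _ "\<lambda>x v. D x v * flat (pCons 0 (pCons 0 (p - pderiv p))) (f x)"])
        (auto intro!: smooth.mult smooth.flat)
  qed
  then show ?thesis using that by blast
qed

text \<open>Closure of the class under directional derivatives takes the place of product and chain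
  rules for \<open>C_k\<close>.\<close>

lemma smooth_imp_C_k: "f \<in> smooth \<Longrightarrow> C_k k f"
proof (induction k arbitrary: f)
  case 0
  from smooth_has_derivative[OF 0] obtain D where "\<And>x. (f has_derivative D x) (at x)" by blast
  then have "isCont f x" for x by (rule has_derivative_continuous)
  then show ?case by (simp add: continuous_at_imp_continuous_on)
next
  case (Suc k)
  from smooth_has_derivative[OF Suc.prems] obtain D where
    D: "\<And>x. (f has_derivative D x) (at x)" "\<And>v. (\<lambda>x. D x v) \<in> smooth" by blast
  have "frechet_derivative f (at x) = D x" for x
    using frechet_derivative_at[OF D(1)] by simp
  moreover have "f differentiable at x" for x
    using D(1) by (rule differentiableI)
  ultimately show ?case using Suc.IH[OF D(2)] by simp
qed

section \<open>Probability measures on compact sets\<close>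

text \<open>The first differing digit j contributes (1/3)^j, while all later digits together can
  cancel at most half of it. With base 2 they could cancel all of it, and distinct digit sequences
  could have the same sum.\<close>

lemma ternary_digits_close:
  fixes a b :: "nat \<Rightarrow> real"
  assumes ab: "\<And>i. a i \<in> {0, 1}" "\<And>i. b i \<in> {0, 1}"
    and close: "\<bar>(\<Sum>i. a i * (1/3) ^ i) - (\<Sum>i. b i * (1/3) ^ i)\<bar> < (1/3) ^ m / 2"
    and "i \<le> m"
  shows "a i = b i"
proof (rule ccontr)
  assume "a i \<noteq> b i"
  define j where "j = (LEAST j. a j \<noteq> b j)"
  have j: "a j \<noteq> b j" and less: "\<And>k. k < j \<Longrightarrow> a k = b k" and "j \<le> m"
    using LeastI[of "\<lambda>j. a j \<noteq> b j" i] not_less_Least[of _ "\<lambda>j. a j \<noteq> b j"]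
      Least_le[of "\<lambda>j. a j \<noteq> b j" i] \<open>a i \<noteq> b i\<close> \<open>i \<le> m\<close>
    unfolding j_def[symmetric] by auto
  define d where "d k = (a k - b k) * (1/3) ^ k" for k
  have bound: "\<bar>a k - b k\<bar> \<le> 1" for k using ab(1)[of k] ab(2)[of k] by auto
  have digit_le: "\<bar>u\<bar> \<le> 1" if "u \<in> {0, 1}" for u :: real using that by auto
  have geo: "summable (\<lambda>k. (1/3) ^ (k + n) :: real)" for n
    by (subst summable_iff_shift) (simp add: summable_geometric)
  have sum: "summable (\<lambda>k. a k * (1/3) ^ k)" "summable (\<lambda>k. b k * (1/3) ^ k)"
    using ab(1)[THEN digit_le] ab(2)[THEN digit_le]
    by (auto intro!: summable_comparison_test'[OF geo[of 0]] simp: abs_mult)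
  then have "summable d"
    unfolding d_def left_diff_distrib by (rule summable_diff)
  have "(\<Sum>i. a i * (1/3) ^ i) - (\<Sum>i. b i * (1/3) ^ i) = suminf d"
    unfolding d_def left_diff_distrib by (rule suminf_diff[OF sum])
  also have "\<dots> = (\<Sum>k. d (k + Suc j)) + sum d {..<Suc j}"
    by (rule suminf_split_initial_segment[OF \<open>summable d\<close>])
  also have "sum d {..<Suc j} = d j"
    using less by (simp add: d_def)
  finally have eq: "(\<Sum>i. a i * (1/3) ^ i) - (\<Sum>i. b i * (1/3) ^ i) = (\<Sum>k. d (k + Suc j)) + d j" .
  have le: "norm (d (k + Suc j)) \<le> (1/3) ^ (k + Suc j)" for k
    using mult_right_mono[OF bound[of "k + Suc j"], of "(1/3) ^ (k + Suc j)"]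
    by (simp add: d_def abs_mult power_abs del: power_Suc add_Suc_right)
  have "\<bar>\<Sum>k. d (k + Suc j)\<bar> \<le> (\<Sum>k. (1/3) ^ (k + Suc j))"
    using norm_suminf_le[OF le geo] by simp
  also have "\<dots> = (\<Sum>k. (1/3) ^ k) * (1/3) ^ Suc j"
    unfolding power_add by (rule suminf_mult2[symmetric]) (simp add: summable_geometric)
  also have "\<dots> = (1/3) ^ j / 2"
    by (simp add: suminf_geometric)
  finally have "\<bar>\<Sum>k. d (k + Suc j)\<bar> \<le> (1/3) ^ j / 2" .
  moreover have "\<bar>d j\<bar> = (1/3) ^ j"
    using j ab(1)[of j] ab(2)[of j] by (auto simp: d_def)
  ultimately have "(1/3) ^ j / 2 \<le> \<bar>(\<Sum>k. d (k + Suc j)) + d j\<bar>" by linarith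
  moreover have "(1/3) ^ m / 2 \<le> ((1/3) ^ j / 2 :: real)"
    using \<open>j \<le> m\<close> by (intro divide_right_mono power_decreasing) auto
  ultimately show False using close eq by linarith
qed

text \<open>A compact set embeds measurably, with continuous inverse, into the line: the ternary digits of
  \<open>e x\<close> record which balls of finer and finer finite covers contain \<open>x\<close>. This transfers Helly's
  selection theorem from the line to compact sets.\<close>

lemma compact_coding:
  fixes K :: "'a::euclidean_space set"
  assumes "compact K" "K \<noteq> {}"
  obtains e :: "'a \<Rightarrow> real" and \<gamma> :: "real \<Rightarrow> 'a" and M where
    "e \<in> borel_measurable borel" "\<And>x. e x \<in> {0..2}"
    "continuous_on UNIV \<gamma>" "\<And>z. norm (\<gamma> z) \<le> M" "\<And>x. x \<in> K \<Longrightarrow> \<gamma> (e x) = x"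
proof -
  have "\<forall>k::nat. \<exists>F. finite F \<and> K \<subseteq> (\<Union>x\<in>F. ball x (1 / (real k + 1)))"
    using \<open>compact K\<close> unfolding compact_eq_totally_bounded by auto
  then obtain F :: "nat \<Rightarrow> 'a set" where "\<forall>k::nat. finite (F k) \<and> K \<subseteq> (\<Union>x\<in>F k. ball x (1 / (real k + 1)))"
    by (rule exE[OF choice])
  then have F: "\<And>k::nat. finite (F k)" "\<And>k::nat. K \<subseteq> (\<Union>x\<in>F k. ball x (1 / (real k + 1)))"
    by blast+
  define \<B> where "\<B> = (\<Union>k::nat. (\<lambda>x. ball x (1 / (real k + 1))) ` F k)"
  have "countable \<B>" unfolding \<B>_def using F(1) by (auto intro: countable_finite)
  have "\<B> \<noteq> {}" using F(2)[of 0] \<open>K \<noteq> {}\<close> by (auto simp: \<B>_def)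
  define B where "B = from_nat_into \<B>"
  have range: "range B = \<B>"
    unfolding B_def by (rule range_from_nat_into) fact+
  have [measurable]: "B i \<in> sets borel" for i
  proof -
    have "B i \<in> \<B>" using range by blast
    then show ?thesis by (auto simp: \<B>_def)
  qed
  define e :: "'a \<Rightarrow> real" where "e x = (\<Sum>i. indicator (B i) x * (1/3) ^ i)" for x
  have ind: "indicator (B i) x \<in> {0, 1::real}" for i x by (auto simp: indicator_def)
  have sume: "summable (\<lambda>i. indicator (B i) x * (1/3) ^ i :: real)" for x
    by (rule summable_comparison_test'[of "\<lambda>i. (1/3) ^ i"])
      (auto simp: summable_geometric indicator_def)
  have e02: "e x \<in> {0..2}" for x
  proof -
    have "e x \<le> (\<Sum>i. (1/3) ^ i)"
      unfolding e_def by (intro suminf_le sume) (auto simp: summable_geometric indicator_def)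
    moreover have "0 \<le> e x"
      unfolding e_def by (intro suminf_nonneg sume) auto
    ultimately show ?thesis by (simp add: suminf_geometric)
  qed
  have "e \<in> borel_measurable borel"
    unfolding e_def by measurable
  have *: "\<exists>\<delta>>0. \<forall>x\<in>K. \<forall>y\<in>K. dist (e x) (e y) < \<delta> \<longrightarrow> dist x y < \<epsilon>" if "\<epsilon> > 0" for \<epsilon>
  proof -
    obtain k :: nat where k: "2 / (real k + 1) < \<epsilon>"
    proof -
      obtain k :: nat where "2 / \<epsilon> < k" using reals_Archimedean2 by blast
      then have "2 < \<epsilon> * (real k + 1)" using \<open>\<epsilon> > 0\<close> by (simp add: field_simps)
      then show thesis using that[of k] by (simp add: field_simps)
    qed
    have "\<forall>x\<in>F k. \<exists>i. ball x (1 / (real k + 1)) = B i"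
      using range unfolding \<B>_def by blast
    then obtain i where i: "\<And>x. x \<in> F k \<Longrightarrow> ball x (1 / (real k + 1)) = B (i x)" by metis
    \<comment> \<open>All balls of the k-th cover have index at most m, so agreement of the digits
      up to m puts x and y into a common ball of radius 1/(k + 1).\<close>
    define m where "m = Max (i ` F k)"
    show ?thesis
    proof (intro exI[of _ "(1/3) ^ m / 2"] conjI ballI impI)
      fix x y assume "x \<in> K" "y \<in> K" and "dist (e x) (e y) < (1/3) ^ m / 2"
      obtain z where z: "z \<in> F k" "x \<in> ball z (1 / (real k + 1))"
        using F(2)[of k] \<open>x \<in> K\<close> by blast
      have "i z \<le> m" using z(1) F(1) by (simp add: m_def)
      then have "indicator (B (i z)) x = (indicator (B (i z)) y :: real)"
        using ternary_digits_close[of "\<lambda>i. indicator (B i) x" "\<lambda>i. indicator (B i) y" m "i z", OF ind ind] \<open>dist (e x) (e y) < (1/3) ^ m / 2\<close>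
        unfolding e_def dist_real_def by blast
      then have "y \<in> ball z (1 / (real k + 1))"
        using z i[OF z(1)] by (auto simp: indicator_def split: if_splits)
      then show "dist x y < \<epsilon>"
        using z(2) k dist_triangle2[of x y z] by (auto simp: dist_commute)
    qed simp
  qed
  have inj: "inj_on e K"
    using * by (intro inj_onI) (metis dist_self dist_pos_lt less_irrefl)
  \<comment> \<open>The code \<open>e\<close> is merely measurable, but its inverse is uniformly
    continuous; it extends to the closure of the codes, and by Tietze to the line with the same
    bound.\<close>
  have "uniformly_continuous_on (e ` K) (the_inv_into K e)"
    unfolding uniformly_continuous_on_def using * by (auto simp: the_inv_into_f_f[OF inj] dist_commute)
  then obtain g where g: "uniformly_continuous_on (closure (e ` K)) g"
    "\<And>z. z \<in> e ` K \<Longrightarrow> the_inv_into K e z = g z"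
    by (rule uniformly_continuous_on_extension_on_closure) blast
  have "bounded (e ` K)"
    using e02 by (intro bounded_subset[OF bounded_closed_interval[of 0 2]] image_subsetI)
  then have "compact (g ` closure (e ` K))"
    using g(1) by (intro compact_continuous_image uniformly_continuous_imp_continuous) (auto simp: compact_closure)
  then have "bounded (g ` closure (e ` K))" by (rule compact_imp_bounded)
  then obtain M where "\<forall>y \<in> g ` closure (e ` K). norm y \<le> M" unfolding bounded_iff by blast
  then have M: "\<And>z. z \<in> closure (e ` K) \<Longrightarrow> norm (g z) \<le> M" by blast
  obtain x where "x \<in> K" using \<open>K \<noteq> {}\<close> by blast
  then have "0 \<le> M"
    using M[of "e x"] closure_subset[of "e ` K"] by (meson image_eqI norm_ge_zero order_trans subsetD)
  have "closedin (top_of_set UNIV) (closure (e ` K))" by simp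
  then obtain \<gamma> where \<gamma>: "continuous_on UNIV \<gamma>" "\<And>z. z \<in> closure (e ` K) \<Longrightarrow> \<gamma> z = g z" "\<And>z. norm (\<gamma> z) \<le> M"
    using Tietze[OF uniformly_continuous_imp_continuous[OF g(1)] _ \<open>0 \<le> M\<close> M] by (metis UNIV_I)
  have "\<gamma> (e x) = x" if "x \<in> K" for x
    using \<gamma>(2)[of "e x"] g(2)[of "e x"] that closure_subset[of "e ` K"]
    by (auto simp: the_inv_into_f_f[OF inj])
  then show ?thesis
    using that[OF \<open>e \<in> borel_measurable borel\<close> e02 \<gamma>(1,3)] by blast
qed

text \<open>Weak convergence on the line is applied to f composed with \<gamma>, which is bounded
  and continuous even where \<open>e\<close> jumps; since \<gamma> inverts \<open>e\<close> on K,
  the integrals are those of f itself.\<close>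

lemma compact_prob_subsequence:
  fixes K :: "'a::euclidean_space set" and \<nu> :: "nat \<Rightarrow> 'a measure"
  assumes "compact K"
    and prob: "\<And>n. prob_space (\<nu> n)" and sets: "\<And>n. sets (\<nu> n) = sets borel"
    and K: "\<And>n. AE x in \<nu> n. x \<in> K"
  obtains r \<mu> where "strict_mono (r :: nat \<Rightarrow> nat)" "prob_space \<mu>" "sets \<mu> = sets borel"
    "AE x in \<mu>. x \<in> K"
    "\<And>f :: 'a \<Rightarrow> real. continuous_on UNIV f \<Longrightarrow> (\<lambda>n. LINT x|\<nu> (r n). f x) \<longlonglongrightarrow> (LINT x|\<mu>. f x)"
proof -
  have "K \<noteq> {}"
    using K[of 0] prob_space.AE_False[OF prob[of 0]] by auto
  from compact_coding[OF \<open>compact K\<close> this] obtain e and \<gamma> :: "real \<Rightarrow> 'a" and M where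
    e[measurable]: "e \<in> borel_measurable borel" and e02: "\<And>x. e x \<in> {0..2}" and
    \<gamma>: "continuous_on UNIV \<gamma>" "\<And>z. norm (\<gamma> z) \<le> M" "\<And>x. x \<in> K \<Longrightarrow> \<gamma> (e x) = x" by metis
  note [measurable_cong] = sets
  have [measurable]: "\<gamma> \<in> borel_measurable borel"
    using \<gamma>(1) by (rule borel_measurable_continuous_onI)
  define D where "D n = distr (\<nu> n) borel e" for n
  have D: "real_distribution (D n)" for n
    unfolding D_def using prob by (intro real_distribution.intro prob_space.prob_space_distr real_distribution_axioms.intro) auto
  have "tight D"
    unfolding tight_def
  proof (intro conjI allI impI D)
    fix \<epsilon> :: real assume "\<epsilon> > 0"
    \<comment> \<open>All codes lie in [0, 2], so this half-open interval has full mass.\<close>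
    have "1 - \<epsilon> < measure (D n) {-1<..3}" for n
    proof -
    have "measure (D n) {-1<..3} = measure (\<nu> n) (e -` {-1<..3} \<inter> space (\<nu> n))"
      unfolding D_def by (rule measure_distr) auto
    also have "e -` {-1<..3} \<inter> space (\<nu> n) = space (\<nu> n)"
    proof -
      have "e x \<in> {-1<..3}" for x using e02[of x] by auto
      then show ?thesis by blast
    qed
    also have "measure (\<nu> n) \<dots> = 1" using prob by (rule prob_space.prob_space)
    finally show ?thesis using \<open>\<epsilon> > 0\<close> by simp
    qed
    then show "\<exists>a b. a < b \<and> (\<forall>n. 1 - \<epsilon> < measure (D n) {a<..b})"
      by (intro exI[of _ "-1"] exI[of _ 3]) simp
  qed
  then obtain r M' where r: "strict_mono (r :: nat \<Rightarrow> nat)" and M': "real_distribution M'"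
    and weak: "weak_conv_m (\<lambda>n. D (r n)) M'"
    using tight_imp_convergent_subsubsequence[of D id] by (auto simp: strict_mono_def comp_def)
  interpret M': real_distribution M' by fact
  define \<mu> where "\<mu> = distr M' borel \<gamma>"
  have conv: "(\<lambda>n. LINT x|\<nu> (r n). f x) \<longlonglongrightarrow> (LINT x|\<mu>. f x)" if f: "continuous_on UNIV f" for f :: "'a \<Rightarrow> real"
  proof -
    have [measurable]: "f \<in> borel_measurable borel" using f by (rule borel_measurable_continuous_onI)
    obtain B where B: "\<And>x. x \<in> cball 0 M \<Longrightarrow> norm (f x) \<le> B"
      using compact_imp_bounded[OF compact_continuous_image[OF continuous_on_subset[OF f] compact_cball]]
      unfolding bounded_iff by (metis image_eqI subset_UNIV)
    have "(\<lambda>n. LINT z|D (r n). f (\<gamma> z)) \<longlonglongrightarrow> (LINT z|M'. f (\<gamma> z))"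
    proof (rule weak_conv_imp_integral_bdd_continuous_conv[OF D M' weak])
      show "isCont (\<lambda>z. f (\<gamma> z)) z" for z
        using continuous_on_compose2[OF f \<gamma>(1)] by (simp add: continuous_on_eq_continuous_at)
      show "norm (f (\<gamma> z)) \<le> B" for z using B \<gamma>(2) by simp
    qed
    moreover have "(LINT z|D n. f (\<gamma> z)) = (LINT x|\<nu> n. f x)" for n
    proof -
      have "(LINT z|D n. f (\<gamma> z)) = (LINT x|\<nu> n. f (\<gamma> (e x)))"
        unfolding D_def by (rule integral_distr) auto
      also have "\<dots> = (LINT x|\<nu> n. f x)"
        using K[of n] by (intro integral_cong_AE) (auto simp: \<gamma>(3) elim: eventually_mono)
      finally show ?thesis .
    qed
    moreover have "(LINT z|M'. f (\<gamma> z)) = (LINT x|\<mu>. f x)"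
      unfolding \<mu>_def by (rule integral_distr[symmetric]) auto
    ultimately show ?thesis by simp
  qed
  have \<mu>: "prob_space \<mu>" unfolding \<mu>_def by (rule M'.prob_space_distr) simp
  then interpret \<mu>: prob_space \<mu> .
  have [measurable_cong]: "sets \<mu> = sets borel" by (simp add: \<mu>_def)
  \<comment> \<open>The limit stays on K because the distance to the closed set K is continuous and
    its vanishing integral passes to the limit.\<close>
  have "(LINT x|\<nu> n. infdist x K) = 0" for n
    using K[of n] by (intro integral_eq_zero_AE) (auto elim: eventually_mono)
  then have zero: "(LINT x|\<mu>. infdist x K) = 0"
    using conv[of "\<lambda>x. infdist x K"] by (simp add: LIMSEQ_const_iff continuous_on_infdist)
  have [measurable]: "(\<lambda>x. infdist x K) \<in> borel_measurable borel"
    by (intro borel_measurable_continuous_onI continuous_intros)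
  have "AE x in \<mu>. norm (infdist x K) \<le> infdist 0 K + M"
    unfolding \<mu>_def
  proof (subst AE_distr_iff)
    show "AE z in M'. norm (infdist (\<gamma> z) K) \<le> infdist 0 K + M"
      using \<gamma>(2) by (intro AE_I2) (metis abs_of_nonneg add_mono_thms_linordered_semiring(2) dist_0_norm dist_commute infdist_nonneg infdist_triangle order_trans real_norm_def)
  qed auto
  then have "integrable \<mu> (\<lambda>x. infdist x K)"
    by (intro \<mu>.integrable_const_bound) auto
  then have "AE x in \<mu>. infdist x K = 0"
    using zero by (subst (asm) integral_nonneg_eq_0_iff_AE) (auto intro!: AE_I2 infdist_nonneg)
  then have "AE x in \<mu>. x \<in> K"
    using in_closed_iff_infdist_zero[OF compact_imp_closed[OF \<open>compact K\<close>] \<open>K \<noteq> {}\<close>] by simp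
  then show ?thesis using that[OF r \<mu> _ _ conv] by (simp add: \<mu>_def)
qed

section \<open>The parameter cone and the network\<close>

lemma Theta_bar_eq: "(Theta_bar :: 'n::finite param set) = {(a, w, b). a\<^sup>2 \<le> (norm w)\<^sup>2 + b\<^sup>2}"
proof
  have "closed {\<theta> :: 'n param. (fst \<theta>)\<^sup>2 \<le> (norm (fst (snd \<theta>)))\<^sup>2 + (snd (snd \<theta>))\<^sup>2}"
    by (intro closed_Collect_le continuous_intros)
  then show "(Theta_bar :: 'n param set) \<subseteq> {(a, w, b). a\<^sup>2 \<le> (norm w)\<^sup>2 + b\<^sup>2}"
    by (intro closure_minimal) (auto simp: Theta_def case_prod_unfold)
  show "{(a, w, b). a\<^sup>2 \<le> (norm w)\<^sup>2 + b\<^sup>2} \<subseteq> (Theta_bar :: 'n param set)"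
  proof clarify
    fix a b :: real and w :: "real ^ 'n" assume *: "a\<^sup>2 \<le> (norm w)\<^sup>2 + b\<^sup>2"
    \<comment> \<open>Moving b away from 0 strictly increases b^2; the sign of the move is that of
      b, with either sign possible at b = 0.\<close>
    define s :: real where "s = (if 0 \<le> b then 1 else -1)"
    define f where "f n = (a, w, b + s * inverse (Suc n))" for n
    have "f \<longlonglongrightarrow> (a, w, b + s * 0)"
      unfolding f_def by (intro tendsto_intros LIMSEQ_inverse_real_of_nat)
    moreover have "f n \<in> Theta" for n
    proof -
      have "0 < (s * inverse (Suc n))\<^sup>2" "0 \<le> 2 * b * (s * inverse (Suc n))"
        by (auto simp: s_def mult_nonneg_nonneg mult_nonpos_nonneg)
      then show ?thesis
        unfolding Theta_def f_def using * by (simp only: mem_Collect_eq case_prod_conv power2_sum)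
    qed
    ultimately show "(a, w, b) \<in> Theta_bar"
      by (auto simp: closure_sequential)
  qed
qed

lemma open_Theta: "open (Theta :: 'n::finite param set)"
proof -
  have "open {\<theta> :: 'n param. (fst \<theta>)\<^sup>2 < (norm (fst (snd \<theta>)))\<^sup>2 + (snd (snd \<theta>))\<^sup>2}"
    by (intro open_Collect_less continuous_intros)
  then show ?thesis by (simp add: Theta_def case_prod_unfold)
qed

lemma Theta_scaleR_iff: "r > 0 \<Longrightarrow> r *\<^sub>R \<theta> \<in> Theta \<longleftrightarrow> \<theta> \<in> Theta"
  by (cases \<theta>) (simp add: Theta_def power_mult_distrib flip: distrib_left)

lemma Theta_bar_scaleR: "\<theta> \<in> Theta_bar \<Longrightarrow> r *\<^sub>R \<theta> \<in> Theta_bar"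
  by (cases \<theta>) (simp add: Theta_bar_eq power_mult_distrib mult_left_mono flip: distrib_left)

lemma zero_notin_Theta: "0 \<notin> Theta"
  by (simp add: Theta_def zero_prod_def)

lemma zero_in_Theta_bar: "0 \<in> Theta_bar"
  by (simp add: Theta_bar_eq zero_prod_def)

lemma halfspace_scaleR: "r > 0 \<Longrightarrow> halfspace (r *\<^sub>R w) (r * b) = halfspace w b"
  by (auto simp: halfspace_def zero_less_mult_iff simp flip: distrib_left)

section \<open>The activation, its derivative and homogeneity\<close>

lemma relu'_eq_indicator: "relu' (w \<bullet> x + b) = indicator (halfspace w b) x"
  by (simp add: relu'_def halfspace_def indicator_def)

lemma relu_eq: "relu z = relu' z * z"
  by (simp add: relu_def relu'_def indicator_def)

lemma relu_lipschitz: "\<bar>relu z - relu z'\<bar> \<le> \<bar>z - z'\<bar>"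
  by (simp add: relu_def max_def)

lemma abs_relu_le: "\<bar>relu z\<bar> \<le> \<bar>z\<bar>"
  by (simp add: relu_def)

lemma relu'_cases: "relu' z = 0 \<or> relu' z = 1"
  by (simp add: relu'_def indicator_def)

text \<open>Both one-sided bounds come from the convexity of \<^const>\<open>relu\<close>.\<close>

lemma relu_taylor: "\<bar>relu z' - relu z - relu' z * (z' - z)\<bar> \<le> \<bar>relu' z - relu' z'\<bar> * \<bar>z - z'\<bar>"
  by (auto simp: relu_def relu'_def indicator_def)

lemma phi_scaleR: "r > 0 \<Longrightarrow> phi (r *\<^sub>R \<theta>) x = r\<^sup>2 * phi \<theta> x"
proof (cases \<theta>)
  case (fields a w b)
  assume "r > 0"
  then have "relu (r * (w \<bullet> x) + r * b) = r * relu (w \<bullet> x + b)"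
    by (simp add: relu_def max_def zero_le_mult_iff mult_le_0_iff flip: distrib_left)
  then show ?thesis by (simp add: fields phi_def power2_eq_square)
qed

lemma grad_phi_scaleR: "r > 0 \<Longrightarrow> grad_phi (r *\<^sub>R \<theta>) x = r *\<^sub>R grad_phi \<theta> x"
proof (cases \<theta>)
  case (fields a w b)
  assume "r > 0"
  then have "relu (r * (w \<bullet> x) + r * b) = r * relu (w \<bullet> x + b)"
    "relu' (r * (w \<bullet> x) + r * b) = relu' (w \<bullet> x + b)"
    by (simp_all add: relu_def relu'_def indicator_def max_def zero_le_mult_iff zero_less_mult_iff mult_le_0_iff
        flip: distrib_left)
  then show ?thesis by (simp add: fields grad_phi_def)
qed

text \<open>Euler's identity for a function homogeneous of degree two. It lets the potential be
  recovered from the field.\<close>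

lemma inner_grad_phi: "\<theta> \<bullet> grad_phi \<theta> x = 2 * phi \<theta> x"
  by (cases \<theta>) (simp add: grad_phi_def phi_def relu_eq inner_prod_def algebra_simps)

text \<open>Both sides equal \<open>phi \<theta> x\<close>. Integrated along a trajectory, the
  identity says that a^2 - |w|^2 - b^2 is constant.\<close>

lemma grad_phi_conservation:
  "fst \<theta> * fst (grad_phi \<theta> x) = snd \<theta> \<bullet> snd (grad_phi \<theta> x)"
  by (cases \<theta>) (simp add: grad_phi_def relu_eq inner_prod_def algebra_simps)

lemma phi_uminus_fst: "phi (- a, u) x = - phi (a, u) x"
  by (cases u) (simp add: phi_def)

text \<open>This is the norm of (x, 1), the natural weight since w x + b is the inner product of (w,
  b) and (x, 1); it is also the density in the Lipschitz assumption on halfspaces.\<close>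

definition weight :: "real ^ ('n::finite) \<Rightarrow> real" where
  "weight x = sqrt (1 + (norm x)\<^sup>2)"

lemma weight_ge_1: "1 \<le> weight x"
  by (simp add: weight_def)

lemma weight_le: "weight x \<le> 1 + norm x"
  unfolding weight_def by (rule real_le_lsqrt) (auto simp: power2_sum)

lemma norm_pair_1: "norm (x, 1::real) = weight x"
  by (simp add: norm_prod_def weight_def add.commute)

section \<open>Growth and regularity in the parameters\<close>

lemma preactivation_bound: "\<bar>w \<bullet> x + b\<bar> \<le> norm (w, b) * weight x"
  using Cauchy_Schwarz_ineq2[of "(w, b)" "(x, 1)"] by (simp add: inner_prod_def norm_pair_1)

lemma norm_snd_le: "norm (snd \<theta>) \<le> norm \<theta>" and norm_fst_le: "norm (fst \<theta>) \<le> norm \<theta>"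
  by (cases \<theta>; simp add: norm_prod_def)+

lemma norm_Pair2: "norm (0, y) = norm y"
  by (simp add: norm_Pair)

lemma norm_triple_le:
  fixes x :: "real ^ 'n::finite"
  shows "norm (p :: real, s *\<^sub>R x, s) \<le> \<bar>p\<bar> + \<bar>s\<bar> * weight x"
proof -
  have "(p, s *\<^sub>R x, s) = (p, 0) + (0, s *\<^sub>R x, s)"
    by (simp add: zero_prod_def)
  then have "norm (p, s *\<^sub>R x, s) \<le> norm (p, 0 :: (real ^ 'n) \<times> real) + norm (0 :: real, s *\<^sub>R x, s)"
    by (metis norm_triangle_ineq)
  moreover have "(s *\<^sub>R x, s) = s *\<^sub>R (x, 1)" by simp
  then have "norm (0 :: real, s *\<^sub>R x, s) = \<bar>s\<bar> * weight x"
    by (metis norm_Pair2 norm_scaleR norm_pair_1)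
  moreover have "norm (p, 0 :: (real ^ 'n) \<times> real) = \<bar>p\<bar>" by (simp add: norm_Pair)
  ultimately show ?thesis by simp
qed

lemma phi_bound: "\<bar>phi \<theta> x\<bar> \<le> (norm \<theta>)\<^sup>2 * weight x"
proof (cases \<theta>)
  case (fields a w b)
  have "\<bar>relu (w \<bullet> x + b)\<bar> \<le> norm (w, b) * weight x"
    using abs_relu_le preactivation_bound by (rule order_trans)
  also have "\<dots> \<le> norm \<theta> * weight x"
    using norm_snd_le[of \<theta>] weight_ge_1[of x] by (intro mult_right_mono) (auto simp: fields)
  finally have "\<bar>a\<bar> * \<bar>relu (w \<bullet> x + b)\<bar> \<le> norm \<theta> * (norm \<theta> * weight x)"
    using norm_fst_le[of \<theta>] by (intro mult_mono) (auto simp: fields)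
  then show ?thesis by (simp add: fields phi_def abs_mult power2_eq_square)
qed

lemma grad_phi_bound: "norm (grad_phi \<theta> x) \<le> 2 * norm \<theta> * weight x"
proof (cases \<theta>)
  case (fields a w b)
  have w: "0 \<le> weight x" using weight_ge_1[of x] by simp
  have "\<bar>relu (w \<bullet> x + b)\<bar> \<le> norm (w, b) * weight x"
    using abs_relu_le preactivation_bound by (rule order_trans)
  also have "\<dots> \<le> norm \<theta> * weight x"
    using norm_snd_le[of \<theta>] w by (intro mult_right_mono) (auto simp: fields)
  finally have "\<bar>relu (w \<bullet> x + b)\<bar> \<le> norm \<theta> * weight x" .
  moreover have "\<bar>a * relu' (w \<bullet> x + b)\<bar> * weight x \<le> norm \<theta> * weight x"
    using norm_fst_le[of \<theta>] relu'_cases[of "w \<bullet> x + b"] w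
    by (intro mult_right_mono) (auto simp: fields)
  ultimately show ?thesis
    using norm_triple_le[of "relu (w \<bullet> x + b)" "a * relu' (w \<bullet> x + b)" x]
    by (simp add: fields grad_phi_def)
qed

text \<open>The first summand collects what is Lipschitz in the parameters. The second is the jump
  of the activation: it lives where the two halfspaces differ and carries the factor |a'|, which
  later pays for the singularity at (w', b') = 0.\<close>

lemma grad_phi_difference:
  fixes a a' b b' :: real
  shows "norm (grad_phi (a, w, b) x - grad_phi (a', w', b') x)
    \<le> 2 * norm ((a, w, b) - (a', w', b')) * weight x
      + \<bar>a'\<bar> * (\<bar>indicator (halfspace w b) x - indicator (halfspace w' b') x\<bar> * weight x)"
proof -
  define z z' where "z = w \<bullet> x + b" and "z' = w' \<bullet> x + b'"
  define N where "N = norm ((a, w, b) - (a', w', b'))"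
  have w: "0 \<le> weight x" using weight_ge_1[of x] by simp
  have "\<bar>relu z - relu z'\<bar> \<le> \<bar>z - z'\<bar>" by (rule relu_lipschitz)
  also have "z - z' = (w - w') \<bullet> x + (b - b')" by (simp add: z_def z'_def inner_diff_left)
  also have "\<bar>\<dots>\<bar> \<le> norm (w - w', b - b') * weight x" by (rule preactivation_bound)
  also have "\<dots> \<le> N * weight x"
    using norm_snd_le[of "(a, w, b) - (a', w', b')"] w by (intro mult_right_mono) (auto simp: N_def)
  finally have 1: "\<bar>relu z - relu z'\<bar> \<le> N * weight x" .
  have "\<bar>a * relu' z - a' * relu' z'\<bar> \<le> \<bar>a - a'\<bar> + \<bar>a'\<bar> * \<bar>relu' z - relu' z'\<bar>"
    using relu'_cases[of z] relu'_cases[of z'] by auto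
  also have "\<bar>a - a'\<bar> \<le> N"
    using norm_fst_le[of "(a, w, b) - (a', w', b')"] by (simp add: N_def)
  finally have "\<bar>a * relu' z - a' * relu' z'\<bar> * weight x \<le> (N + \<bar>a'\<bar> * \<bar>relu' z - relu' z'\<bar>) * weight x"
    using w by (intro mult_right_mono) auto
  moreover have "grad_phi (a, w, b) x - grad_phi (a', w', b') x
      = (relu z - relu z', (a * relu' z - a' * relu' z') *\<^sub>R x, a * relu' z - a' * relu' z')"
    by (simp add: grad_phi_def z_def z'_def scaleR_diff_left)
  ultimately show ?thesis
    using norm_triple_le[of "relu z - relu z'" "a * relu' z - a' * relu' z'" x] 1
    unfolding N_def[symmetric] relu'_eq_indicator[symmetric] z_def[symmetric] z'_def[symmetric] distrib_right mult.assoc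
    by (smt (verit))
qed

text \<open>The remainder splits into the product of the increments of a and of the activation,
  which is quadratic, and a times the remainder of \<open>relu\<close>. The latter is only of first
  order, but lives where the halfspaces differ, so averaging over the data supplies the second
  order.\<close>

lemma phi_taylor:
  fixes a a' b b' :: real
  shows "\<bar>phi (a', w', b') x - phi (a, w, b) x - grad_phi (a, w, b) x \<bullet> ((a', w', b') - (a, w, b))\<bar>
    \<le> (norm ((a', w', b') - (a, w, b)))\<^sup>2 * weight x
      + \<bar>a\<bar> * norm ((a', w', b') - (a, w, b)) *
        (\<bar>indicator (halfspace w b) x - indicator (halfspace w' b') x\<bar> * weight x)"
proof -
  define z z' where "z = w \<bullet> x + b" and "z' = w' \<bullet> x + b'"
  define N where "N = norm ((a', w', b') - (a, w, b))"
  have w: "0 \<le> weight x" using weight_ge_1[of x] by simp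
  have "z' - z = (w' - w) \<bullet> x + (b' - b)" by (simp add: z_def z'_def inner_diff_left)
  then have "\<bar>z' - z\<bar> \<le> norm (w' - w, b' - b) * weight x" using preactivation_bound by metis
  also have "\<dots> \<le> N * weight x"
    using norm_snd_le[of "(a', w', b') - (a, w, b)"] w by (intro mult_right_mono) (auto simp: N_def)
  finally have z: "\<bar>z' - z\<bar> \<le> N * weight x" .
  have N: "\<bar>a' - a\<bar> \<le> N" "0 \<le> N"
    using norm_fst_le[of "(a', w', b') - (a, w, b)"] by (simp_all add: N_def)
  have "phi (a', w', b') x - phi (a, w, b) x - grad_phi (a, w, b) x \<bullet> ((a', w', b') - (a, w, b))
      = (a' - a) * (relu z' - relu z) + a * (relu z' - relu z - relu' z * (z' - z))"
    by (simp add: phi_def grad_phi_def z_def z'_def inner_prod_def inner_diff_right inner_commute algebra_simps)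
  also have "\<bar>\<dots>\<bar> \<le> \<bar>a' - a\<bar> * \<bar>relu z' - relu z\<bar> + \<bar>a\<bar> * \<bar>relu z' - relu z - relu' z * (z' - z)\<bar>"
    by (simp add: abs_mult[symmetric])
  also have "\<dots> \<le> N * (N * weight x) + \<bar>a\<bar> * (\<bar>relu' z - relu' z'\<bar> * (N * weight x))"
  proof (intro add_mono mult_mono[OF order_refl] mult_mono[OF N(1)])
    show "\<bar>relu z' - relu z\<bar> \<le> N * weight x" using relu_lipschitz z by (rule order_trans)
    have "\<bar>relu z' - relu z - relu' z * (z' - z)\<bar> \<le> \<bar>relu' z - relu' z'\<bar> * \<bar>z' - z\<bar>"
      using relu_taylor[of z' z] by (simp add: abs_minus_commute)
    also have "\<dots> \<le> \<bar>relu' z - relu' z'\<bar> * (N * weight x)" using z by (intro mult_left_mono) auto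
    finally show "\<bar>relu z' - relu z - relu' z * (z' - z)\<bar> \<le> \<bar>relu' z - relu' z'\<bar> * (N * weight x)" .
  qed (use N in auto)
  also have "\<dots> = N\<^sup>2 * weight x + \<bar>a\<bar> * N * (\<bar>relu' z - relu' z'\<bar> * weight x)"
    by (simp add: power2_eq_square)
  finally show ?thesis
    unfolding N_def[symmetric] relu'_eq_indicator[symmetric] z_def[symmetric] z'_def[symmetric] .
qed

text \<open>Normalization is Lipschitz with a constant inversely proportional to the norm; the
  prefactor removes this singularity.\<close>

lemma norm_scaled_normalized_diff:
  fixes u u' :: "'a::real_normed_vector"
  assumes "u \<noteq> 0" "u' \<noteq> 0"
  shows "norm u' * norm (u /\<^sub>R norm u - u' /\<^sub>R norm u') \<le> 2 * norm (u - u')"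
proof -
  have "norm u' * norm (u /\<^sub>R norm u - u' /\<^sub>R norm u') = norm (norm u' *\<^sub>R (u /\<^sub>R norm u - u' /\<^sub>R norm u'))"
    by simp
  also have "norm u' *\<^sub>R (u /\<^sub>R norm u - u' /\<^sub>R norm u') = (norm u' - norm u) *\<^sub>R (u /\<^sub>R norm u) + (u - u')"
    using assms by (simp add: algebra_simps)
  also have "norm \<dots> \<le> norm ((norm u' - norm u) *\<^sub>R (u /\<^sub>R norm u)) + norm (u - u')"
    by (rule norm_triangle_ineq)
  also have "norm ((norm u' - norm u) *\<^sub>R (u /\<^sub>R norm u)) = \<bar>norm u' - norm u\<bar> * norm (u /\<^sub>R norm u)"
    by (rule norm_scaleR)
  also have "norm (u /\<^sub>R norm u) = 1" using assms by simp
  also have "\<bar>norm u' - norm u\<bar> * 1 + norm (u - u') \<le> 2 * norm (u - u')"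
    using norm_triangle_ineq3[of u' u] by (simp add: norm_minus_commute)
  finally show ?thesis .
qed

section \<open>Gradients for bounded weights\<close>

text \<open>The weight \<open>q\<close> stands for the derivative of the loss at the current
  network. Estimates that depend on \<open>q\<close> only through a bound hold uniformly along the
  flow.\<close>

definition potential :: "((real ^ 'n::finite) \<times> real) measure \<Rightarrow> ((real ^ 'n) \<times> real \<Rightarrow> real) \<Rightarrow> 'n param \<Rightarrow> real"
  where "potential P q \<theta> = (LINT z|P. q z * phi \<theta> (fst z))"

definition field :: "((real ^ 'n::finite) \<times> real) measure \<Rightarrow> ((real ^ 'n) \<times> real \<Rightarrow> real) \<Rightarrow> 'n param \<Rightarrow> 'n param"
  where "field P q \<theta> = (LINT z|P. q z *\<^sub>R grad_phi \<theta> (fst z))"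

section \<open>Measurability of the integrands\<close>

lemma measurable_relu'[measurable]: "relu' \<in> borel_measurable borel"
  unfolding relu'_def[abs_def] by measurable

lemma continuous_relu: "continuous_on S relu"
  unfolding relu_def[abs_def] by (intro continuous_intros)

lemma continuous_phi_param: "continuous_on S (\<lambda>\<theta>. phi \<theta> x)"
  unfolding phi_def case_prod_unfold
  by (intro continuous_intros continuous_on_compose2[OF continuous_relu[of UNIV]]) auto

lemma measurable_phi_param[measurable]: "(\<lambda>\<theta>. phi \<theta> x) \<in> borel_measurable borel"
  by (rule borel_measurable_continuous_onI) (rule continuous_phi_param)

lemma measurable_phi[measurable]: "phi \<theta> \<in> borel_measurable borel"
proof -
  have "phi \<theta> = (\<lambda>x. fst \<theta> * relu (fst (snd \<theta>) \<bullet> x + snd (snd \<theta>)))"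
    by (simp add: phi_def case_prod_unfold)
  also have "\<dots> \<in> borel_measurable borel"
    by (intro borel_measurable_continuous_onI continuous_intros continuous_on_compose2[OF continuous_relu[of UNIV]]) auto
  finally show ?thesis .
qed

lemma measurable_grad_phi[measurable]: "grad_phi \<theta> \<in> borel_measurable borel"
proof (cases \<theta>)
  case (fields a w b)
  have [measurable]: "relu \<in> borel_measurable borel"
    by (rule borel_measurable_continuous_onI) (rule continuous_relu)
  show ?thesis
    unfolding fields grad_phi_def by (simp only: case_prod_conv) measurable
qed

lemma measurable_weight[measurable]: "weight \<in> borel_measurable borel"
  unfolding weight_def by measurable

section \<open>The data measure and distances of halfspaces\<close>

locale data =
  fixes P :: "((real ^ 'n::finite) \<times> real) measure"
  assumes data: "data_assumption P"
begin

sublocale prob_space P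
  using data by (simp add: data_assumption_def)

lemma sets_P[measurable_cong]: "sets P = sets borel"
  using data by (simp add: data_assumption_def)

lemma sets_P': "sets P = sets (borel \<Otimes>\<^sub>M borel)"
  by (subst borel_prod) (rule sets_P)

lemma measurable_fst_P[measurable]: "fst \<in> P \<rightarrow>\<^sub>M borel"
  using measurable_fst[of borel borel] by (simp cong: measurable_cong_sets add: sets_P')

lemma measurable_snd_P[measurable]: "snd \<in> P \<rightarrow>\<^sub>M borel"
  using measurable_snd[of borel borel] by (simp cong: measurable_cong_sets add: sets_P')

lemma integrable_weight: "integrable P (\<lambda>z. weight (fst z))"
proof (rule Bochner_Integration.integrable_bound)
  show "integrable P (\<lambda>z. 1 + (norm (fst z) + \<bar>snd z\<bar>))"
    using data by (auto simp: data_assumption_def case_prod_unfold)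
  show "AE z in P. norm (weight (fst z)) \<le> norm (1 + (norm (fst z) + \<bar>snd z\<bar>))"
  proof (rule AE_I2)
    fix z
    show "norm (weight (fst z)) \<le> norm (1 + (norm (fst z) + \<bar>snd z\<bar>))"
      using weight_le[of "fst z"] weight_ge_1[of "fst z"] by simp
  qed
qed measurable

definition mean_weight :: real where "mean_weight = (LINT z|P. weight (fst z))"

lemma mean_weight_nonneg: "0 \<le> mean_weight"
  unfolding mean_weight_def using weight_ge_1 by (intro integral_nonneg_AE) (auto intro!: AE_I2 intro: order_trans[OF zero_le_one])

lemma halfspace_measurable[measurable]: "halfspace w b \<in> sets borel"
proof -
  have "open (halfspace w b)"
    unfolding halfspace_def by (intro open_Collect_less continuous_intros)
  then show ?thesis by simp
qed

text \<open>Its integral is the distance of the two indicators in the weighted L^1 space of the data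
  assumption, with the weight moved into the integrand.\<close>

definition gap :: "real ^ 'n \<Rightarrow> real \<Rightarrow> real ^ 'n \<Rightarrow> real \<Rightarrow> real ^ 'n \<Rightarrow> real" where
  "gap w b w' b' x = \<bar>indicator (halfspace w b) x - indicator (halfspace w' b') x\<bar> * weight x"

lemma gap_bounds: "0 \<le> gap w b w' b' x" "gap w b w' b' x \<le> weight x"
  using weight_ge_1[of x] by (auto simp: gap_def indicator_def)

lemma measurable_gap[measurable]: "gap w b w' b' \<in> borel_measurable borel"
  unfolding gap_def[abs_def] by measurable

lemma integrable_gap: "integrable P (\<lambda>z. gap w b w' b' (fst z))"
proof (rule Bochner_Integration.integrable_bound[OF integrable_weight])
  show "AE z in P. norm (gap w b w' b' (fst z)) \<le> norm (weight (fst z))"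
  proof (rule AE_I2)
    fix z
    show "norm (gap w b w' b' (fst z)) \<le> norm (weight (fst z))"
      using gap_bounds[of w b w' b' "fst z"] by simp
  qed
qed measurable

lemma gap_integral_sphere:
  "(LINT x|density (marginal P) (\<lambda>x. ennreal (sqrt (1 + (norm x)\<^sup>2))).
      \<bar>indicator (halfspace w b) x - indicator (halfspace w' b') x\<bar>) = (LINT z|P. gap w b w' b' (fst z))"
proof -
  have "(LINT x|density (marginal P) (\<lambda>x. ennreal (sqrt (1 + (norm x)\<^sup>2))).
      \<bar>indicator (halfspace w b) x - indicator (halfspace w' b') x\<bar>) = (LINT x|marginal P. gap w b w' b' x)"
    unfolding marginal_def gap_def weight_def
    by (subst integral_density) (auto simp: mult.commute)
  also have "\<dots> = (LINT z|P. gap w b w' b' (fst z))"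
    unfolding marginal_def by (rule integral_distr) auto
  finally show ?thesis .
qed

text \<open>Selected once from the data, so that the Lipschitz constants built from it depend
  neither on the measure nor on time.\<close>

definition halfspace_lip :: real where
  "halfspace_lip = (SOME K. 0 \<le> K \<and> (\<forall>w b w' b'. (w, b) \<in> sphere 0 1 \<longrightarrow> (w', b') \<in> sphere 0 1 \<longrightarrow>
        (LINT z|P. gap w b w' b' (fst z)) \<le> K * dist (w, b) (w', b')))"

lemma halfspace_lip: "0 \<le> halfspace_lip"
    "(w, b) \<in> sphere 0 1 \<Longrightarrow> (w', b') \<in> sphere 0 1 \<Longrightarrow> (LINT z|P. gap w b w' b' (fst z)) \<le> halfspace_lip * dist (w, b) (w', b')"
proof -
  obtain K' where K': "\<forall>w b w' b'. (w, b) \<in> sphere 0 1 \<longrightarrow> (w', b') \<in> sphere 0 1 \<longrightarrow>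
        (LINT z|P. gap w b w' b' (fst z)) \<le> K' * dist (w, b) (w', b')"
    using data by (auto simp: data_assumption_def halfspaces_lipschitz_def gap_integral_sphere)
  have "0 \<le> max K' 0 \<and> (\<forall>w b w' b'. (w, b) \<in> sphere 0 1 \<longrightarrow> (w', b') \<in> sphere 0 1 \<longrightarrow>
        (LINT z|P. gap w b w' b' (fst z)) \<le> max K' 0 * dist (w, b) (w', b'))"
  proof (intro conjI allI impI)
    fix w w' :: "real ^ 'n" and b b' :: real
    assume "(w, b) \<in> sphere 0 1" "(w', b') \<in> sphere 0 1"
    then have "(LINT z|P. gap w b w' b' (fst z)) \<le> K' * dist (w, b) (w', b')" using K' by blast
    also have "\<dots> \<le> max K' 0 * dist (w, b) (w', b')" by (intro mult_right_mono) auto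
    finally show "(LINT z|P. gap w b w' b' (fst z)) \<le> max K' 0 * dist (w, b) (w', b')" .
  qed simp
  then have "\<exists>K. 0 \<le> K \<and> (\<forall>w b w' b'. (w, b) \<in> sphere 0 1 \<longrightarrow> (w', b') \<in> sphere 0 1 \<longrightarrow>
        (LINT z|P. gap w b w' b' (fst z)) \<le> K * dist (w, b) (w', b'))" by (rule exI)
  from someI_ex[OF this, folded halfspace_lip_def]
  show "0 \<le> halfspace_lip" "(w, b) \<in> sphere 0 1 \<Longrightarrow> (w', b') \<in> sphere 0 1 \<Longrightarrow> (LINT z|P. gap w b w' b' (fst z)) \<le> halfspace_lip * dist (w, b) (w', b')"
    by blast+
qed

text \<open>A halfspace depends only on the direction of (w, b), so the assumption on the unit
  sphere applies after normalization. The price is a constant that blows up at the origin, and |a'|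
  \<le> |(w', b')| cancels it; this is what the restriction to \<open>Theta_bar\<close> is good
  for.\<close>

lemma gap_integral_bound:
  assumes "(w, b) \<noteq> 0" "(w', b') \<noteq> 0" "\<bar>a'\<bar> \<le> norm (w', b')"
  shows "\<bar>a'\<bar> * (LINT z|P. gap w b w' b' (fst z)) \<le> 2 * halfspace_lip * norm ((w, b) - (w', b'))"
proof -
  define s s' where "s = inverse (norm (w, b))" and "s' = inverse (norm (w', b'))"
  have pos: "s > 0" "s' > 0" using assms by (simp_all add: s_def s'_def)
  have "gap w b w' b' = gap (s *\<^sub>R w) (s * b) (s' *\<^sub>R w') (s' * b')"
    by (simp add: gap_def[abs_def] halfspace_scaleR[OF pos(1)] halfspace_scaleR[OF pos(2)])
  moreover have "(s *\<^sub>R w, s * b) = (w, b) /\<^sub>R norm (w, b)" "(s' *\<^sub>R w', s' * b') = (w', b') /\<^sub>R norm (w', b')"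
    by (simp_all add: s_def s'_def)
  moreover have "(w, b) /\<^sub>R norm (w, b) \<in> sphere 0 1" "(w', b') /\<^sub>R norm (w', b') \<in> sphere 0 1"
    using assms by (simp_all del: scaleR_Pair)
  ultimately have "(LINT z|P. gap w b w' b' (fst z)) \<le> halfspace_lip * norm ((w, b) /\<^sub>R norm (w, b) - (w', b') /\<^sub>R norm (w', b'))"
    using halfspace_lip(2)[of "s *\<^sub>R w" "s * b" "s' *\<^sub>R w'" "s' * b'"] by (metis dist_norm)
  then have "\<bar>a'\<bar> * (LINT z|P. gap w b w' b' (fst z))
      \<le> norm (w', b') * (halfspace_lip * norm ((w, b) /\<^sub>R norm (w, b) - (w', b') /\<^sub>R norm (w', b')))"
    using assms(3) halfspace_lip(1) gap_bounds by (intro mult_mono) (auto intro!: integral_nonneg_AE AE_I2)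
  also have "\<dots> = halfspace_lip * (norm (w', b') * norm ((w, b) /\<^sub>R norm (w, b) - (w', b') /\<^sub>R norm (w', b')))"
    by (rule mult.left_commute)
  also have "\<dots> \<le> halfspace_lip * (2 * norm ((w, b) - (w', b')))"
    using norm_scaled_normalized_diff[OF assms(1,2)] halfspace_lip(1) by (rule mult_left_mono)
  finally show ?thesis by simp
qed

end

lemma Theta_bar_abs: "(a, w, b) \<in> Theta_bar \<Longrightarrow> \<bar>a\<bar> \<le> norm (w, b)"
  by (auto simp: Theta_bar_eq norm_Pair intro: real_le_rsqrt)

section \<open>Lipschitz and Taylor estimates for averaged gradients\<close>

locale bounded_weight = data P for P :: "((real ^ 'n::finite) \<times> real) measure" +
  fixes q :: "(real ^ 'n) \<times> real \<Rightarrow> real" and C :: real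
  assumes measurable_q[measurable]: "q \<in> borel_measurable P"
    and q_bound: "\<And>z. \<bar>q z\<bar> \<le> C"
begin

lemma C_nonneg: "0 \<le> C" using q_bound[of undefined] by linarith

lemma weighted_bound:
  fixes f :: "(real ^ 'n) \<times> real \<Rightarrow> 'b::{banach, second_countable_topology}"
  assumes [measurable]: "f \<in> borel_measurable P" and h: "integrable P h" "\<And>z. norm (f z) \<le> h z"
  shows "integrable P (\<lambda>z. q z *\<^sub>R f z)" "norm (LINT z|P. q z *\<^sub>R f z) \<le> C * (LINT z|P. h z)"
proof -
  have le: "norm (q z *\<^sub>R f z) \<le> C * h z" for z
    unfolding norm_scaleR using q_bound h(2) C_nonneg by (intro mult_mono) auto
  have int: "integrable P (\<lambda>z. C * h z)" using h(1) by simp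
  show i: "integrable P (\<lambda>z. q z *\<^sub>R f z)"
  proof (rule Bochner_Integration.integrable_bound[OF int])
    show "AE z in P. norm (q z *\<^sub>R f z) \<le> norm (C * h z)"
      by (intro AE_I2 order_trans[OF le]) simp
  qed measurable
  show "norm (LINT z|P. q z *\<^sub>R f z) \<le> C * (LINT z|P. h z)"
    using Bochner_Integration.integral_norm_bound_integral[OF i int le] by simp
qed

lemma integrable_potential: "integrable P (\<lambda>z. q z * phi \<theta> (fst z))"
proof -
  have "integrable P (\<lambda>z. q z *\<^sub>R phi \<theta> (fst z))"
    by (rule weighted_bound(1)[where h = "\<lambda>z. (norm \<theta>)\<^sup>2 * weight (fst z)"])
      (simp_all only: real_norm_def phi_bound integrable_weight integrable_mult_right, measurable)
  then show ?thesis by simp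
qed

lemma integrable_field: "integrable P (\<lambda>z. q z *\<^sub>R grad_phi \<theta> (fst z))"
  by (rule weighted_bound(1)[where h = "\<lambda>z. 2 * norm \<theta> * weight (fst z)"])
    (simp_all only: grad_phi_bound integrable_weight integrable_mult_right, measurable)

lemma inner_field: "v \<bullet> field P q \<theta> = (LINT z|P. q z * (v \<bullet> grad_phi \<theta> (fst z)))"
  unfolding field_def using integral_inner_right[OF integrable_field] by simp

lemma field_scaleR: "r > 0 \<Longrightarrow> field P q (r *\<^sub>R \<theta>) = r *\<^sub>R field P q \<theta>"
  unfolding field_def by (subst integral_scaleR_right[symmetric]) (simp add: grad_phi_scaleR mult_ac)

lemma inner_field_self: "\<theta> \<bullet> field P q \<theta> = 2 * potential P q \<theta>"
  unfolding inner_field potential_def by (subst integral_mult_right_zero[symmetric]) (simp add: inner_grad_phi mult_ac)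

lemma potential_uminus_fst: "potential P q (- a, u) = - potential P q (a, u)"
  by (simp add: potential_def phi_uminus_fst)

lemma field_conservation: "fst \<theta> * fst (field P q \<theta>) = snd \<theta> \<bullet> snd (field P q \<theta>)"
proof -
  have "fst \<theta> * fst (field P q \<theta>) = (fst \<theta>, 0) \<bullet> field P q \<theta>"
    "snd \<theta> \<bullet> snd (field P q \<theta>) = (0, snd \<theta>) \<bullet> field P q \<theta>"
    by (simp_all add: inner_prod_def)
  moreover have "(fst \<theta>, 0) \<bullet> grad_phi \<theta> x = (0, snd \<theta>) \<bullet> grad_phi \<theta> x" for x
    using grad_phi_conservation[of \<theta> x] by (simp add: inner_prod_def)
  ultimately show ?thesis by (simp add: inner_field)
qed

text \<open>\<open>mean_weight\<close> accounts for the continuous part of the gradient and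
  \<open>halfspace_lip\<close> for its jumps. The same constant also bounds the growth and the
  Taylor remainder.\<close>

definition L :: real where "L = C * (2 * mean_weight + 2 * halfspace_lip)"

lemma field_0: "field P q 0 = 0"
proof -
  have "grad_phi 0 = (\<lambda>x :: real ^ 'n. 0)"
    by (auto simp: grad_phi_def zero_prod_def relu_def)
  then show ?thesis by (simp add: field_def)
qed

lemma field_norm: "norm (field P q \<theta>) \<le> L * norm \<theta>"
proof -
  have "norm (field P q \<theta>) \<le> C * (LINT z|P. 2 * norm \<theta> * weight (fst z))"
    unfolding field_def by (rule weighted_bound(2)) (simp_all only: grad_phi_bound integrable_weight integrable_mult_right, measurable)
  also have "\<dots> = C * (2 * mean_weight) * norm \<theta>" by (simp add: mean_weight_def)
  also have "\<dots> \<le> L * norm \<theta>"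
    unfolding L_def using C_nonneg halfspace_lip(1) by (intro mult_right_mono mult_left_mono) auto
  finally show ?thesis .
qed

lemma field_lipschitz:
  assumes "\<theta> \<in> Theta_bar" "\<theta>' \<in> Theta_bar"
  shows "norm (field P q \<theta> - field P q \<theta>') \<le> L * norm (\<theta> - \<theta>')"
proof -
  obtain a w b where \<theta>: "\<theta> = (a, w, b)" by (cases \<theta>)
  obtain a' w' b' where \<theta>': "\<theta>' = (a', w', b')" by (cases \<theta>')
  \<comment> \<open>If (w, b) = 0 there is no direction to normalize, but membership in
    \<open>Theta_bar\<close> then forces a = 0, and linear growth of the field is enough.\<close>
  consider "(w, b) = 0" | "(w', b') = 0" | "(w, b) \<noteq> 0" "(w', b') \<noteq> 0" by blast
  then show ?thesis
  proof cases
    case 1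
    then have "\<theta> = 0" using assms(1) Theta_bar_abs[of a w b] by (simp add: \<theta> zero_prod_def)
    then show ?thesis using field_norm[of \<theta>'] by (simp add: field_0)
  next
    case 2
    then have "\<theta>' = 0" using assms(2) Theta_bar_abs[of a' w' b'] by (simp add: \<theta>' zero_prod_def)
    then show ?thesis using field_norm[of \<theta>] by (simp add: field_0)
  next
    case 3
    have "field P q \<theta> - field P q \<theta>' = (LINT z|P. q z *\<^sub>R (grad_phi \<theta> (fst z) - grad_phi \<theta>' (fst z)))"
      unfolding field_def scaleR_diff_right by (rule Bochner_Integration.integral_diff[OF integrable_field integrable_field, symmetric])
    also have "norm \<dots> \<le> C * (LINT z|P. 2 * norm (\<theta> - \<theta>') * weight (fst z) + \<bar>a'\<bar> * gap w b w' b' (fst z))"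
      using grad_phi_difference[of a w b _ a' w' b'] integrable_weight integrable_gap
      by (intro weighted_bound) (auto simp: \<theta> \<theta>' gap_def)
    also have "\<dots> = C * (2 * norm (\<theta> - \<theta>') * mean_weight + \<bar>a'\<bar> * (LINT z|P. gap w b w' b' (fst z)))"
      using integrable_weight integrable_gap by (simp add: mean_weight_def)
    also have "\<dots> \<le> C * (2 * norm (\<theta> - \<theta>') * mean_weight + 2 * halfspace_lip * norm (\<theta> - \<theta>'))"
    proof (intro mult_left_mono add_left_mono)
      have "\<bar>a'\<bar> * (LINT z|P. gap w b w' b' (fst z)) \<le> 2 * halfspace_lip * norm ((w, b) - (w', b'))"
        using 3 Theta_bar_abs assms(2) by (intro gap_integral_bound) (auto simp: \<theta>')
      also have "\<dots> \<le> 2 * halfspace_lip * norm (\<theta> - \<theta>')"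
        using norm_snd_le[of "\<theta> - \<theta>'"] halfspace_lip(1) by (intro mult_left_mono) (auto simp: \<theta> \<theta>')
      finally show "\<bar>a'\<bar> * (LINT z|P. gap w b w' b' (fst z)) \<le> 2 * halfspace_lip * norm (\<theta> - \<theta>')" .
    qed (rule C_nonneg)
    also have "\<dots> = L * norm (\<theta> - \<theta>')" by (simp add: L_def algebra_simps)
    finally show ?thesis .
  qed
qed

text \<open>Single functions \<open>phi\<close> have a kink, yet the average has a Lipschitz
  gradient: the data for which the kink is crossed have weight of order |\<theta>' - \<theta>|,
  times an error of the same order. This identifies \<open>field\<close> as the gradient of
  \<open>potential\<close>.\<close>

lemma potential_taylor:
  assumes "\<theta> \<in> Theta" "\<theta>' \<in> Theta"
  shows "\<bar>potential P q \<theta>' - potential P q \<theta> - field P q \<theta> \<bullet> (\<theta>' - \<theta>)\<bar> \<le> L * (norm (\<theta>' - \<theta>))\<^sup>2"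
proof -
  obtain a w b where \<theta>: "\<theta> = (a, w, b)" by (cases \<theta>)
  obtain a' w' b' where \<theta>': "\<theta>' = (a', w', b')" by (cases \<theta>')
  have nz: "(w, b) \<noteq> 0" "(w', b') \<noteq> 0"
    using assms by (auto simp: \<theta> \<theta>' Theta_def zero_prod_def)
  define N where "N = norm (\<theta>' - \<theta>)"
  have "potential P q \<theta>' - potential P q \<theta> - field P q \<theta> \<bullet> (\<theta>' - \<theta>)
      = (LINT z|P. q z *\<^sub>R (phi \<theta>' (fst z) - phi \<theta> (fst z) - grad_phi \<theta> (fst z) \<bullet> (\<theta>' - \<theta>)))"
    unfolding potential_def inner_commute[of "field P q \<theta>"] inner_field
    using integrable_potential integrable_inner_right[OF integrable_field, of "\<theta>' - \<theta>" \<theta>]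
    by (simp add: right_diff_distrib inner_commute del: inner_diff_left inner_diff_right)
  also have "\<bar>\<dots>\<bar> \<le> C * (LINT z|P. N\<^sup>2 * weight (fst z) + \<bar>a\<bar> * N * gap w b w' b' (fst z))"
    unfolding real_norm_def[symmetric] using phi_taylor[of a' w' b' _ a w b] integrable_weight integrable_gap
    by (intro weighted_bound) (auto simp: \<theta> \<theta>' gap_def N_def simp del: diff_Pair)
  also have "\<dots> = C * (N\<^sup>2 * mean_weight + N * (\<bar>a\<bar> * (LINT z|P. gap w b w' b' (fst z))))"
    using integrable_weight integrable_gap by (simp add: mean_weight_def)
  also have "\<dots> \<le> C * (N\<^sup>2 * mean_weight + N * (2 * halfspace_lip * N))"
  proof (intro mult_left_mono add_left_mono)
    have "\<bar>a\<bar> * (LINT z|P. gap w' b' w b (fst z)) \<le> 2 * halfspace_lip * norm ((w', b') - (w, b))"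
      using nz Theta_bar_abs[of a w b] subsetD[OF closure_subset assms(1)] by (intro gap_integral_bound) (auto simp: \<theta>)
    also have "\<dots> \<le> 2 * halfspace_lip * N"
      using norm_snd_le[of "\<theta>' - \<theta>"] halfspace_lip(1) by (intro mult_left_mono) (auto simp: \<theta> \<theta>' N_def)
    also have "gap w' b' w b = gap w b w' b'" by (auto simp: gap_def abs_minus_commute)
    finally show "\<bar>a\<bar> * (LINT z|P. gap w b w' b' (fst z)) \<le> 2 * halfspace_lip * N" .
  qed (auto simp: N_def C_nonneg)
  also have "\<dots> = C * (mean_weight + 2 * halfspace_lip) * N\<^sup>2" by (simp add: algebra_simps power2_eq_square)
  also have "\<dots> \<le> L * N\<^sup>2"
    unfolding L_def using C_nonneg mean_weight_nonneg by (intro mult_right_mono mult_left_mono) auto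
  finally show ?thesis by (simp add: N_def)
qed

end

section \<open>Continuity of the flow in time\<close>

lemma phi_difference: "\<bar>phi \<theta> x - phi \<eta> x\<bar> \<le> weight x * ((norm \<theta> + norm \<eta>) * norm (\<theta> - \<eta>))"
proof -
  obtain a w b where \<theta>: "\<theta> = (a, w, b)" by (cases \<theta>)
  obtain a' w' b' where \<eta>: "\<eta> = (a', w', b')" by (cases \<eta>)
  define z z' where "z = w \<bullet> x + b" and "z' = w' \<bullet> x + b'"
  have w: "0 \<le> weight x" using weight_ge_1[of x] by simp
  have "\<bar>relu z\<bar> \<le> \<bar>z\<bar>" by (rule abs_relu_le)
  also have "\<dots> \<le> norm (w, b) * weight x" unfolding z_def by (rule preactivation_bound)
  also have "\<dots> \<le> norm \<theta> * weight x" using norm_snd_le[of \<theta>] w by (intro mult_right_mono) (auto simp: \<theta>)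
  finally have 1: "\<bar>relu z\<bar> \<le> norm \<theta> * weight x" .
  have "z - z' = (w - w') \<bullet> x + (b - b')" by (simp add: z_def z'_def inner_diff_left)
  then have "\<bar>z - z'\<bar> \<le> norm (w - w', b - b') * weight x" using preactivation_bound by metis
  also have "\<dots> \<le> norm (\<theta> - \<eta>) * weight x"
    using norm_snd_le[of "\<theta> - \<eta>"] w by (intro mult_right_mono) (auto simp: \<theta> \<eta>)
  finally have 2: "\<bar>relu z - relu z'\<bar> \<le> norm (\<theta> - \<eta>) * weight x"
    using relu_lipschitz[of z z'] by linarith
  have 3: "\<bar>a - a'\<bar> \<le> norm (\<theta> - \<eta>)" "\<bar>a'\<bar> \<le> norm \<eta>"
    using norm_fst_le[of "\<theta> - \<eta>"] norm_fst_le[of \<eta>] by (simp_all add: \<theta> \<eta>)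
  have "phi \<theta> x - phi \<eta> x = (a - a') * relu z + a' * (relu z - relu z')"
    by (simp add: \<theta> \<eta> phi_def z_def z'_def algebra_simps)
  also have "\<bar>\<dots>\<bar> \<le> \<bar>a - a'\<bar> * \<bar>relu z\<bar> + \<bar>a'\<bar> * \<bar>relu z - relu z'\<bar>"
    by (simp add: abs_mult[symmetric])
  also have "\<dots> \<le> norm (\<theta> - \<eta>) * (norm \<theta> * weight x) + norm \<eta> * (norm (\<theta> - \<eta>) * weight x)"
    using 1 2 3 by (intro add_mono mult_mono) auto
  also have "\<dots> = weight x * ((norm \<theta> + norm \<eta>) * norm (\<theta> - \<eta>))"
    by (simp add: algebra_simps)
  finally show ?thesis .
qed

section \<open>Networks of measures with finite second moment\<close>

lemma P2D:
  assumes "\<mu> \<in> P2"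
  shows "prob_space \<mu>" "sets \<mu> = sets (restrict_space borel Theta_bar)" "space \<mu> = Theta_bar"
    "integrable \<mu> (\<lambda>\<theta>. (norm \<theta>)\<^sup>2)"
  using assms sets_eq_imp_space_eq[of \<mu> "restrict_space borel Theta_bar"]
  by (auto simp: P2_def space_restrict_space)

lemma P2_id_measurable: "\<mu> \<in> P2 \<Longrightarrow> (\<lambda>\<theta>. \<theta>) \<in> \<mu> \<rightarrow>\<^sub>M borel"
  using measurable_restrict_space1[OF measurable_ident, of borel Theta_bar]
  by (simp add: measurable_cong_sets[OF P2D(2) refl] id_def)

lemma P2_measurable:
  assumes "\<mu> \<in> P2" "f \<in> borel_measurable borel"
  shows "f \<in> borel_measurable \<mu>"
  using measurable_compose[OF P2_id_measurable[OF assms(1)] assms(2)] .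

lemma P2_integrable_phi: "\<mu> \<in> P2 \<Longrightarrow> integrable \<mu> (\<lambda>\<theta>. phi \<theta> x)"
proof (rule Bochner_Integration.integrable_bound)
  assume \<mu>: "\<mu> \<in> P2"
  show "integrable \<mu> (\<lambda>\<theta>. (norm \<theta>)\<^sup>2 * weight x)" using P2D(4)[OF \<mu>] by simp
  show "(\<lambda>\<theta>. phi \<theta> x) \<in> borel_measurable \<mu>" by (rule P2_measurable[OF \<mu>]) measurable
  show "AE \<theta> in \<mu>. norm (phi \<theta> x) \<le> norm ((norm \<theta>)\<^sup>2 * weight x)"
    using phi_bound weight_ge_1[of x] by (intro AE_I2) (auto simp: abs_mult)
qed

lemma network_bound:
  assumes \<mu>: "\<mu> \<in> P2"
  shows "\<bar>network \<mu> x\<bar> \<le> second_moment \<mu> * weight x"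
proof -
  have "norm (LINT \<theta>|\<mu>. phi \<theta> x) \<le> (LINT \<theta>|\<mu>. (norm \<theta>)\<^sup>2 * weight x)"
    using P2_integrable_phi[OF \<mu>] P2D(4)[OF \<mu>] phi_bound
    by (intro Bochner_Integration.integral_norm_bound_integral) auto
  then show ?thesis by (simp add: network_def second_moment_def)
qed

lemma second_moment_nonneg: "0 \<le> second_moment \<mu>"
  by (simp add: second_moment_def)

lemma measurable_network:
  fixes \<mu> :: "'n::finite param measure"
  assumes \<mu>: "\<mu> \<in> P2"
  shows "network \<mu> \<in> borel_measurable borel"
proof -
  interpret prob_space \<mu> by (rule P2D(1)[OF \<mu>])
  note [measurable] = P2_id_measurable[OF \<mu>]
  have "continuous_on UNIV (\<lambda>z :: 'n param \<times> (real ^ 'n). phi (fst z) (snd z))"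
    unfolding phi_def case_prod_unfold
    by (intro continuous_intros continuous_on_compose2[OF continuous_relu[of UNIV]]) auto
  then have "(\<lambda>z :: 'n param \<times> (real ^ 'n). phi (fst z) (snd z)) \<in> borel_measurable (borel \<Otimes>\<^sub>M borel)"
    by (simp add: borel_measurable_continuous_onI borel_prod)
  from measurable_compose[OF _ this, of "\<lambda>z. (snd z, fst z)" "borel \<Otimes>\<^sub>M \<mu>"]
  have "(\<lambda>z. phi (snd z) (fst z)) \<in> borel_measurable (borel \<Otimes>\<^sub>M \<mu>)"
    by simp
  then have "(\<lambda>x. LINT \<theta>|\<mu>. phi \<theta> x) \<in> borel_measurable borel"
    by (intro borel_measurable_lebesgue_integral) (simp add: case_prod_unfold)
  then show ?thesis by (simp add: network_def[abs_def])
qed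

text \<open>This provides nonemptiness of the set over which \<open>wasserstein2\<close> takes its
  infimum, without which the infimum says nothing.\<close>

lemma product_coupling:
  assumes "\<mu> \<in> P2" "\<nu> \<in> P2"
  shows "\<mu> \<Otimes>\<^sub>M \<nu> \<in> couplings \<mu> \<nu>"
proof -
  interpret \<mu>: prob_space \<mu> by (rule P2D(1)[OF assms(1)])
  interpret \<nu>: prob_space \<nu> by (rule P2D(1)[OF assms(2)])
  interpret pair_prob_space \<mu> \<nu> ..
  have "distr (\<mu> \<Otimes>\<^sub>M \<nu>) \<mu> fst = \<mu>" by (rule \<nu>.distr_pair_fst)
  moreover have "distr (\<mu> \<Otimes>\<^sub>M \<nu>) \<nu> snd = \<nu>"
  proof (rule measure_eqI)
    fix A assume "A \<in> sets (distr (\<mu> \<Otimes>\<^sub>M \<nu>) \<nu> snd)"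
    then have A: "A \<in> sets \<nu>" by simp
    have "emeasure (distr (\<mu> \<Otimes>\<^sub>M \<nu>) \<nu> snd) A = emeasure (\<mu> \<Otimes>\<^sub>M \<nu>) (space \<mu> \<times> A)"
      using A sets.sets_into_space[OF A]
      by (subst emeasure_distr) (auto simp: space_pair_measure intro!: arg_cong2[where f = emeasure])
    also have "\<dots> = emeasure \<nu> A" using A by (simp add: \<nu>.emeasure_pair_measure_Times \<mu>.emeasure_space_1)
    finally show "emeasure (distr (\<mu> \<Otimes>\<^sub>M \<nu>) \<nu> snd) A = emeasure \<nu> A" .
  qed simp
  ultimately show ?thesis by (simp add: couplings_def)
qed

lemma wasserstein2_coupling:
  assumes "\<mu> \<in> P2" "\<nu> \<in> P2" "wasserstein2 \<mu> \<nu> < \<delta>"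
  obtains \<gamma> where "\<gamma> \<in> couplings \<mu> \<nu>" "(LINT p|\<gamma>. (dist (fst p) (snd p))\<^sup>2) < \<delta>\<^sup>2"
proof -
  let ?I = "INF \<gamma>\<in>couplings \<mu> \<nu>. LINT p|\<gamma>. (dist (fst p) (snd p))\<^sup>2"
  have "sqrt ?I < \<delta>" using assms(3) by (simp add: wasserstein2_def case_prod_unfold)
  then have "?I < \<delta>\<^sup>2"
    using real_le_rsqrt[of \<delta> ?I] by linarith
  moreover have "couplings \<mu> \<nu> \<noteq> {}" using product_coupling[OF assms(1,2)] by blast
  moreover have "bdd_below ((\<lambda>\<gamma>. LINT p|\<gamma>. (dist (fst p) (snd p))\<^sup>2) ` couplings \<mu> \<nu>)"
    by (intro bdd_belowI[of _ 0]) auto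
  ultimately show thesis using that by (auto simp: cINF_less_iff)
qed

text \<open>Integrating the difference of \<open>phi\<close> against a nearly optimal coupling
  leaves products of a distance and a norm, which second moments control. Quadratic growth of
  \<open>phi\<close> is matched by the quadratic cost.\<close>

lemma network_wasserstein_bound:
  fixes \<mu> \<nu> :: "'n::finite param measure"
  assumes \<mu>: "\<mu> \<in> P2" and \<nu>: "\<nu> \<in> P2" and W: "wasserstein2 \<mu> \<nu> < \<delta>" and "\<delta> > 0"
  shows "\<bar>network \<mu> x - network \<nu> x\<bar> \<le> weight x * (\<delta>\<^sup>2 + \<delta> + \<delta> * second_moment \<nu>)"
proof -
  obtain \<gamma> where \<gamma>: "\<gamma> \<in> couplings \<mu> \<nu>" "(LINT p|\<gamma>. (dist (fst p) (snd p))\<^sup>2) < \<delta>\<^sup>2"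
    using wasserstein2_coupling[OF \<mu> \<nu> W] .
  have sets: "sets \<gamma> = sets (\<mu> \<Otimes>\<^sub>M \<nu>)" and fst: "distr \<gamma> \<mu> fst = \<mu>" and snd: "distr \<gamma> \<nu> snd = \<nu>"
    using \<gamma>(1) by (auto simp: couplings_def)
  note [measurable_cong] = sets
  have mfst: "fst \<in> \<gamma> \<rightarrow>\<^sub>M \<mu>" and msnd: "snd \<in> \<gamma> \<rightarrow>\<^sub>M \<nu>" by measurable
  note mfst' = measurable_compose[OF mfst P2_id_measurable[OF \<mu>]]
    and msnd' = measurable_compose[OF msnd P2_id_measurable[OF \<nu>]]
  note [measurable] = mfst' msnd'
  have int_fst: "integrable \<gamma> (\<lambda>p. f (fst p))" "(LINT p|\<gamma>. f (fst p)) = (LINT \<theta>|\<mu>. f \<theta>)"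
    if "integrable \<mu> f" for f :: "'n param \<Rightarrow> real"
    using integrable_distr[OF mfst, of f] integral_distr[OF mfst, of f] that by (auto simp: fst)
  have int_snd: "integrable \<gamma> (\<lambda>p. f (snd p))" "(LINT p|\<gamma>. f (snd p)) = (LINT \<theta>|\<nu>. f \<theta>)"
    if "integrable \<nu> f" for f :: "'n param \<Rightarrow> real"
    using integrable_distr[OF msnd, of f] integral_distr[OF msnd, of f] that by (auto simp: snd)
  note sq = int_fst(1)[OF P2D(4)[OF \<mu>]] int_snd(1)[OF P2D(4)[OF \<nu>]]
  have "integrable \<gamma> (\<lambda>p. 2 * (norm (fst p))\<^sup>2 + 2 * (norm (snd p))\<^sup>2)"
    using sq by (intro Bochner_Integration.integrable_add integrable_mult_right)
  then have dist: "integrable \<gamma> (\<lambda>p. (dist (fst p) (snd p))\<^sup>2)"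
  proof (rule Bochner_Integration.integrable_bound)
    show "AE p in \<gamma>. norm ((dist (fst p) (snd p))\<^sup>2) \<le> norm (2 * (norm (fst p))\<^sup>2 + 2 * (norm (snd p))\<^sup>2)"
    proof (rule AE_I2)
      fix p :: "'n param \<times> 'n param"
      have "(dist (fst p) (snd p))\<^sup>2 \<le> (norm (fst p) + norm (snd p))\<^sup>2"
        unfolding dist_norm by (intro power_mono norm_triangle_ineq4) auto
      also have "\<dots> \<le> 2 * (norm (fst p))\<^sup>2 + 2 * (norm (snd p))\<^sup>2"
        using sum_squares_bound[of "norm (fst p)" "norm (snd p)"] by (simp add: power2_sum)
      finally show "norm ((dist (fst p) (snd p))\<^sup>2) \<le> norm (2 * (norm (fst p))\<^sup>2 + 2 * (norm (snd p))\<^sup>2)"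
        by simp
    qed
  qed measurable
  have le: "norm (phi (fst p) x - phi (snd p) x)
      \<le> weight x * ((1 + 1 / \<delta>) * (dist (fst p) (snd p))\<^sup>2 + \<delta> * (norm (snd p))\<^sup>2)" for p
  proof -
    define d m where "d = dist (fst p) (snd p)" and "m = norm (snd p)"
    have "norm (phi (fst p) x - phi (snd p) x) \<le> weight x * ((norm (fst p) + m) * d)"
      using phi_difference[of "fst p" x "snd p"] by (simp add: d_def m_def dist_norm)
    also have "\<dots> \<le> weight x * ((d + 2 * m) * d)"
      using norm_triangle_sub[of "fst p" "snd p"] weight_ge_1[of x]
      by (intro mult_left_mono mult_right_mono) (auto simp: d_def m_def dist_norm)
    also have "\<dots> \<le> weight x * ((1 + 1 / \<delta>) * d\<^sup>2 + \<delta> * m\<^sup>2)"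
    proof (rule mult_left_mono)
      \<comment> \<open>Young's inequality with parameter \<delta>: the squared distance has
        integral below the square of \<delta> and so survives division by \<delta>, while the second
        moment is multiplied by \<delta>.\<close>
      have "0 \<le> (d - \<delta> * m)\<^sup>2 / \<delta>" using \<open>\<delta> > 0\<close> by simp
      also have "\<dots> = d\<^sup>2 / \<delta> - 2 * m * d + \<delta> * m\<^sup>2"
        using \<open>\<delta> > 0\<close> by (simp add: power2_eq_square field_simps)
      finally show "(d + 2 * m) * d \<le> (1 + 1 / \<delta>) * d\<^sup>2 + \<delta> * m\<^sup>2"
        by (simp add: power2_eq_square algebra_simps)
    qed (use weight_ge_1[of x] in simp)
    finally show ?thesis by (simp add: d_def m_def)
  qed
  have "network \<mu> x - network \<nu> x = (LINT p|\<gamma>. phi (fst p) x - phi (snd p) x)"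
    unfolding network_def
    using int_fst[OF P2_integrable_phi[OF \<mu>]] int_snd[OF P2_integrable_phi[OF \<nu>]] by simp
  also have "\<bar>\<dots>\<bar> \<le> (LINT p|\<gamma>. weight x * ((1 + 1 / \<delta>) * (dist (fst p) (snd p))\<^sup>2 + \<delta> * (norm (snd p))\<^sup>2))"
    unfolding real_norm_def[symmetric] using le dist sq
    by (intro Bochner_Integration.integral_norm_bound_integral Bochner_Integration.integrable_diff
        int_fst(1)[OF P2_integrable_phi[OF \<mu>]] int_snd(1)[OF P2_integrable_phi[OF \<nu>]]) auto
  also have "\<dots> = weight x * ((1 + 1 / \<delta>) * (LINT p|\<gamma>. (dist (fst p) (snd p))\<^sup>2) + \<delta> * second_moment \<nu>)"
    using dist sq int_snd(2)[OF P2D(4)[OF \<nu>]] by (simp add: second_moment_def)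
  also have "\<dots> \<le> weight x * ((1 + 1 / \<delta>) * \<delta>\<^sup>2 + \<delta> * second_moment \<nu>)"
    using \<gamma>(2) \<open>\<delta> > 0\<close> weight_ge_1[of x] by (intro mult_left_mono add_right_mono) auto
  also have "(1 + 1 / \<delta>) * \<delta>\<^sup>2 = \<delta>\<^sup>2 + \<delta>"
    using \<open>\<delta> > 0\<close> by (simp add: field_simps power2_eq_square)
  finally show ?thesis .
qed

section \<open>The derivative of the loss as a weight\<close>

locale loss_data = data P for P :: "((real ^ 'n::finite) \<times> real) measure" +
  fixes \<l> :: "real \<Rightarrow> real \<Rightarrow> real"
  assumes loss: "loss_assumption \<l>"
begin

lemma loss_continuous: "continuous_on UNIV (\<lambda>z. \<l> (fst z) (snd z))"
  using loss by (simp add: loss_assumption_def case_prod_unfold)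

lemma loss_measurable: "(\<lambda>z. \<l> (fst z) (snd z)) \<in> borel_measurable (borel \<Otimes>\<^sub>M borel)"
  using loss_continuous by (simp add: borel_measurable_continuous_onI borel_prod)

lemma loss_measurable'[measurable (raw)]:
  assumes "f \<in> borel_measurable N" "g \<in> borel_measurable N"
  shows "(\<lambda>x. \<l> (f x) (g x)) \<in> borel_measurable N"
  using measurable_compose[OF measurable_Pair[OF assms] loss_measurable] by simp

lemma loss_has_derivative: "((\<lambda>u. \<l> u y) has_real_derivative partial1 \<l> u y) (at u)"
  using loss unfolding loss_assumption_def partial1_def
  by (simp add: DERIV_deriv_iff_field_differentiable)

text \<open>The derivative is assumed continuous in the first argument only. Joint measurability
  comes from its being a limit of difference quotients of the jointly continuous loss.\<close>

lemma partial1_measurable[measurable (raw)]: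
  assumes [measurable]: "f \<in> borel_measurable N" "g \<in> borel_measurable N"
  shows "(\<lambda>x. partial1 \<l> (f x) (g x)) \<in> borel_measurable N"
proof (rule borel_measurable_LIMSEQ_real)
  fix x
  have "((\<lambda>h. (\<l> (f x + h) (g x) - \<l> (f x) (g x)) / h) \<longlongrightarrow> partial1 \<l> (f x) (g x)) (at 0)"
    using loss_has_derivative by (simp add: DERIV_def)
  moreover have "filterlim (\<lambda>n. inverse (real (Suc n))) (at 0) sequentially"
    using LIMSEQ_inverse_real_of_nat by (auto simp: filterlim_at)
  ultimately show "(\<lambda>n. (\<l> (f x + inverse (real (Suc n))) (g x) - \<l> (f x) (g x)) / inverse (real (Suc n)))
      \<longlonglongrightarrow> partial1 \<l> (f x) (g x)"
    by (rule filterlim_compose)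
qed measurable

definition C :: real where "C = (SOME C. \<forall>u y. \<bar>partial1 \<l> u y\<bar> \<le> C)"

lemma partial1_bound: "\<bar>partial1 \<l> u y\<bar> \<le> C"
proof -
  have "\<exists>C. \<forall>u y. \<bar>partial1 \<l> u y\<bar> \<le> C" using loss by (auto simp: loss_assumption_def)
  from someI_ex[OF this, folded C_def] show ?thesis by blast
qed

definition q :: "'n param measure \<Rightarrow> (real ^ 'n) \<times> real \<Rightarrow> real" where
  "q \<mu> z = partial1 \<l> (network \<mu> (fst z)) (snd z)"

lemma bounded_weight: "\<mu> \<in> P2 \<Longrightarrow> bounded_weight P (q \<mu>) C"
proof unfold_locales
  assume "\<mu> \<in> P2"
  note [measurable] = measurable_network[OF this]
  show "q \<mu> \<in> borel_measurable P" unfolding q_def[abs_def] by measurable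
  show "\<bar>q \<mu> z\<bar> \<le> C" for z unfolding q_def by (rule partial1_bound)
qed

lemma delta_risk_eq: "delta_risk \<l> P \<mu> = potential P (q \<mu>)"
  by (simp add: fun_eq_iff delta_risk_def potential_def q_def case_prod_unfold)

lemma grad_delta_risk_eq: "grad_delta_risk \<l> P \<mu> = field P (q \<mu>)"
  by (simp add: fun_eq_iff grad_delta_risk_def field_def q_def case_prod_unfold)

lemma q_tendsto:
  assumes "(\<lambda>n. network (\<mu> n) (fst z)) \<longlonglongrightarrow> network \<nu> (fst z)"
  shows "(\<lambda>n. q (\<mu> n) z) \<longlonglongrightarrow> q \<nu> z"
proof -
  have "isCont (\<lambda>u. partial1 \<l> u (snd z)) u" for u
    using loss by (simp add: loss_assumption_def continuous_on_eq_continuous_at)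
  then show ?thesis unfolding q_def using assms by (rule isCont_tendsto_compose)
qed

text \<open>Dominated convergence: pointwise convergence of the networks passes to the weights by
  continuity of \<open>partial1\<close> in its first argument, and its bound \<open>C\<close> leaves
  a multiple of the integrable \<open>weight\<close> as majorant.\<close>

lemma
  assumes \<mu>: "\<And>n. \<mu> n \<in> P2" and \<nu>: "\<nu> \<in> P2"
    and lim: "\<And>x. (\<lambda>n. network (\<mu> n) x) \<longlonglongrightarrow> network \<nu> x"
  shows field_tendsto: "(\<lambda>n. field P (q (\<mu> n)) \<theta>) \<longlonglongrightarrow> field P (q \<nu>) \<theta>"
    and potential_tendsto: "(\<lambda>n. potential P (q (\<mu> n)) \<theta>) \<longlonglongrightarrow> potential P (q \<nu>) \<theta>"
proof -
  have [measurable]: "q (\<mu> n) \<in> borel_measurable P" "q \<nu> \<in> borel_measurable P" for n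
    using bounded_weight.measurable_q[OF bounded_weight] \<mu> \<nu> by blast+
  have C: "\<bar>q (\<mu> n) z\<bar> \<le> C" for n z
    using bounded_weight.q_bound[OF bounded_weight] \<mu> by blast
  have C0: "0 \<le> C" using C[of 0 undefined] by linarith
  note tend = q_tendsto[OF lim]
  show "(\<lambda>n. field P (q (\<mu> n)) \<theta>) \<longlonglongrightarrow> field P (q \<nu>) \<theta>"
    unfolding field_def
  proof (rule integral_dominated_convergence[where w = "\<lambda>z. C * (2 * norm \<theta> * weight (fst z))"])
    show "AE z in P. (\<lambda>n. q (\<mu> n) z *\<^sub>R grad_phi \<theta> (fst z)) \<longlonglongrightarrow> q \<nu> z *\<^sub>R grad_phi \<theta> (fst z)"
      by (intro AE_I2 tendsto_intros tend)
    show "AE z in P. norm (q (\<mu> n) z *\<^sub>R grad_phi \<theta> (fst z)) \<le> C * (2 * norm \<theta> * weight (fst z))" for n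
      unfolding norm_scaleR by (intro AE_I2 mult_mono C grad_phi_bound C0 norm_ge_zero)
    show "integrable P (\<lambda>z. C * (2 * norm \<theta> * weight (fst z)))" using integrable_weight by simp
  qed measurable
  show "(\<lambda>n. potential P (q (\<mu> n)) \<theta>) \<longlonglongrightarrow> potential P (q \<nu>) \<theta>"
    unfolding potential_def
  proof (rule integral_dominated_convergence[where w = "\<lambda>z. C * ((norm \<theta>)\<^sup>2 * weight (fst z))"])
    show "AE z in P. (\<lambda>n. q (\<mu> n) z * phi \<theta> (fst z)) \<longlonglongrightarrow> q \<nu> z * phi \<theta> (fst z)"
      by (intro AE_I2 tendsto_intros tend)
    show "AE z in P. norm (q (\<mu> n) z * phi \<theta> (fst z)) \<le> C * ((norm \<theta>)\<^sup>2 * weight (fst z))" for n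
      unfolding abs_mult real_norm_def by (intro AE_I2 mult_mono C phi_bound C0 abs_ge_zero)
    show "integrable P (\<lambda>z. C * ((norm \<theta>)\<^sup>2 * weight (fst z)))" using integrable_weight by simp
  qed measurable
qed

end

locale gradient_flow = loss_data P \<l> for P :: "((real ^ 'n::finite) \<times> real) measure" and \<l> +
  fixes \<pi>0 :: "'n param measure" and \<pi> :: "real \<Rightarrow> 'n param measure"
  assumes flow: "wasserstein_gradient_flow \<l> P \<pi>0 \<pi>"
begin

lemma \<pi>_P2: "0 \<le> t \<Longrightarrow> \<pi> t \<in> P2"
  using flow by (simp add: wasserstein_gradient_flow_def)

abbreviation V :: "real \<Rightarrow> 'n param \<Rightarrow> 'n param" where "V t \<equiv> field P (q (\<pi> t))"
abbreviation G :: "real \<Rightarrow> 'n param \<Rightarrow> real" where "G t \<equiv> potential P (q (\<pi> t))"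

lemma bw: "0 \<le> t \<Longrightarrow> bounded_weight P (q (\<pi> t)) C"
  by (intro bounded_weight \<pi>_P2)

lemma network_tendsto:
  assumes "0 \<le> t"
  shows "((\<lambda>s. network (\<pi> s) x) \<longlongrightarrow> network (\<pi> t) x) (at t within {0..})"
proof (rule LIM_zero_cancel, rule tendstoI)
  fix e :: real assume "e > 0"
  let ?N = "second_moment (\<pi> t)"
  have "((\<lambda>\<delta>. weight x * (\<delta>\<^sup>2 + \<delta> + \<delta> * ?N)) \<longlongrightarrow> weight x * (0\<^sup>2 + 0 + 0 * ?N)) (at_right 0)"
    by (intro tendsto_intros)
  then have "\<forall>\<^sub>F \<delta> in at_right 0. weight x * (\<delta>\<^sup>2 + \<delta> + \<delta> * ?N) < e"
    using \<open>e > 0\<close> by (intro order_tendstoD(2)) auto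
  from eventually_happens'[OF trivial_limit_at_right_real eventually_conj[OF this eventually_at_right_less]]
  obtain \<delta> where \<delta>: "weight x * (\<delta>\<^sup>2 + \<delta> + \<delta> * ?N) < e" "\<delta> > 0" by blast
  have "((\<lambda>s. wasserstein2 (\<pi> s) (\<pi> t)) \<longlongrightarrow> 0) (at t within {0..})"
    using flow assms by (simp add: wasserstein_gradient_flow_def)
  then have "\<forall>\<^sub>F s in at t within {0..}. wasserstein2 (\<pi> s) (\<pi> t) < \<delta>"
    using \<delta>(2) by (rule order_tendstoD(2))
  moreover have "\<forall>\<^sub>F s in at t within {0..}. 0 \<le> s"
    by (auto simp: eventually_at_filter)
  ultimately show "\<forall>\<^sub>F s in at t within {0..}. dist (network (\<pi> s) x - network (\<pi> t) x) 0 < e"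
  proof eventually_elim
    case (elim s)
    then show ?case
      using network_wasserstein_bound[OF \<pi>_P2 \<pi>_P2 elim(1) \<delta>(2), of x] \<delta>(1) assms by simp
  qed
qed

lemma V_continuous: "continuous_on {0..} (\<lambda>t. V t \<theta>)"
  unfolding continuous_on_def
proof
  fix t :: real assume "t \<in> {0..}"
  then have t: "0 \<le> t" by simp
  show "((\<lambda>t. V t \<theta>) \<longlongrightarrow> V t \<theta>) (at t within {0..})"
    unfolding tendsto_at_iff_sequentially
  proof (intro allI impI)
    fix X assume X: "\<forall>i. X i \<in> {0..} - {t}" "X \<longlonglongrightarrow> t"
    have "(\<lambda>n. network (\<pi> (X n)) x) \<longlonglongrightarrow> network (\<pi> t) x" for x
      using network_tendsto[OF t, of x] X unfolding tendsto_at_iff_sequentially comp_def by blast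
    then show "((\<lambda>t. V t \<theta>) \<circ> X) \<longlonglongrightarrow> V t \<theta>"
      unfolding comp_def using X(1) t by (intro field_tendsto \<pi>_P2) auto
  qed
qed

end

section \<open>Trajectories\<close>

text \<open>The quadratic form that trajectories conserve; its sign decides membership in
  \<open>Theta\<close>.\<close>

definition cone_form :: "'n::finite param \<Rightarrow> real" where
  "cone_form \<theta> = (fst \<theta>)\<^sup>2 - (norm (snd \<theta>))\<^sup>2"

lemma Theta_iff_cone_form: "\<theta> \<in> Theta \<longleftrightarrow> cone_form \<theta> < 0"
  by (cases \<theta>) (simp add: Theta_def cone_form_def norm_Pair)

lemma Theta_bar_iff_cone_form: "\<theta> \<in> Theta_bar \<longleftrightarrow> cone_form \<theta> \<le> 0"
  by (cases \<theta>) (simp add: Theta_bar_eq cone_form_def norm_Pair)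

lemma continuous_cone_form: "continuous_on S cone_form"
  unfolding cone_form_def[abs_def] by (intro continuous_intros)

text \<open>A retraction onto the closure of the parameter set; it turns a field on that set into a
  globally Lipschitz one.\<close>

definition clip :: "'n::finite param \<Rightarrow> 'n param" where
  "clip \<theta> = (max (- norm (snd \<theta>)) (min (norm (snd \<theta>)) (fst \<theta>)), snd \<theta>)"

lemma clip_in_Theta_bar: "clip \<theta> \<in> Theta_bar"
proof -
  have "\<bar>max (- norm (snd \<theta>)) (min (norm (snd \<theta>)) (fst \<theta>))\<bar> \<le> norm (snd \<theta>)"
    using norm_ge_zero[of "snd \<theta>"] by (auto simp: max_def min_def)
  then show ?thesis
    by (simp add: Theta_bar_iff_cone_form cone_form_def clip_def abs_le_square_iff[symmetric])
qed

lemma clip_eq: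
  assumes "\<theta> \<in> Theta_bar"
  shows "clip \<theta> = \<theta>"
proof -
  have "\<bar>fst \<theta>\<bar> \<le> norm (snd \<theta>)"
    using assms abs_le_square_iff[of "fst \<theta>" "norm (snd \<theta>)"] by (simp add: Theta_bar_iff_cone_form cone_form_def)
  then have "max (- norm (snd \<theta>)) (min (norm (snd \<theta>)) (fst \<theta>)) = fst \<theta>" by linarith
  then show ?thesis by (simp add: clip_def)
qed

lemma max_difference: "\<bar>max a b - max c d\<bar> \<le> \<bar>a - c\<bar> + \<bar>b - d\<bar>" for a :: real
  by linarith

lemma min_difference: "\<bar>min a b - min c d\<bar> \<le> \<bar>a - c\<bar> + \<bar>b - d\<bar>" for a :: real
  by linarith

lemma clamp_difference:
  "\<bar>max (- r) (min r a) - max (- s) (min s b)\<bar> \<le> \<bar>a - b\<bar> + 2 * \<bar>r - s\<bar>" for a :: real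
proof -
  have "\<bar>max (- r) (min r a) - max (- s) (min s b)\<bar> \<le> \<bar>- r - - s\<bar> + \<bar>min r a - min s b\<bar>"
    by (rule max_difference)
  also have "\<bar>min r a - min s b\<bar> \<le> \<bar>r - s\<bar> + \<bar>a - b\<bar>" by (rule min_difference)
  also have "\<bar>- r - - s\<bar> = \<bar>r - s\<bar>" by (simp add: abs_minus_commute)
  finally show ?thesis by argo
qed

lemma clip_lipschitz: "norm (clip \<theta> - clip \<eta>) \<le> 4 * norm (\<theta> - \<eta>)"
proof -
  have n: "\<bar>norm (snd \<theta>) - norm (snd \<eta>)\<bar> \<le> norm (snd \<theta> - snd \<eta>)" by (rule norm_triangle_ineq3)
  have s: "norm (snd \<theta> - snd \<eta>) \<le> norm (\<theta> - \<eta>)" using norm_snd_le[of "\<theta> - \<eta>"] by simp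
  have f: "\<bar>fst \<theta> - fst \<eta>\<bar> \<le> norm (\<theta> - \<eta>)" using norm_fst_le[of "\<theta> - \<eta>"] by simp
  have "\<bar>fst (clip \<theta>) - fst (clip \<eta>)\<bar> \<le> \<bar>fst \<theta> - fst \<eta>\<bar> + 2 * \<bar>norm (snd \<theta>) - norm (snd \<eta>)\<bar>"
    unfolding clip_def fst_conv by (rule clamp_difference)
  moreover have "norm (clip \<theta> - clip \<eta>) \<le> \<bar>fst (clip \<theta>) - fst (clip \<eta>)\<bar> + norm (snd \<theta> - snd \<eta>)"
  proof -
    have "snd (clip \<theta>) = snd \<theta>" "snd (clip \<eta>) = snd \<eta>" by (simp_all only: clip_def snd_conv)
    then have "clip \<theta> - clip \<eta> = (fst (clip \<theta>) - fst (clip \<eta>), snd \<theta> - snd \<eta>)"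
      by (simp only: prod_eq_iff fst_diff snd_diff fst_conv snd_conv simp_thms)
    then show ?thesis using norm_Pair_le by (metis real_norm_def)
  qed
  ultimately have "norm (clip \<theta> - clip \<eta>)
      \<le> \<bar>fst \<theta> - fst \<eta>\<bar> + 2 * \<bar>norm (snd \<theta>) - norm (snd \<eta>)\<bar> + norm (snd \<theta> - snd \<eta>)" by argo
  also have "\<dots> \<le> 4 * norm (\<theta> - \<eta>)" using n s f by argo
  finally show ?thesis .
qed

text \<open>The clipped equation has a global solution, but it agrees with the original one only
  inside \<open>Theta_bar\<close>, and conservation of \<open>cone_form\<close> is available only
  there. The circle is broken by a barrier strictly between the initial value and 0.\<close>

lemma trajectory_in_Theta:
  fixes F :: "real \<Rightarrow> 'n::finite param \<Rightarrow> 'n param"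
  assumes T: "0 \<le> T" and L: "0 < L"
    and cont: "\<And>\<theta>. \<theta> \<in> Theta_bar \<Longrightarrow> continuous_on {0..T} (\<lambda>s. F s \<theta>)"
    and lip: "\<And>s \<theta> \<eta>. s \<in> {0..T} \<Longrightarrow> \<theta> \<in> Theta_bar \<Longrightarrow> \<eta> \<in> Theta_bar \<Longrightarrow>
      norm (F s \<theta> - F s \<eta>) \<le> L * norm (\<theta> - \<eta>)"
    and conserve: "\<And>s \<theta>. s \<in> {0..T} \<Longrightarrow> fst \<theta> * fst (F s \<theta>) = snd \<theta> \<bullet> snd (F s \<theta>)"
    and \<theta>0: "\<theta>0 \<in> Theta"
  obtains c where "c 0 = \<theta>0"
    "\<And>s. s \<in> {0..T} \<Longrightarrow> (c has_vector_derivative F s (c s)) (at s within {0..T})"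
    "\<And>s. s \<in> {0..T} \<Longrightarrow> cone_form (c s) = cone_form \<theta>0"
proof -
  obtain c where c0: "c 0 = \<theta>0"
    and c': "\<And>s. s \<in> {0..T} \<Longrightarrow> (c has_vector_derivative F s (clip (c s))) (at s within {0..T})"
  proof (rule picard_lindelof[OF T, of "4 * L" "\<lambda>s \<theta>. F s (clip \<theta>)" \<theta>0])
    show "continuous_on {0..T} (\<lambda>s. F s (clip \<theta>))" for \<theta> by (rule cont[OF clip_in_Theta_bar])
    fix s \<theta> \<eta> assume s: "s \<in> {0..T}"
    have "norm (F s (clip \<theta>) - F s (clip \<eta>)) \<le> L * norm (clip \<theta> - clip \<eta>)"
      using s by (rule lip[OF _ clip_in_Theta_bar clip_in_Theta_bar])
    also have "\<dots> \<le> L * (4 * norm (\<theta> - \<eta>))" using L by (intro mult_left_mono clip_lipschitz) simp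
    finally show "norm (F s (clip \<theta>) - F s (clip \<eta>)) \<le> 4 * L * norm (\<theta> - \<eta>)" by simp
  qed (use L in auto)
  \<comment> \<open>A reflection that turns \<open>cone_form\<close> into the pairing of \<theta>
    with J \<theta>, so that the product rule for inner products applies.\<close>
  define J :: "'n param \<Rightarrow> 'n param" where "J \<theta> = (fst \<theta>, - snd \<theta>)" for \<theta>
  have J: "bounded_linear J" unfolding J_def
    by (intro bounded_linear_Pair bounded_linear_minus bounded_linear_fst bounded_linear_snd)
  have QJ: "cone_form \<theta> = \<theta> \<bullet> J \<theta>" for \<theta> 
    unfolding inner_prod_def[of \<theta>] by (simp add: cone_form_def J_def dot_square_norm power2_eq_square del: inner_Pair)
  define cone_form' where "cone_form' s = 2 * (J (c s) \<bullet> F s (clip (c s)))" for s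
  have dQ: "((\<lambda>s. cone_form (c s)) has_real_derivative cone_form' s) (at s within {0..T})" if "s \<in> {0..T}" for s
  proof -
    have JJ: "x \<bullet> J y = J x \<bullet> y" for x y
      unfolding inner_prod_def[of x] inner_prod_def[of "J x"] by (simp add: J_def)
    have E: "c s \<bullet> J (F s (clip (c s))) + F s (clip (c s)) \<bullet> J (c s) = cone_form' s"
      unfolding cone_form'_def JJ[of "c s"] inner_commute[of "F s (clip (c s))"] by simp
    show ?thesis
      using inner_has_real_derivative[OF c'[OF that] bounded_linear.has_vector_derivative[OF J c'[OF that]]]
      unfolding QJ E .
  qed
  have cone_form'0: "cone_form' s = 0" if "s \<in> {0..T}" "cone_form (c s) \<le> 0" for s
    using conserve[OF that(1), of "c s"] clip_eq[of "c s"] that(2)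
    unfolding cone_form'_def inner_prod_def[of "J (c s)"] by (simp add: J_def Theta_bar_iff_cone_form)
  \<comment> \<open>The barrier b starts at three quarters of the negative initial value and rises
    with slope - k > 0 by less than a quarter of its modulus until T, so it stays negative. At a
    contact \<open>cone_form\<close> is stationary while b rises, hence no crossing.\<close>
  define k where "k = cone_form \<theta>0 / (4 * (T + 1))"
  define b where "b s = 3/4 * cone_form \<theta>0 - k * s" for s
  have Q0: "cone_form \<theta>0 < 0" using \<theta>0 by (simp add: Theta_iff_cone_form)
  then have k: "k < 0" using T by (simp add: k_def divide_neg_pos)
  have b: "b s < 0" if "s \<in> {0..T}" for s
  proof -
    have "k * (T + 1) = cone_form \<theta>0 / 4" using T by (simp add: k_def field_simps)
    moreover have "k * (T + 1) \<le> k * s" using k that by (intro mult_left_mono_neg) auto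
    ultimately show ?thesis using Q0 by (simp add: b_def)
  qed
  have Qneg: "cone_form (c s) < b s" if "s \<in> {0..T}" for s
  proof -
    have "cone_form (c s) - b s < 0"
    proof (rule strict_barrier[OF _ _ _ that])
      show "((\<lambda>s. cone_form (c s) - b s) has_real_derivative cone_form' s + k) (at s within {0..T})"
        if "s \<in> {0..T}" for s
        unfolding b_def using dQ[OF that] by (auto intro!: derivative_eq_intros)
      show "cone_form (c 0) - b 0 < 0" using Q0 by (simp add: b_def c0)
      show "cone_form' s + k < 0" if "s \<in> {0..T}" "cone_form (c s) - b s = 0" for s
        using cone_form'0[OF that(1)] b[OF that(1)] that(2) k by simp
    qed
    then show ?thesis by simp
  qed
  then have Qle: "cone_form (c s) \<le> 0" if "s \<in> {0..T}" for s using b that by force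
  have "cone_form (c s) = cone_form \<theta>0" if s: "s \<in> {0..T}" for s
  proof (rule antisym)
    have sub: "{0..s} \<subseteq> {0..T}" using s by auto
    have d: "((\<lambda>s. cone_form (c s)) has_real_derivative 0) (at r within {0..s})" if "r \<in> {0..s}" for r
      using dQ[of r] cone_form'0[of r] Qle[of r] that s sub by (auto intro: DERIV_subset)
    show "cone_form (c s) \<le> cone_form \<theta>0"
      using nonincreasing_within[of 0 s "\<lambda>s. cone_form (c s)" "\<lambda>_. 0"] d s by (simp add: c0)
    show "cone_form \<theta>0 \<le> cone_form (c s)"
      using nonincreasing_within[of 0 s "\<lambda>s. - cone_form (c s)" "\<lambda>_. 0"] DERIV_minus[OF d] s by (simp add: c0)
  qed
  moreover have "(c has_vector_derivative F s (c s)) (at s within {0..T})" if "s \<in> {0..T}" for s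
    using c'[OF that] clip_eq[of "c s"] Qle[OF that] by (simp add: Theta_bar_iff_cone_form)
  ultimately show thesis using that c0 by blast
qed

section \<open>Transport of mass\<close>

lemma grad_inner:
  assumes "(f has_derivative D) (at x)"
  shows "grad f x \<bullet> v = D v"
proof -
  interpret bounded_linear D using assms by (rule has_derivative_bounded_linear)
  have D: "frechet_derivative f (at x) = D" using frechet_derivative_at[OF assms] by simp
  have "grad f x \<bullet> v = (\<Sum>e\<in>Basis. (v \<bullet> e) * D e)"
    unfolding grad_def D by (subst inner_sum_left) (simp add: inner_commute[of v] mult.commute)
  also have "\<dots> = D (\<Sum>e\<in>Basis. (v \<bullet> e) *\<^sub>R e)" by (simp add: sum scaleR)
  finally show ?thesis by (simp add: euclidean_representation)
qed

lemma test_function_continuous: "\<psi> \<in> test_functions U \<Longrightarrow> continuous_on UNIV \<psi>"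
proof -
  assume "\<psi> \<in> test_functions U"
  then have "C_k 0 \<psi>" unfolding test_functions_def by blast
  then show ?thesis by simp
qed

lemma test_function_grad:
  assumes "\<psi> \<in> test_functions U"
  shows "continuous_on UNIV (grad \<psi>)" "grad \<psi> x \<noteq> 0 \<Longrightarrow> x \<in> closure {x. \<psi> x \<noteq> 0}"
proof -
  have "C_k (Suc 0) \<psi>" using assms unfolding test_functions_def by blast
  then show "continuous_on UNIV (grad \<psi>)"
    unfolding grad_def[abs_def] by (intro continuous_intros) simp
  assume "grad \<psi> x \<noteq> 0"
  show "x \<in> closure {x. \<psi> x \<noteq> 0}"
  proof (rule ccontr)
    assume "x \<notin> closure {x. \<psi> x \<noteq> 0}"
    then have x: "x \<in> - closure {x. \<psi> x \<noteq> 0}" by simp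
    have "(\<psi> has_derivative (\<lambda>v. 0)) (at x)"
    proof (rule has_derivative_transform_within_open[where f = "\<lambda>_. 0", OF has_derivative_const, rotated])
      show "0 = \<psi> y" if "y \<in> - closure {x. \<psi> x \<noteq> 0}" for y
        using that closure_subset[of "{x. \<psi> x \<noteq> 0}"] by auto
    qed (use x in auto)
    from grad_inner[OF this, of "grad \<psi> x"] \<open>grad \<psi> x \<noteq> 0\<close> show False by simp
  qed
qed

lemma compact_support_bounded:
  fixes f :: "'a::euclidean_space \<Rightarrow> 'b::real_normed_vector"
  assumes "continuous_on UNIV f" "compact S" "\<And>x. f x \<noteq> 0 \<Longrightarrow> x \<in> S"
  obtains B where "0 \<le> B" "\<And>x. norm (f x) \<le> B"
proof -
  have "bounded (f ` S)"
    by (intro compact_imp_bounded compact_continuous_image continuous_on_subset[OF assms(1)] assms(2)) simp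
  then obtain B where "\<forall>y\<in>f ` S. norm y \<le> B" unfolding bounded_iff by blast
  then have "norm (f x) \<le> max B 0" for x
    using assms(3)[of x] by (cases "f x = 0") (auto simp: le_max_iff_disj)
  then show thesis using that[of "max B 0"] by simp
qed

lemma P2_borel_sets: "\<mu> \<in> P2 \<Longrightarrow> A \<in> sets borel \<Longrightarrow> A \<subseteq> Theta_bar \<Longrightarrow> A \<in> sets \<mu>"
  by (simp add: P2D(2) sets_restrict_space_iff)

lemma P2_set_integrable:
  fixes f :: "'n::finite param \<Rightarrow> real"
  assumes \<mu>: "\<mu> \<in> P2" and f: "continuous_on Theta f" and B: "\<And>\<theta>. \<theta> \<in> Theta \<Longrightarrow> \<bar>f \<theta>\<bar> \<le> B"
  shows "set_integrable \<mu> Theta f"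
  unfolding set_integrable_def
proof -
  interpret prob_space \<mu> by (rule P2D(1)[OF \<mu>])
  have "(\<lambda>\<theta>. indicator Theta \<theta> *\<^sub>R f \<theta>) \<in> borel_measurable borel"
    using f borel_open[OF open_Theta] by (intro borel_measurable_continuous_on_indicator) auto
  then have "(\<lambda>\<theta>. indicator Theta \<theta> *\<^sub>R f \<theta>) \<in> borel_measurable \<mu>"
    by (rule P2_measurable[OF \<mu>])
  moreover have "norm (indicator Theta \<theta> *\<^sub>R f \<theta>) \<le> max B 0" for \<theta>
    using B[of \<theta>] by (auto simp: indicator_def)
  ultimately show "integrable \<mu> (\<lambda>\<theta>. indicator Theta \<theta> *\<^sub>R f \<theta>)"
    by (intro integrable_const_bound[of _ "max B 0"]) auto
qed

lemma P2_set_integrable_test: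
  assumes "\<mu> \<in> P2" "\<psi> \<in> test_functions Theta"
  shows "set_integrable \<mu> Theta \<psi>"
proof -
  have "compact (closure {x. \<psi> x \<noteq> 0})" using assms(2) by (simp add: test_functions_def)
  from compact_support_bounded[OF test_function_continuous[OF assms(2)] this]
  obtain B where "\<And>x. norm (\<psi> x) \<le> B" using closure_subset by (metis (mono_tags, lifting) mem_Collect_eq subsetD)
  then show ?thesis
    by (intro P2_set_integrable[of _ _ B] assms(1) continuous_on_subset[OF test_function_continuous[OF assms(2)]]) auto
qed

context gradient_flow
begin

text \<open>The summand 1 makes the constant positive, as division by it and
  \<open>picard_lindelof\<close> demand.\<close>

definition L :: real where "L = C * (2 * mean_weight + 2 * halfspace_lip) + 1"

lemma C_nonneg: "0 \<le> C"
  using partial1_bound[of 0 0] by linarith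

lemma L_pos: "0 < L"
  unfolding L_def using C_nonneg mean_weight_nonneg halfspace_lip(1) by (simp add: add_nonneg_pos)

lemma
  assumes "0 \<le> t"
  shows V_lipschitz: "\<theta> \<in> Theta_bar \<Longrightarrow> \<eta> \<in> Theta_bar \<Longrightarrow> norm (V t \<theta> - V t \<eta>) \<le> L * norm (\<theta> - \<eta>)"
    and V_norm: "norm (V t \<theta>) \<le> L * norm \<theta>"
    and G_taylor: "\<theta> \<in> Theta \<Longrightarrow> \<eta> \<in> Theta \<Longrightarrow> \<bar>G t \<eta> - G t \<theta> - V t \<theta> \<bullet> (\<eta> - \<theta>)\<bar> \<le> L * (norm (\<eta> - \<theta>))\<^sup>2"
proof -
  interpret b: bounded_weight P "q (\<pi> t)" C using assms by (rule bw)
  have L: "b.L \<le> L" by (simp add: b.L_def L_def)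
  show "norm (V t \<theta> - V t \<eta>) \<le> L * norm (\<theta> - \<eta>)" if "\<theta> \<in> Theta_bar" "\<eta> \<in> Theta_bar"
    using b.field_lipschitz[OF that] mult_right_mono[OF L, of "norm (\<theta> - \<eta>)"] by simp
  show "norm (V t \<theta>) \<le> L * norm \<theta>"
    using b.field_norm[of \<theta>] mult_right_mono[OF L, of "norm \<theta>"] by simp
  show "\<bar>G t \<eta> - G t \<theta> - V t \<theta> \<bullet> (\<eta> - \<theta>)\<bar> \<le> L * (norm (\<eta> - \<theta>))\<^sup>2" if "\<theta> \<in> Theta" "\<eta> \<in> Theta"
    using b.potential_taylor[OF that] mult_right_mono[OF L, of "(norm (\<eta> - \<theta>))\<^sup>2"] by simp
qed

lemma V_continuous_on: "0 \<le> t \<Longrightarrow> continuous_on Theta_bar (V t)"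
  using V_lipschitz[of t] L_pos
  by (intro lipschitz_on_continuous_on[of L] lipschitz_onI) (auto simp: dist_norm)

lemma continuity_equation:
  assumes "\<psi> \<in> test_functions Theta" "0 \<le> t"
  shows "((\<lambda>s. LINT \<theta>:Theta|\<pi> s. \<psi> \<theta>) has_real_derivative
           - (LINT \<theta>:Theta|\<pi> t. grad \<psi> \<theta> \<bullet> V t \<theta>)) (at t within {0..})"
  using flow assms by (simp add: wasserstein_gradient_flow_def grad_delta_risk_eq)

lemma set_integrable_grad:
  assumes \<psi>: "\<psi> \<in> test_functions Theta" and t: "0 \<le> t"
  shows "set_integrable (\<pi> t) Theta (\<lambda>\<theta>. grad \<psi> \<theta> \<bullet> V t \<theta>)"
proof -
  let ?S = "closure {x. \<psi> x \<noteq> 0}"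
  have S: "compact ?S" using \<psi> by (simp add: test_functions_def)
  obtain B where B: "0 \<le> B" "\<And>x. norm (grad \<psi> x) \<le> B"
    using compact_support_bounded[OF test_function_grad(1)[OF \<psi>] S] test_function_grad(2)[OF \<psi>] by metis
  obtain R where R: "0 \<le> R" "\<And>x. x \<in> ?S \<Longrightarrow> norm x \<le> R"
    using compact_imp_bounded[OF S] unfolding bounded_pos by (metis less_imp_le)
  show ?thesis
  proof (rule P2_set_integrable[OF \<pi>_P2[OF t], of _ "B * (L * R)"])
    show "continuous_on Theta (\<lambda>\<theta>. grad \<psi> \<theta> \<bullet> V t \<theta>)"
      using test_function_grad(1)[OF \<psi>] V_continuous_on[OF t] closure_subset[of Theta]
      by (intro continuous_intros) (auto intro: continuous_on_subset)
    fix \<theta> :: "'n param"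
    show "\<bar>grad \<psi> \<theta> \<bullet> V t \<theta>\<bar> \<le> B * (L * R)"
    proof (cases "grad \<psi> \<theta> = 0")
      case True
      then show ?thesis using B(1) R(1) L_pos by simp
    next
      case False
      then have "norm \<theta> \<le> R" by (intro R(2) test_function_grad(2)[OF \<psi>])
      then have "norm (V t \<theta>) \<le> L * R"
        using V_norm[OF t, of \<theta>] L_pos by (meson less_imp_le mult_left_mono order_trans)
      then have "norm (grad \<psi> \<theta>) * norm (V t \<theta>) \<le> B * (L * R)"
        using B by (intro mult_mono) auto
      then show ?thesis using Cauchy_Schwarz_ineq2[of "grad \<psi> \<theta>" "V t \<theta>"] by linarith
    qed
  qed
qed

text \<open>The hypothesis \<open>le\<close> says that \<open>\<Psi>\<close> does not decrease along the trajectories of \<open>- V\<close>.\<close>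

lemma moving_test_function_mono:
  fixes \<Psi> D :: "real \<Rightarrow> 'n param \<Rightarrow> real"
  assumes T: "0 \<le> T"
    and test: "\<And>s. s \<in> {0..T} \<Longrightarrow> \<Psi> s \<in> test_functions Theta" "\<And>s. s \<in> {0..T} \<Longrightarrow> D s \<in> test_functions Theta"
    and deriv: "\<And>s \<theta>. s \<in> {0..T} \<Longrightarrow> ((\<lambda>s. \<Psi> s \<theta>) has_real_derivative D s \<theta>) (at s within {0..T})"
    and cont: "continuous_on ({0..T} \<times> UNIV) (\<lambda>z. D (fst z) (snd z))"
    and supp: "\<And>s \<theta>. s \<in> {0..T} \<Longrightarrow> norm \<theta> > R \<Longrightarrow> D s \<theta> = 0"
    and le: "\<And>s \<theta>. s \<in> {0..T} \<Longrightarrow> \<theta> \<in> Theta \<Longrightarrow> grad (\<Psi> s) \<theta> \<bullet> V s \<theta> \<le> D s \<theta>"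
  shows "(LINT \<theta>:Theta|\<pi> 0. \<Psi> 0 \<theta>) \<le> (LINT \<theta>:Theta|\<pi> T. \<Psi> T \<theta>)"
proof -
  define \<Phi> where "\<Phi> s = (LINT \<theta>:Theta|\<pi> s. \<Psi> s \<theta>)" for s
  have uc: "uniformly_continuous_on ({0..T} \<times> cball 0 R) (\<lambda>z. D (fst z) (snd z))"
    by (intro compact_uniformly_continuous continuous_on_subset[OF cont] compact_Times) auto
  \<comment> \<open>First-order expansion in time, uniform in \<theta>: the functions
    \<open>D s\<close> vanish outside one fixed ball, on which D is uniformly continuous.\<close>
  have quot: "\<exists>\<delta>>0. \<forall>r\<in>{0..T}. \<forall>s\<in>{0..T}. \<forall>\<theta>. \<bar>r - s\<bar> < \<delta> \<longrightarrow>
      \<bar>\<Psi> r \<theta> - \<Psi> s \<theta> - (r - s) * D s \<theta>\<bar> \<le> e * \<bar>r - s\<bar>" if "e > 0" for e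
  proof -
    obtain \<delta> where \<delta>: "\<delta> > 0" "\<And>z z'. z \<in> {0..T} \<times> cball 0 R \<Longrightarrow> z' \<in> {0..T} \<times> cball 0 R \<Longrightarrow>
        dist z' z < \<delta> \<Longrightarrow> dist (D (fst z') (snd z')) (D (fst z) (snd z)) < e"
      using uc \<open>e > 0\<close> unfolding uniformly_continuous_on_def by metis
    have near: "\<bar>D r \<theta> - D s \<theta>\<bar> \<le> e" if "r \<in> {0..T}" "s \<in> {0..T}" "\<bar>r - s\<bar> < \<delta>" for r s \<theta>
    proof (cases "norm \<theta> > R")
      case True
      then show ?thesis using supp that \<open>e > 0\<close> by simp
    next
      case False
      then show ?thesis using \<delta>(2)[of "(s, \<theta>)" "(r, \<theta>)"] that by (simp add: dist_Pair_Pair dist_real_def)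
    qed
    show ?thesis
    proof (intro exI[of _ \<delta>] conjI ballI allI impI \<delta>(1))
      fix r s \<theta> assume rs: "r \<in> {0..T}" "s \<in> {0..T}" "\<bar>r - s\<bar> < \<delta>"
      let ?S = "{0..T} \<inter> ball s \<delta>"
      have "norm ((\<Psi> r \<theta> - r * D s \<theta>) - (\<Psi> s \<theta> - s * D s \<theta>)) \<le> e * norm (r - s)"
      proof (rule field_differentiable_bound[of ?S "\<lambda>z. \<Psi> z \<theta> - z * D s \<theta>" "\<lambda>z. D z \<theta> - D s \<theta>"])
        show "convex ?S" by (intro convex_Int) auto
        show "((\<lambda>z. \<Psi> z \<theta> - z * D s \<theta>) has_real_derivative D z \<theta> - D s \<theta>) (at z within ?S)" if "z \<in> ?S" for z
          using DERIV_subset[OF deriv[of z \<theta>], of ?S] that by (auto intro!: derivative_eq_intros)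
        show "norm (D z \<theta> - D s \<theta>) \<le> e" if "z \<in> ?S" for z
          using near[of z s \<theta>] that rs by (auto simp: dist_real_def)
      qed (use rs \<delta>(1) in \<open>auto simp: dist_real_def\<close>)
      then show "\<bar>\<Psi> r \<theta> - \<Psi> s \<theta> - (r - s) * D s \<theta>\<bar> \<le> e * \<bar>r - s\<bar>"
        by (simp add: algebra_simps)
    qed
  qed
  have d\<Phi>: "(\<Phi> has_real_derivative ((LINT \<theta>:Theta|\<pi> s. D s \<theta>) - (LINT \<theta>:Theta|\<pi> s. grad (\<Psi> s) \<theta> \<bullet> V s \<theta>)))
      (at s within {0..T})" if s: "s \<in> {0..T}" for s
    unfolding has_field_derivative_iff
  proof -
    have sub: "{0..T} \<subseteq> {0..}" and s0: "0 \<le> s" using s by auto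
    define A where "A r = (LINT \<theta>:Theta|\<pi> r. (\<Psi> r \<theta> - \<Psi> s \<theta> - (r - s) * D s \<theta>)) / (r - s)" for r
    have intA: "set_integrable (\<pi> r) Theta (\<lambda>\<theta>. \<Psi> r \<theta> - \<Psi> s \<theta> - (r - s) * D s \<theta>)" if "r \<in> {0..T}" for r
      using that s by (intro set_integral_diff set_integrable_mult_right P2_set_integrable_test \<pi>_P2 test) auto
    have split: "(\<Phi> r - \<Phi> s) / (r - s) = A r + (LINT \<theta>:Theta|\<pi> r. D s \<theta>)
        + ((LINT \<theta>:Theta|\<pi> r. \<Psi> s \<theta>) - (LINT \<theta>:Theta|\<pi> s. \<Psi> s \<theta>)) / (r - s)"
      if "r \<in> {0..T}" "r \<noteq> s" for r
    proof -
      have i: "set_integrable (\<pi> r) Theta (\<Psi> r)" "set_integrable (\<pi> r) Theta (\<Psi> s)" "set_integrable (\<pi> r) Theta (D s)"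
        using that s by (auto intro!: P2_set_integrable_test \<pi>_P2 test)
      have E: "(LINT \<theta>:Theta|\<pi> r. (\<Psi> r \<theta> - \<Psi> s \<theta> - (r - s) * D s \<theta>))
          = \<Phi> r - (LINT \<theta>:Theta|\<pi> r. \<Psi> s \<theta>) - (r - s) * (LINT \<theta>:Theta|\<pi> r. D s \<theta>)"
        using i by (simp add: set_integral_diff set_integrable_mult_right \<Phi>_def)
      show ?thesis using that(2) unfolding A_def E by (simp add: \<Phi>_def diff_divide_distrib)
    qed
    have "(A \<longlongrightarrow> 0) (at s within {0..T})"
    proof (rule tendstoI)
      fix e :: real assume "e > 0"
      then have "e / 2 > 0" by simp
      from quot[OF this] obtain \<delta> where \<delta>0: "\<delta> > 0" "\<forall>r\<in>{0..T}. \<forall>s\<in>{0..T}. \<forall>\<theta>. \<bar>r - s\<bar> < \<delta> \<longrightarrow>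
          \<bar>\<Psi> r \<theta> - \<Psi> s \<theta> - (r - s) * D s \<theta>\<bar> \<le> e / 2 * \<bar>r - s\<bar>" by (elim exE conjE)
      note \<delta> = \<delta>0(1) \<delta>0(2)[rule_format, OF _ s]
      have "dist (A r) 0 < e" if r: "r \<in> {0..T}" "r \<noteq> s" "\<bar>r - s\<bar> < \<delta>" for r
      proof -
        interpret \<pi>r: prob_space "\<pi> r" using r by (intro P2D(1) \<pi>_P2) auto
        have "\<bar>LINT \<theta>:Theta|\<pi> r. (\<Psi> r \<theta> - \<Psi> s \<theta> - (r - s) * D s \<theta>)\<bar> \<le> (LINT \<theta>|\<pi> r. e / 2 * \<bar>r - s\<bar>)"
          unfolding set_lebesgue_integral_def real_norm_def[symmetric]
        proof (rule Bochner_Integration.integral_norm_bound_integral)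
          show "integrable (\<pi> r) (\<lambda>\<theta>. indicator Theta \<theta> *\<^sub>R (\<Psi> r \<theta> - \<Psi> s \<theta> - (r - s) * D s \<theta>))"
            using intA[OF r(1)] by (simp add: set_integrable_def)
          show "norm (indicator Theta \<theta> *\<^sub>R (\<Psi> r \<theta> - \<Psi> s \<theta> - (r - s) * D s \<theta>)) \<le> e / 2 * norm (r - s)" for \<theta>
            using \<delta>(2)[OF r(1) r(3), of \<theta>] \<open>e > 0\<close> by (auto simp: indicator_def)
        qed auto
        also have "\<dots> = e / 2 * \<bar>r - s\<bar>" by (simp add: \<pi>r.prob_space)
        finally have "\<bar>A r\<bar> \<le> e / 2"
          using r(2) by (simp add: A_def abs_divide pos_divide_le_eq)
        then show ?thesis using \<open>e > 0\<close> by simp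
      qed
      then show "\<forall>\<^sub>F r in at s within {0..T}. dist (A r) 0 < e"
        unfolding eventually_at using \<delta>(1) by (intro exI[of _ \<delta>]) (auto simp: dist_real_def)
    qed
    \<comment> \<open>Continuity in time of this integral is read off from the continuity equation
      for \<open>D s\<close>, which is the reason for requiring \<open>D s\<close> to be a test
      function.\<close>
    moreover have "((\<lambda>r. LINT \<theta>:Theta|\<pi> r. D s \<theta>) \<longlongrightarrow> (LINT \<theta>:Theta|\<pi> s. D s \<theta>)) (at s within {0..T})"
      using DERIV_continuous[OF DERIV_subset[OF continuity_equation[OF test(2)[OF s] s0] sub]]
      by (simp add: continuous_within)
    moreover have "((\<lambda>r. ((LINT \<theta>:Theta|\<pi> r. \<Psi> s \<theta>) - (LINT \<theta>:Theta|\<pi> s. \<Psi> s \<theta>)) / (r - s))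
        \<longlongrightarrow> - (LINT \<theta>:Theta|\<pi> s. grad (\<Psi> s) \<theta> \<bullet> V s \<theta>)) (at s within {0..T})"
      using DERIV_subset[OF continuity_equation[OF test(1)[OF s] s0] sub]
      by (simp add: has_field_derivative_iff)
    ultimately have "((\<lambda>r. A r + (LINT \<theta>:Theta|\<pi> r. D s \<theta>)
        + ((LINT \<theta>:Theta|\<pi> r. \<Psi> s \<theta>) - (LINT \<theta>:Theta|\<pi> s. \<Psi> s \<theta>)) / (r - s))
        \<longlongrightarrow> 0 + (LINT \<theta>:Theta|\<pi> s. D s \<theta>) + - (LINT \<theta>:Theta|\<pi> s. grad (\<Psi> s) \<theta> \<bullet> V s \<theta>)) (at s within {0..T})"
      by (intro tendsto_add)
    moreover have "\<forall>\<^sub>F r in at s within {0..T}. A r + (LINT \<theta>:Theta|\<pi> r. D s \<theta>)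
        + ((LINT \<theta>:Theta|\<pi> r. \<Psi> s \<theta>) - (LINT \<theta>:Theta|\<pi> s. \<Psi> s \<theta>)) / (r - s) = (\<Phi> r - \<Phi> s) / (r - s)"
      unfolding eventually_at_filter using split by (intro always_eventually) auto
    ultimately show "((\<lambda>r. (\<Phi> r - \<Phi> s) / (r - s)) \<longlongrightarrow>
        (LINT \<theta>:Theta|\<pi> s. D s \<theta>) - (LINT \<theta>:Theta|\<pi> s. grad (\<Psi> s) \<theta> \<bullet> V s \<theta>)) (at s within {0..T})"
      unfolding add_0_left add_uminus_conv_diff by (rule Lim_transform_eventually)
  qed
  have "- \<Phi> T \<le> - \<Phi> 0"
  proof (rule nonincreasing_within[OF T DERIV_minus[OF d\<Phi>]])
    fix s assume s: "s \<in> {0..T}"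
    have "(LINT \<theta>:Theta|\<pi> s. grad (\<Psi> s) \<theta> \<bullet> V s \<theta>) \<le> (LINT \<theta>:Theta|\<pi> s. D s \<theta>)"
      using s by (intro set_integral_mono set_integrable_grad P2_set_integrable_test \<pi>_P2 test le) auto
    then show "- ((LINT \<theta>:Theta|\<pi> s. D s \<theta>) - (LINT \<theta>:Theta|\<pi> s. grad (\<Psi> s) \<theta> \<bullet> V s \<theta>)) \<le> 0" by simp
  qed
  then show ?thesis by (simp add: \<Phi>_def)
qed

end

section \<open>Compactly supported bumps carried by trajectories\<close>

lemma flat_one_has_derivative: "(flat 1 has_real_derivative flat [:0, 0, 1:] x) (at x)"
  using flat_has_derivative[of 1 x] by (simp add: one_pCons)

lemma continuous_flat: "continuous_on S (flat p)"
  using flat_has_derivative[of p] by (intro continuous_at_imp_continuous_on) (blast intro: DERIV_isCont)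

lemma flat_nonpos: "x \<le> 0 \<Longrightarrow> flat p x = 0"
  by (simp add: flat_def)

lemma flat_one_nonneg: "0 \<le> flat 1 x"
  by (simp add: flat_def)

lemma flat_one_mono: "x \<le> y \<Longrightarrow> flat 1 x \<le> flat 1 y"
  by (auto simp: flat_def intro: divide_left_mono)

lemma flat_derivative_nonneg: "0 \<le> flat [:0, 0, 1:] x"
  by (simp add: flat_def)

lemma smooth_minus: "f \<in> smooth \<Longrightarrow> (\<lambda>x. - f x) \<in> smooth"
  using smooth.mult[OF smooth.const[of "-1"]] by simp

lemma smooth_diff:
  assumes "f \<in> smooth" "g \<in> smooth"
  shows "(\<lambda>x. f x - g x) \<in> smooth"
  using smooth.add[OF assms(1) smooth_minus[OF assms(2)]] by simp

lemma smooth_inner_diff: "(\<lambda>x. (x - c) \<bullet> v) \<in> smooth"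
  unfolding inner_diff_left by (intro smooth_diff smooth.const smooth.inner)

lemma smooth_square_dist: "(\<lambda>x. (x - c) \<bullet> (x - c)) \<in> smooth"
  by (subst euclidean_inner) (intro smooth_sum smooth.mult smooth_inner_diff finite_Basis)

lemma smooth_test_function:
  assumes "f \<in> smooth" "compact B" "B \<subseteq> U" "\<And>x. f x \<noteq> 0 \<Longrightarrow> x \<in> B"
  shows "f \<in> test_functions U"
proof -
  have "closure {x. f x \<noteq> 0} \<subseteq> B"
    using assms by (intro closure_minimal compact_imp_closed) auto
  moreover from this have "compact (closure {x. f x \<noteq> 0})"
    using compact_Int_closed[OF assms(2) closed_closure, of "{x. f x \<noteq> 0}"] by (simp add: Int_absorb1)
  ultimately show ?thesis
    using assms smooth_imp_C_k by (auto simp: test_functions_def)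
qed

context gradient_flow
begin

text \<open>This replaces the representation of the flow as a push-forward. Finitely many bumps, carried by
  trajectories and widening at the rate \<open>exp (L * s)\<close> so that the Lipschitz error has a favourable sign,
  are combined into \<open>1 - exp (- sum)\<close>; the bound \<open>1\<close> on the latter is independent of their overlap.\<close>

lemma transport_lower_bound:
  fixes X :: "'n param \<Rightarrow> real \<Rightarrow> 'n param"
  assumes T: "0 \<le> T" and K: "compact K" "K \<subseteq> Theta" and r: "0 < r"
    and X0: "\<And>\<theta>. \<theta> \<in> K \<Longrightarrow> X \<theta> 0 = \<theta>"
    and X': "\<And>\<theta> s. \<theta> \<in> K \<Longrightarrow> s \<in> {0..T} \<Longrightarrow> (X \<theta> has_vector_derivative - V s (X \<theta> s)) (at s within {0..T})"
    and tube: "\<And>\<theta> s. \<theta> \<in> K \<Longrightarrow> s \<in> {0..T} \<Longrightarrow> cball (X \<theta> s) r \<subseteq> Theta"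
    and U: "U \<in> sets borel" "\<And>\<theta>. \<theta> \<in> K \<Longrightarrow> ball (X \<theta> T) r \<subseteq> U"
  shows "measure (\<pi> 0) K / 2 \<le> measure (\<pi> T) (U \<inter> Theta)"
proof -
  \<comment> \<open>The initial radius, chosen so that a bump widening at the rate exp(L s) reaches
    radius r only at time T.\<close>
  define \<rho> where "\<rho> = r * exp (- (L * T))"
  have \<rho>: "\<rho> > 0" using r by (simp add: \<rho>_def)
  obtain I where I: "I \<subseteq> K" "finite I" "K \<subseteq> (\<Union>i\<in>I. ball i (\<rho> / 2))"
  proof (rule compactE_image[OF K(1), of K "\<lambda>x. ball x (\<rho> / 2)"])
    show "K \<subseteq> (\<Union>i\<in>K. ball i (\<rho> / 2))" using \<rho> by force
  qed auto
  \<comment> \<open>With this factor \<kappa> i s is positive exactly in the ball of radius \<rho>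
    exp(L s) around X i s.\<close>
  define E where "E s = exp (- (2 * L * s))" for s
  define d where "d i s \<theta> = (\<theta> - X i s) \<bullet> (\<theta> - X i s)" for i s \<theta>
  define \<kappa> where "\<kappa> i s \<theta> = \<rho>\<^sup>2 - E s * d i s \<theta>" for i s \<theta>
  define \<kappa>' where "\<kappa>' i s \<theta> = 2 * E s * (L * d i s \<theta> - (\<theta> - X i s) \<bullet> V s (X i s))" for i s \<theta>
  \<comment> \<open>The initial height of a bump at half its radius, since the square of \<rho>
    loses a quarter there. The half-radius balls cover K, so dividing by \<eta> makes the sum at
    least 1 on K.\<close>
  define \<eta> where "\<eta> = flat 1 (3/4 * \<rho>\<^sup>2)"
  have \<eta>: "\<eta> > 0" using \<rho> by (simp add: \<eta>_def flat_def)
  define S where "S s \<theta> = (\<Sum>i\<in>I. flat 1 (\<kappa> i s \<theta>))" for s \<theta>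
  define \<Psi> where "\<Psi> s \<theta> = 1 - exp (- (1 / \<eta> * S s \<theta>))" for s \<theta>
  define D where "D s \<theta> = exp (- (1 / \<eta> * S s \<theta>)) * (1 / \<eta> * (\<Sum>i\<in>I. flat [:0, 0, 1:] (\<kappa> i s \<theta>) * \<kappa>' i s \<theta>))" for s \<theta>
  have S_nonneg: "0 \<le> S s \<theta>" for s \<theta> unfolding S_def by (intro sum_nonneg flat_one_nonneg)
  have Epos: "0 < E s" for s by (simp add: E_def)
  have support: "dist (X i s) \<theta> < r" if "\<kappa> i s \<theta> > 0" "s \<in> {0..T}" for i s \<theta>
  proof -
    have "E s * d i s \<theta> < \<rho>\<^sup>2" using that(1) by (simp add: \<kappa>_def)
    also have "\<rho>\<^sup>2 = r\<^sup>2 * E T"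
      by (simp add: \<rho>_def E_def power_mult_distrib exp_double[symmetric])
    also have "\<dots> \<le> r\<^sup>2 * E s"
      using that(2) L_pos by (intro mult_left_mono) (auto simp: E_def)
    finally have "d i s \<theta> < r\<^sup>2" using Epos[of s] by (simp add: mult.commute)
    then have "(norm (\<theta> - X i s))\<^sup>2 < r\<^sup>2" by (simp add: d_def power2_norm_eq_inner)
    then show ?thesis using r by (simp add: dist_norm norm_minus_commute power2_less_imp_less)
  qed
  define B where "B s = (\<Union>i\<in>I. cball (X i s) r)" for s
  have B: "compact (B s)" "s \<in> {0..T} \<Longrightarrow> B s \<subseteq> Theta" for s
  proof -
    show "compact (B s)" unfolding B_def by (intro compact_UN I compact_cball)
    show "B s \<subseteq> Theta" if "s \<in> {0..T}"
      unfolding B_def by (intro UN_least tube that) (use I(1) in blast)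
  qed
  have inB: "\<theta> \<in> B s" if s: "s \<in> {0..T}" and ex: "\<exists>i\<in>I. \<kappa> i s \<theta> > 0" for s \<theta>
  proof -
    obtain i where i: "i \<in> I" "\<kappa> i s \<theta> > 0" using ex by blast
    then have "\<theta> \<in> cball (X i s) r" using support[OF i(2) s] by simp
    then show ?thesis unfolding B_def using i(1) by blast
  qed
  have S0: "S s \<theta> = 0" and D0: "D s \<theta> = 0" if "\<not> (\<exists>i\<in>I. \<kappa> i s \<theta> > 0)" for s \<theta>
  proof -
    have "flat p (\<kappa> i s \<theta>) = 0" if "i \<in> I" for i p using that \<open>\<not> (\<exists>i\<in>I. \<kappa> i s \<theta> > 0)\<close> by (auto intro!: flat_nonpos simp: not_less)
    then show "S s \<theta> = 0" "D s \<theta> = 0" by (simp_all add: S_def D_def)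
  qed
  have \<kappa>_smooth: "\<kappa> i s \<in> smooth" and \<kappa>'_smooth: "\<kappa>' i s \<in> smooth" for i s
    unfolding \<kappa>_def[abs_def] \<kappa>'_def[abs_def] d_def
    by (intro smooth_diff smooth.mult smooth.const smooth_square_dist smooth_inner_diff)+
  have S_smooth: "S s \<in> smooth" for s
    unfolding S_def[abs_def] by (intro smooth_sum I smooth.flat \<kappa>_smooth)
  have \<Psi>_test: "\<Psi> s \<in> test_functions Theta" if s: "s \<in> {0..T}" for s
  proof (rule smooth_test_function[OF _ B(1) B(2)[OF s]])
    show "\<Psi> s \<in> smooth" unfolding \<Psi>_def[abs_def]
      by (intro smooth_diff smooth_minus smooth.exp smooth.mult smooth.const S_smooth)
    show "\<theta> \<in> B s" if "\<Psi> s \<theta> \<noteq> 0" for \<theta>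
      using that S0[of s \<theta>] inB[OF s, of \<theta>] by (auto simp: \<Psi>_def)
  qed
  have D_test: "D s \<in> test_functions Theta" if s: "s \<in> {0..T}" for s
  proof (rule smooth_test_function[OF _ B(1) B(2)[OF s]])
    show "D s \<in> smooth" unfolding D_def[abs_def]
      by (intro smooth_minus smooth.exp smooth.mult smooth.const S_smooth smooth_sum I smooth.flat \<kappa>_smooth \<kappa>'_smooth)
    show "\<theta> \<in> B s" if "D s \<theta> \<noteq> 0" for \<theta>
      using that D0[of s \<theta>] inB[OF s, of \<theta>] by auto
  qed
  have X_cont: "continuous_on {0..T} (X i)" if "i \<in> I" for i
    by (rule continuous_on_vector_derivative[where f' = "\<lambda>s. - V s (X i s)"]) (use X' that I(1) in blast)
  have X_Theta: "X i s \<in> Theta" if "i \<in> I" "s \<in> {0..T}" for i s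
  proof -
    have "X i s \<in> cball (X i s) r" using r by simp
    then show ?thesis using tube[of i s] that I(1) by blast
  qed
  then have X_Theta_bar: "X i s \<in> Theta_bar" if "i \<in> I" "s \<in> {0..T}" for i s
    using that closure_subset by blast
  have \<kappa>_deriv: "((\<lambda>s. \<kappa> i s \<theta>) has_real_derivative \<kappa>' i s \<theta>) (at s within {0..T})" if "i \<in> I" "s \<in> {0..T}" for i s \<theta>
  proof -
    have "((\<lambda>s. \<theta> - X i s) has_vector_derivative (0 - - V s (X i s))) (at s within {0..T})"
      using that I(1) by (intro has_vector_derivative_diff has_vector_derivative_const X') auto
    from inner_has_real_derivative[OF this this]
    have "((\<lambda>s. d i s \<theta>) has_real_derivative 2 * ((\<theta> - X i s) \<bullet> V s (X i s))) (at s within {0..T})"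
      by (simp add: d_def inner_commute)
    moreover have "(E has_real_derivative - 2 * L * E s) (at s within {0..T})"
      unfolding E_def by (auto intro!: derivative_eq_intros)
    ultimately show ?thesis
      unfolding \<kappa>_def by (auto intro!: derivative_eq_intros simp: \<kappa>'_def algebra_simps)
  qed
  obtain R where R: "\<And>i s. i \<in> I \<Longrightarrow> s \<in> {0..T} \<Longrightarrow> norm (X i s) \<le> R"
  proof -
    have "bounded (\<Union>i\<in>I. X i ` {0..T})"
      using I(2) X_cont by (intro bounded_UN) (auto intro!: compact_imp_bounded compact_continuous_image)
    then obtain R where "\<forall>y\<in>(\<Union>i\<in>I. X i ` {0..T}). norm y \<le> R" unfolding bounded_iff by (elim exE)
    then show thesis using that[of R] by blast
  qed
  have "(LINT \<theta>:Theta|\<pi> 0. \<Psi> 0 \<theta>) \<le> (LINT \<theta>:Theta|\<pi> T. \<Psi> T \<theta>)"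
  proof (rule moving_test_function_mono[OF T \<Psi>_test D_test, where R = "R + r"])
    fix s \<theta> assume s: "s \<in> {0..T}"
    have "((\<lambda>s. S s \<theta>) has_real_derivative (\<Sum>i\<in>I. flat [:0, 0, 1:] (\<kappa> i s \<theta>) * \<kappa>' i s \<theta>)) (at s within {0..T})"
      unfolding S_def by (intro DERIV_sum DERIV_chain2[OF flat_one_has_derivative] \<kappa>_deriv s)
    then show "((\<lambda>s. \<Psi> s \<theta>) has_real_derivative D s \<theta>) (at s within {0..T})"
      unfolding \<Psi>_def using \<eta> by (auto intro!: derivative_eq_intros simp: D_def)
    show "D s \<theta> = 0" if "R + r < norm \<theta>"
    proof (rule D0, safe)
      fix i assume i: "i \<in> I" "\<kappa> i s \<theta> > 0"
      have "norm \<theta> \<le> norm (X i s) + dist (X i s) \<theta>"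
        by (metis dist_commute dist_norm norm_triangle_sub)
      then show False using support[OF i(2) s] R[OF i(1) s] that by simp
    qed
    assume \<theta>: "\<theta> \<in> Theta"
    have \<kappa>_der: "(\<kappa> i s has_derivative (\<lambda>v. - (2 * E s * ((\<theta> - X i s) \<bullet> v)))) (at \<theta>)" for i
      unfolding \<kappa>_def[abs_def] d_def
      by (auto intro!: derivative_eq_intros simp: inner_commute algebra_simps)
    have "(S s has_derivative (\<lambda>v. \<Sum>i\<in>I. - (2 * E s * ((\<theta> - X i s) \<bullet> v)) * flat [:0, 0, 1:] (\<kappa> i s \<theta>))) (at \<theta>)"
      unfolding S_def[abs_def]
      by (intro has_derivative_sum DERIV_compose_FDERIV[OF flat_one_has_derivative \<kappa>_der])
    then have "((\<lambda>\<theta>. - (1 / \<eta> * S s \<theta>)) has_derivative (\<lambda>v. - (1 / \<eta> * (\<Sum>i\<in>I. - (2 * E s * ((\<theta> - X i s) \<bullet> v)) * flat [:0, 0, 1:] (\<kappa> i s \<theta>))))) (at \<theta>)"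
      by (intro has_derivative_minus has_derivative_mult_right)
    from DERIV_compose_FDERIV[OF DERIV_exp this]
    have "(\<Psi> s has_derivative (\<lambda>v. 0 - - (1 / \<eta> * (\<Sum>i\<in>I. - (2 * E s * ((\<theta> - X i s) \<bullet> v)) * flat [:0, 0, 1:] (\<kappa> i s \<theta>))) * exp (- (1 / \<eta> * S s \<theta>)))) (at \<theta>)"
      unfolding \<Psi>_def[abs_def] by (intro has_derivative_diff has_derivative_const)
    from grad_inner[OF this, of "V s \<theta>"]
    have "grad (\<Psi> s) \<theta> \<bullet> V s \<theta> = exp (- (1 / \<eta> * S s \<theta>)) * (1 / \<eta> * (\<Sum>i\<in>I. flat [:0, 0, 1:] (\<kappa> i s \<theta>) * - (2 * E s * ((\<theta> - X i s) \<bullet> V s \<theta>))))"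
      by (simp add: mult.commute[of _ "flat _ _"] mult.commute[of _ "exp _"])
    also have "\<dots> \<le> D s \<theta>"
      unfolding D_def
    proof (intro mult_left_mono sum_mono flat_derivative_nonneg)
      fix i assume i: "i \<in> I"
      \<comment> \<open>Replacing the velocity at the centre by the one at \<theta> costs at most L
        times the squared distance, which is exactly the gain from the decay of E in
        \<kappa>'.\<close>
      have "(\<theta> - X i s) \<bullet> V s (X i s) - (\<theta> - X i s) \<bullet> V s \<theta> = (\<theta> - X i s) \<bullet> (V s (X i s) - V s \<theta>)"
        by (simp add: inner_diff_right)
      also have "\<dots> \<le> norm (\<theta> - X i s) * norm (V s (X i s) - V s \<theta>)" by (rule norm_cauchy_schwarz)
      also have "\<dots> \<le> norm (\<theta> - X i s) * (L * norm (X i s - \<theta>))"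
        using s \<theta> closure_subset by (intro mult_left_mono V_lipschitz X_Theta_bar i) auto
      also have "\<dots> = L * d i s \<theta>"
        by (simp add: d_def power2_norm_eq_inner[symmetric] power2_eq_square norm_minus_commute)
      finally have "2 * E s * - ((\<theta> - X i s) \<bullet> V s \<theta>) \<le> 2 * E s * (L * d i s \<theta> - (\<theta> - X i s) \<bullet> V s (X i s))"
        using Epos[of s] by (intro mult_left_mono) auto
      then show "- (2 * E s * ((\<theta> - X i s) \<bullet> V s \<theta>)) \<le> \<kappa>' i s \<theta>" by (simp add: \<kappa>'_def)
    qed (use \<eta> in auto)
    finally show "grad (\<Psi> s) \<theta> \<bullet> V s \<theta> \<le> D s \<theta>" .
  next
    let ?Z = "{0..T} \<times> (UNIV :: 'n param set)"
    have E: "continuous_on ?Z (\<lambda>z. E (fst z))" unfolding E_def by (intro continuous_intros)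
    have X: "continuous_on ?Z (\<lambda>z. X i (fst z))" if "i \<in> I" for i
      by (rule continuous_on_compose2[OF X_cont[OF that]]) (auto intro: continuous_intros)
    have VX: "continuous_on ?Z (\<lambda>z. V (fst z) (X i (fst z)))" if i: "i \<in> I" for i
    proof -
      have "continuous_on {0..T} (\<lambda>s. V s (X i s))"
      proof (rule lipschitz_composition_continuous[where D = Theta_bar and L = L and F = V])
        show "continuous_on {0..T} (\<lambda>s. V s x)" for x using V_continuous by (rule continuous_on_subset) auto
        show "X i ` {0..T} \<subseteq> Theta_bar" using X_Theta_bar[OF i] by blast
        show "norm (V s x - V s y) \<le> L * norm (x - y)" if "s \<in> {0..T}" "x \<in> Theta_bar" "y \<in> Theta_bar" for s x y
          using that by (intro V_lipschitz) auto
      qed (rule X_cont[OF i])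
      then show ?thesis by (rule continuous_on_compose2) (auto intro: continuous_intros)
    qed
    have d: "continuous_on ?Z (\<lambda>z. d i (fst z) (snd z))" if "i \<in> I" for i
      unfolding d_def by (intro continuous_intros X that)
    have \<kappa>: "continuous_on ?Z (\<lambda>z. \<kappa> i (fst z) (snd z))" if "i \<in> I" for i
      unfolding \<kappa>_def by (intro continuous_intros E d that)
    have \<kappa>': "continuous_on ?Z (\<lambda>z. \<kappa>' i (fst z) (snd z))" if "i \<in> I" for i
      unfolding \<kappa>'_def by (intro continuous_intros E d X VX that)
    have fl: "continuous_on ?Z (\<lambda>z. flat p (\<kappa> i (fst z) (snd z)))" if "i \<in> I" for i p
      by (rule continuous_on_compose2[OF continuous_flat[of UNIV] \<kappa>[OF that]]) auto
    show "continuous_on ?Z (\<lambda>z. D (fst z) (snd z))"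
      unfolding D_def S_def by (intro continuous_intros fl \<kappa>')
  qed
  moreover have "measure (\<pi> 0) K / 2 \<le> (LINT \<theta>:Theta|\<pi> 0. \<Psi> 0 \<theta>)"
  proof -
    interpret \<pi>0: prob_space "\<pi> 0" by (rule P2D(1)[OF \<pi>_P2[OF order_refl]])
    have Ks: "K \<in> sets (\<pi> 0)"
      by (rule P2_borel_sets[OF \<pi>_P2[OF order_refl] borel_compact[OF K(1)] order_trans[OF K(2) closure_subset]])
    have "measure (\<pi> 0) K / 2 = (LINT \<theta>|\<pi> 0. 1/2 * indicator K \<theta>)" using Ks by simp
    also have "\<dots> \<le> (LINT \<theta>|\<pi> 0. indicator Theta \<theta> *\<^sub>R \<Psi> 0 \<theta>)"
    proof (rule integral_mono)
      show "integrable (\<pi> 0) (\<lambda>\<theta>. 1/2 * indicator K \<theta> :: real)" using Ks by (simp add: \<pi>0.emeasure_eq_measure)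
      show "integrable (\<pi> 0) (\<lambda>\<theta>. indicator Theta \<theta> *\<^sub>R \<Psi> 0 \<theta>)"
        using P2_set_integrable_test[OF \<pi>_P2 \<Psi>_test] T by (simp add: set_integrable_def)
      fix \<theta>
      show "1/2 * indicator K \<theta> \<le> indicator Theta \<theta> *\<^sub>R \<Psi> 0 \<theta>"
      proof (cases "\<theta> \<in> K")
        case True
        then obtain i where i: "i \<in> I" "dist i \<theta> < \<rho> / 2" using I(3) by auto
        have "d i 0 \<theta> = (dist i \<theta>)\<^sup>2"
          using X0[of i] i(1) I(1) by (auto simp: d_def power2_norm_eq_inner[symmetric] dist_norm norm_minus_commute)
        also have "\<dots> \<le> (\<rho> / 2)\<^sup>2" using i(2) by (intro power_mono) auto
        finally have "3/4 * \<rho>\<^sup>2 \<le> \<kappa> i 0 \<theta>" by (simp add: \<kappa>_def E_def power_divide)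
        then have "\<eta> \<le> flat 1 (\<kappa> i 0 \<theta>)" unfolding \<eta>_def by (rule flat_one_mono)
        also have "\<dots> \<le> S 0 \<theta>" unfolding S_def using i(1) I(2) flat_one_nonneg by (intro member_le_sum) auto
        finally have "1 \<le> 1 / \<eta> * S 0 \<theta>" using \<eta> by simp
        then have "exp (- (1 / \<eta> * S 0 \<theta>)) \<le> exp (- 1)" by simp
        \<comment> \<open>The estimate 1 - exp(-1) \<ge> 1/2 is the origin of the factor 1/2 in the
          claim.\<close>
        also have "\<dots> \<le> 1 / (2::real)" using exp_ge_add_one_self[of 1] by (simp add: exp_minus field_simps)
        finally show ?thesis using True K(2) by (auto simp: \<Psi>_def)
      next
        case False
        then show ?thesis using S_nonneg[of 0 \<theta>] \<eta> by (simp add: \<Psi>_def)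
      qed
    qed
    finally show ?thesis by (simp add: set_lebesgue_integral_def)
  qed
  moreover have "(LINT \<theta>:Theta|\<pi> T. \<Psi> T \<theta>) \<le> measure (\<pi> T) (U \<inter> Theta)"
  proof -
    interpret \<pi>T: prob_space "\<pi> T" by (rule P2D(1)[OF \<pi>_P2[OF T]])
    have Us: "U \<inter> Theta \<in> sets (\<pi> T)"
      using U(1) borel_open[OF open_Theta]
      by (intro P2_borel_sets[OF \<pi>_P2[OF T]] sets.Int order_trans[OF Int_lower2 closure_subset])
    have "(LINT \<theta>|\<pi> T. indicator Theta \<theta> *\<^sub>R \<Psi> T \<theta>) \<le> (LINT \<theta>|\<pi> T. indicator (U \<inter> Theta) \<theta>)"
    proof (rule integral_mono)
      show "integrable (\<pi> T) (\<lambda>\<theta>. indicator (U \<inter> Theta) \<theta> :: real)" using Us by (simp add: \<pi>T.emeasure_eq_measure)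
      show "integrable (\<pi> T) (\<lambda>\<theta>. indicator Theta \<theta> *\<^sub>R \<Psi> T \<theta>)"
        using P2_set_integrable_test[OF \<pi>_P2 \<Psi>_test] T by (simp add: set_integrable_def)
      fix \<theta>
      have TT: "T \<in> {0..T}" using T by simp
      have "\<theta> \<in> U" if ex: "\<exists>i\<in>I. \<kappa> i T \<theta> > 0"
      proof -
        obtain i where i: "i \<in> I" "\<kappa> i T \<theta> > 0" using ex by blast
        then have "\<theta> \<in> ball (X i T) r" using support[OF i(2) TT] by simp
        then show ?thesis using U(2) i(1) I(1) by blast
      qed
      then show "indicator Theta \<theta> *\<^sub>R \<Psi> T \<theta> \<le> indicator (U \<inter> Theta) \<theta>"
        using S0[of T \<theta>] by (cases "\<exists>i\<in>I. \<kappa> i T \<theta> > 0") (auto simp: \<Psi>_def indicator_def)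
    qed
    then show ?thesis using Us by (simp add: set_lebesgue_integral_def)
  qed
  ultimately show ?thesis by linarith
qed

end

section \<open>Escape of the second moment\<close>

context gradient_flow
begin

lemma V_conservation: "0 \<le> t \<Longrightarrow> fst \<theta> * fst (V t \<theta>) = snd \<theta> \<bullet> snd (V t \<theta>)"
  by (rule bounded_weight.field_conservation[OF bw])

lemma V_scaleR: "0 \<le> t \<Longrightarrow> r > 0 \<Longrightarrow> V t (r *\<^sub>R \<theta>) = r *\<^sub>R V t \<theta>"
  by (rule bounded_weight.field_scaleR[OF bw])

lemma V_0: "0 \<le> t \<Longrightarrow> V t 0 = 0"
  by (rule bounded_weight.field_0[OF bw])

lemma G_eq: "0 \<le> t \<Longrightarrow> G t \<theta> = \<theta> \<bullet> V t \<theta> / 2"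
  using bounded_weight.inner_field_self[OF bw, of t \<theta>] by simp

lemma forward_trajectory:
  assumes "0 \<le> T" "\<theta> \<in> Theta"
  obtains c where "c 0 = \<theta>"
    "\<And>s. s \<in> {0..T} \<Longrightarrow> (c has_vector_derivative - V s (c s)) (at s within {0..T})"
    "\<And>s. s \<in> {0..T} \<Longrightarrow> cone_form (c s) = cone_form \<theta>"
proof (rule trajectory_in_Theta[OF assms(1) L_pos _ _ _ assms(2), of "\<lambda>s \<theta>. - V s \<theta>"])
  show "continuous_on {0..T} (\<lambda>s. - V s \<eta>)" for \<eta>
    by (intro continuous_on_minus continuous_on_subset[OF V_continuous]) auto
  show "norm (- V s \<eta> - - V s \<zeta>) \<le> L * norm (\<eta> - \<zeta>)" if "s \<in> {0..T}" "\<eta> \<in> Theta_bar" "\<zeta> \<in> Theta_bar" for s \<eta> \<zeta>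
    using V_lipschitz[of s \<eta> \<zeta>] that norm_minus_cancel[of "V s \<eta> - V s \<zeta>"] by simp
  show "fst \<eta> * fst (- V s \<eta>) = snd \<eta> \<bullet> snd (- V s \<eta>)" if "s \<in> {0..T}" for s \<eta>
    using V_conservation[of s \<eta>] that by simp
  fix c
  assume "c 0 = \<theta>" "\<And>s. s \<in> {0..T} \<Longrightarrow> (c has_vector_derivative - V s (c s)) (at s within {0..T})"
    "\<And>s. s \<in> {0..T} \<Longrightarrow> cone_form (c s) = cone_form \<theta>"
  then show thesis by (rule that)
qed

text \<open>Time reversal: y(s) = c(T - s) solves the equation with the opposite sign, for which the
  Lipschitz bound and the conservation law hold just as well.\<close>

lemma backward_trajectory:
  assumes "0 \<le> T" "\<theta> \<in> Theta"
  obtains c where "c T = \<theta>"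
    "\<And>s. s \<in> {0..T} \<Longrightarrow> (c has_vector_derivative - V s (c s)) (at s within {0..T})"
    "\<And>s. s \<in> {0..T} \<Longrightarrow> cone_form (c s) = cone_form \<theta>"
proof -
  obtain y where y: "y 0 = \<theta>"
    "\<And>s. s \<in> {0..T} \<Longrightarrow> (y has_vector_derivative V (T - s) (y s)) (at s within {0..T})"
    "\<And>s. s \<in> {0..T} \<Longrightarrow> cone_form (y s) = cone_form \<theta>"
  proof (rule trajectory_in_Theta[OF assms(1) L_pos _ _ _ assms(2), of "\<lambda>s \<theta>. V (T - s) \<theta>"])
    show "continuous_on {0..T} (\<lambda>s. V (T - s) \<eta>)" for \<eta>
      by (rule continuous_on_compose2[OF V_continuous]) (auto intro: continuous_intros)
    show "norm (V (T - s) \<eta> - V (T - s) \<zeta>) \<le> L * norm (\<eta> - \<zeta>)" if "s \<in> {0..T}" "\<eta> \<in> Theta_bar" "\<zeta> \<in> Theta_bar" for s \<eta> \<zeta>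
      using that by (intro V_lipschitz) auto
    show "fst \<eta> * fst (V (T - s) \<eta>) = snd \<eta> \<bullet> snd (V (T - s) \<eta>)" if "s \<in> {0..T}" for s \<eta>
      using that by (intro V_conservation) auto
    fix c
    assume "c 0 = \<theta>" "\<And>s. s \<in> {0..T} \<Longrightarrow> (c has_vector_derivative V (T - s) (c s)) (at s within {0..T})"
      "\<And>s. s \<in> {0..T} \<Longrightarrow> cone_form (c s) = cone_form \<theta>"
    then show thesis by (rule that)
  qed
  show thesis
  proof (rule that[of "\<lambda>s. y (T - s)"])
    fix s assume s: "s \<in> {0..T}"
    have "((\<lambda>s. T - s) has_vector_derivative - 1) (at s within {0..T})"
      by (auto intro!: derivative_eq_intros)
    moreover have "(\<lambda>s. T - s) ` {0..T} = {0..T}" by (auto simp: image_iff intro: bexI[of _ "T - _"])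
    then have "(y has_vector_derivative V (T - (T - s)) (y (T - s))) (at (T - s) within (\<lambda>s. T - s) ` {0..T})"
      using y(2)[of "T - s"] s by simp
    ultimately show "((\<lambda>s. y (T - s)) has_vector_derivative - V s (y (T - s))) (at s within {0..T})"
      using vector_diff_chain_within[of "\<lambda>s. T - s" "-1" s "{0..T}" y] by (simp add: comp_def)
  qed (use y(1,3) in auto)
qed

end

lemma cone_hull_open:
  fixes U :: "'a::euclidean_space set"
  assumes "open U"
  shows "open {r *\<^sub>R x |r x. r > 0 \<and> x \<in> U}"
proof -
  have "{r *\<^sub>R x |r x. r > 0 \<and> x \<in> U} = (\<Union>r\<in>{0<..}. (\<lambda>x. r *\<^sub>R x) ` U)" by auto
  also have "open \<dots>" using assms by (intro open_UN ballI open_scaling) auto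
  finally show ?thesis .
qed

text \<open>An open set is a countable union of closed boxes, and these cannot all be null.\<close>

lemma P2_compact_positive:
  fixes \<mu> :: "'n::finite param measure"
  assumes \<mu>: "\<mu> \<in> P2" and U: "open U" "U \<subseteq> Theta" and pos: "measure \<mu> U > 0"
  obtains A where "compact A" "A \<subseteq> U" "measure \<mu> A > 0"
proof -
  interpret prob_space \<mu> by (rule P2D(1)[OF \<mu>])
  obtain D where D: "countable D" "D \<subseteq> Pow U" "\<And>X. X \<in> D \<Longrightarrow> \<exists>a b. X = cbox a b" "\<Union>D = U"
    using open_countable_Union_open_cbox[OF U(1)] by metis
  have meas: "X \<in> sets \<mu>" if "X \<in> D" for X
  proof (rule P2_borel_sets[OF \<mu>])
    show "X \<in> sets borel" using D(3)[OF that] by auto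
    show "X \<subseteq> Theta_bar" using D(2) that U(2) closure_subset[of Theta] by blast
  qed
  have "\<exists>X\<in>D. measure \<mu> X > 0"
  proof (rule ccontr)
    assume "\<not> (\<exists>X\<in>D. measure \<mu> X > 0)"
    then have "X \<in> null_sets \<mu>" if "X \<in> D" for X
      using meas[OF that] that by (auto simp: null_sets_def emeasure_eq_measure not_less intro: antisym)
    then have "(\<Union>X\<in>D. X) \<in> null_sets \<mu>" by (intro null_sets_UN' D(1)) auto
    then have "\<Union>D \<in> null_sets \<mu>" by simp
    then show False using pos D(4) by (simp add: measure_eq_0_null_sets)
  qed
  then obtain X where X: "X \<in> D" "measure \<mu> X > 0" by blast
  then show thesis using that[of X] D(2) D(3)[OF X(1)] by auto
qed

lemma second_moment_lower:
  fixes \<mu> :: "'n::finite param measure"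
  assumes \<mu>: "\<mu> \<in> P2" and "0 \<le> R" and A: "A \<in> sets \<mu>" "\<And>\<theta>. \<theta> \<in> A \<Longrightarrow> R \<le> norm \<theta>"
  shows "R\<^sup>2 * measure \<mu> A \<le> second_moment \<mu>"
proof -
  interpret prob_space \<mu> by (rule P2D(1)[OF \<mu>])
  have "R\<^sup>2 * measure \<mu> A = (LINT \<theta>|\<mu>. R\<^sup>2 * indicator A \<theta>)" using A by simp
  also have "\<dots> \<le> second_moment \<mu>"
    unfolding second_moment_def
  proof (rule integral_mono[OF _ P2D(4)[OF \<mu>]])
    show "integrable \<mu> (\<lambda>\<theta>. R\<^sup>2 * indicator A \<theta>)" using A by (simp add: emeasure_eq_measure)
    show "R\<^sup>2 * indicator A \<theta> \<le> (norm \<theta>)\<^sup>2" for \<theta>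
      using A(2)[of \<theta>] \<open>0 \<le> R\<close> by (auto simp: indicator_def intro: power_mono)
  qed
  finally show ?thesis .
qed

context gradient_flow
begin

text \<open>The cone \<open>\<C>\<close> at time \<open>T\<close> is pulled back to an open cone at time \<open>0\<close>, the only time at which the
  support is known to be large.\<close>

lemma second_moment_escapes:
  assumes omni: "omni_directional (\<pi> 0)"
    and cone: "open \<C>" "\<C> \<subseteq> Theta" "\<And>\<theta> r. \<theta> \<in> \<C> \<Longrightarrow> r > 0 \<Longrightarrow> r *\<^sub>R \<theta> \<in> \<C>" "\<theta>1 \<in> \<C>"
    and T: "0 \<le> T" and k: "0 < k"
    and grow: "\<And>t c. T \<le> t \<Longrightarrow> c T \<in> \<C> \<Longrightarrow>
        (\<And>s. s \<in> {T..t} \<Longrightarrow> (c has_vector_derivative - V s (c s)) (at s within {T..t})) \<Longrightarrow>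
        (\<And>s. s \<in> {T..t} \<Longrightarrow> c s \<in> Theta) \<Longrightarrow> exp (k * (t - T)) * norm (c T) \<le> norm (c t)"
  shows "filterlim (\<lambda>t. second_moment (\<pi> t)) at_top at_top"
proof -
  obtain z where z: "z T = \<theta>1"
    "\<And>s. s \<in> {0..T} \<Longrightarrow> (z has_vector_derivative - V s (z s)) (at s within {0..T})"
    "\<And>s. s \<in> {0..T} \<Longrightarrow> cone_form (z s) = cone_form \<theta>1"
    using backward_trajectory[OF T] cone by blast
  have z_Theta: "z s \<in> Theta" if "s \<in> {0..T}" for s
    using z(3)[OF that] cone by (auto simp: Theta_iff_cone_form)
  obtain r0 where r0: "r0 > 0" "ball \<theta>1 r0 \<subseteq> \<C>"
    using cone(1,4) open_contains_ball by blast
  \<comment> \<open>Distances grow at most by exp(L T) up to time T, so trajectories starting in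
    this ball arrive in the ball of radius r0 around \<theta>1.\<close>
  define U where "U = ball (z 0) (exp (- L * T) * r0) \<inter> Theta"
  \<comment> \<open>Fields homogeneous of degree one map rescaled trajectories to trajectories, so
    every start in this cone still arrives in \<C>. A cone is what omni-directionality can be
    applied to.\<close>
  define \<U> where "\<U> = {r *\<^sub>R x |r x. r > 0 \<and> x \<in> U}"
  have "open U" unfolding U_def using open_Theta by auto
  then have "open \<U>" unfolding \<U>_def by (rule cone_hull_open)
  moreover have "z 0 \<in> \<U>"
  proof -
    have "z 0 \<in> U" "z 0 = 1 *\<^sub>R z 0" using z_Theta[of 0] T r0(1) by (simp_all add: U_def)
    then show ?thesis unfolding \<U>_def using zero_less_one by blast
  qed
  moreover have \<U>_Theta: "\<U> \<subseteq> Theta"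
  proof
    fix \<theta> assume "\<theta> \<in> \<U>"
    then obtain r x where "r > 0" "x \<in> U" "\<theta> = r *\<^sub>R x" by (auto simp: \<U>_def)
    then show "\<theta> \<in> Theta" using Theta_scaleR_iff[of r x] by (simp add: U_def)
  qed
  moreover have "\<forall>\<theta>\<in>\<U>. \<forall>r>0. r *\<^sub>R \<theta> \<in> \<U>"
  proof safe
    fix \<theta> and r :: real assume "\<theta> \<in> \<U>" "r > 0"
    then obtain r' x where "r' > 0" "x \<in> U" "\<theta> = r' *\<^sub>R x" by (auto simp: \<U>_def)
    then have "r *\<^sub>R \<theta> = (r * r') *\<^sub>R x" "r * r' > 0" using \<open>r > 0\<close> by simp_all
    then show "r *\<^sub>R \<theta> \<in> \<U>" using \<open>x \<in> U\<close> unfolding \<U>_def by blast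
  qed
  ultimately have "measure (\<pi> 0) \<U> > 0"
    using omni unfolding omni_directional_def by blast
  then obtain A where A: "compact A" "A \<subseteq> \<U>" "measure (\<pi> 0) A > 0"
    using P2_compact_positive[OF \<pi>_P2 \<open>open \<U>\<close> \<U>_Theta] by auto
  have A_Theta: "A \<subseteq> Theta" using A(2) \<U>_Theta by simp
  have "A \<noteq> {}" using A(3) by auto
  obtain m where m: "m \<in> A" "\<And>\<theta>. \<theta> \<in> A \<Longrightarrow> norm m \<le> norm \<theta>"
    using continuous_attains_inf[OF A(1) \<open>A \<noteq> {}\<close> continuous_on_norm[OF continuous_on_id]] by blast
  have "norm m > 0" using m(1) A_Theta zero_notin_Theta by auto
  \<comment> \<open>The largest value of the conserved form on A; it keeps all trajectories from A
    inside one closed subset of \<open>Theta\<close>, for all times.\<close>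
  obtain q1 where q1: "q1 \<in> A" "\<And>\<theta>. \<theta> \<in> A \<Longrightarrow> cone_form \<theta> \<le> cone_form q1"
    using continuous_attains_sup[OF A(1) \<open>A \<noteq> {}\<close> continuous_cone_form] by blast
  have "cone_form q1 < 0" using q1(1) A_Theta by (auto simp: Theta_iff_cone_form)
  obtain R where R: "\<And>\<theta>. \<theta> \<in> A \<Longrightarrow> norm \<theta> \<le> R"
    using compact_imp_bounded[OF A(1)] unfolding bounded_iff by auto
  define a where "a = exp (- L * T) * norm m"
  have "a > 0" using \<open>norm m > 0\<close> by (simp add: a_def)
  have main: "(exp (k * (t - T)) * a - 1)\<^sup>2 * (measure (\<pi> 0) A / 2) \<le> second_moment (\<pi> t)"
    if t: "T \<le> t" "1 \<le> exp (k * (t - T)) * a" for t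
  proof -
    have t0: "0 \<le> t" using t T by simp
    have "\<forall>\<theta>\<in>A. \<exists>c. c 0 = \<theta> \<and> (\<forall>s\<in>{0..t}. (c has_vector_derivative - V s (c s)) (at s within {0..t}))
        \<and> (\<forall>s\<in>{0..t}. cone_form (c s) = cone_form \<theta>)"
    proof
      fix \<theta> assume "\<theta> \<in> A"
      then have "\<theta> \<in> Theta" using A_Theta by blast
      then show "\<exists>c. c 0 = \<theta> \<and> (\<forall>s\<in>{0..t}. (c has_vector_derivative - V s (c s)) (at s within {0..t}))
        \<and> (\<forall>s\<in>{0..t}. cone_form (c s) = cone_form \<theta>)"
      proof (rule forward_trajectory[OF t0])
        fix c assume "c 0 = \<theta>" "\<And>s. s \<in> {0..t} \<Longrightarrow> (c has_vector_derivative - V s (c s)) (at s within {0..t})"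
          "\<And>s. s \<in> {0..t} \<Longrightarrow> cone_form (c s) = cone_form \<theta>"
        then show ?thesis by (intro exI[of _ c] conjI ballI)
      qed
    qed
    from bchoice[OF this] obtain X where "\<forall>\<theta>\<in>A. X \<theta> 0 = \<theta> \<and>
        (\<forall>s\<in>{0..t}. (X \<theta> has_vector_derivative - V s (X \<theta> s)) (at s within {0..t}))
        \<and> (\<forall>s\<in>{0..t}. cone_form (X \<theta> s) = cone_form \<theta>)" by (elim exE)
    then have X: "\<And>\<theta>. \<theta> \<in> A \<Longrightarrow> X \<theta> 0 = \<theta>"
      "\<And>\<theta> s. \<theta> \<in> A \<Longrightarrow> s \<in> {0..t} \<Longrightarrow> (X \<theta> has_vector_derivative - V s (X \<theta> s)) (at s within {0..t})"
      "\<And>\<theta> s. \<theta> \<in> A \<Longrightarrow> s \<in> {0..t} \<Longrightarrow> cone_form (X \<theta> s) = cone_form \<theta>" by blast+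
    have X_Theta: "X \<theta> s \<in> Theta" if "\<theta> \<in> A" "s \<in> {0..t}" for \<theta> s
      using X(3)[OF that] that A_Theta by (auto simp: Theta_iff_cone_form)
    have sub: "(X \<theta> has_vector_derivative - V s (X \<theta> s)) (at s within {u..v})"
      if "\<theta> \<in> A" "s \<in> {u..v}" "0 \<le> u" "v \<le> t" for \<theta> s u v
      by (rule has_vector_derivative_within_subset[OF X(2)]) (use that in auto)
    \<comment> \<open>The zero curve solves the equation, and comparison with it bounds norms from
      both sides.\<close>
    have lip0: "norm (- V s x - - V s 0) \<le> L * norm (x - 0)" if "0 \<le> s" for s x
      using V_norm[OF that, of x] V_0[OF that] by simp
    have size: "norm (X \<theta> s) \<le> exp (L * s) * norm \<theta>" "exp (- L * s) * norm \<theta> \<le> norm (X \<theta> s)"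
      if "\<theta> \<in> A" "s \<in> {0..t}" for \<theta> s
      using solutions_distance[of 0 s "X \<theta>" "\<lambda>s \<theta>. - V s \<theta>" "\<lambda>_. 0" L] sub[OF that(1), of _ 0 s] lip0 V_0 that
      by (auto simp: X(1)[OF that(1)])
    \<comment> \<open>One compact subset of \<open>Theta\<close> containing all trajectories up to
      time t; its distance from the complement gives a tube radius common to all of them.\<close>
    define Z where "Z = {\<theta> :: 'n param. cone_form \<theta> \<le> cone_form q1} \<inter> cball 0 (exp (L * t) * R)"
    have "compact Z" unfolding Z_def
      by (intro closed_Int_compact compact_cball closed_Collect_le continuous_cone_form continuous_intros)
    moreover have "Z \<subseteq> Theta" using \<open>cone_form q1 < 0\<close> by (auto simp: Z_def Theta_iff_cone_form)
    ultimately obtain e where e: "e > 0" "(\<Union>x\<in>Z. cball x e) \<subseteq> Theta"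
      using compact_subset_open_imp_cball_epsilon_subset open_Theta by metis
    have inZ: "X \<theta> s \<in> Z" if "\<theta> \<in> A" "s \<in> {0..t}" for \<theta> s
    proof -
      have "norm (X \<theta> s) \<le> exp (L * s) * norm \<theta>" by (rule size(1)[OF that])
      also have "\<dots> \<le> exp (L * t) * R" using that L_pos R[OF that(1)] by (intro mult_mono) auto
      finally show ?thesis using X(3)[OF that] q1(2)[OF that(1)] by (simp add: Z_def)
    qed
    define b where "b = exp (k * (t - T)) * a"
    have far: "b \<le> norm (X \<theta> t)" if \<theta>: "\<theta> \<in> A" for \<theta>
    proof -
      obtain r x where rx: "r > 0" "x \<in> U" "\<theta> = r *\<^sub>R x" using A(2) \<theta> by (auto simp: \<U>_def)
      have "norm (X \<theta> T - r *\<^sub>R z T) \<le> exp (L * (T - 0)) * norm (X \<theta> 0 - r *\<^sub>R z 0)"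
      proof (rule solutions_distance(1)[OF T, where F = "\<lambda>s \<theta>. - V s \<theta>"])
        fix s assume s: "s \<in> {0..T}"
        show "(X \<theta> has_vector_derivative - V s (X \<theta> s)) (at s within {0..T})"
          using \<theta> s t by (intro sub) auto
        have "((\<lambda>s. r *\<^sub>R z s) has_vector_derivative r *\<^sub>R - V s (z s)) (at s within {0..T})"
          using z(2)[OF s] by (auto intro!: derivative_eq_intros)
        then show "((\<lambda>s. r *\<^sub>R z s) has_vector_derivative - V s (r *\<^sub>R z s)) (at s within {0..T})"
          using s rx(1) by (simp add: V_scaleR)
        have "X \<theta> s \<in> Theta_bar" "r *\<^sub>R z s \<in> Theta_bar"
          using X_Theta[OF \<theta>, of s] z_Theta[OF s] s t rx(1) closure_subset[of Theta] by (auto simp: Theta_scaleR_iff)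
        then show "norm (- V s (X \<theta> s) - - V s (r *\<^sub>R z s)) \<le> L * norm (X \<theta> s - r *\<^sub>R z s)"
          using V_lipschitz[of s "X \<theta> s" "r *\<^sub>R z s"] norm_minus_cancel[of "V s (X \<theta> s) - V s (r *\<^sub>R z s)"] s by simp
      qed
      also have "\<dots> = exp (L * T) * (r * dist (z 0) x)"
      proof -
        have "X \<theta> 0 - r *\<^sub>R z 0 = r *\<^sub>R (x - z 0)" using X(1)[OF \<theta>] rx(3) by (simp add: scaleR_diff_right)
        then show ?thesis using rx(1) by (simp add: dist_norm norm_minus_commute)
      qed
      also have "\<dots> < exp (L * T) * (r * (exp (- L * T) * r0))"
        using rx by (intro mult_strict_left_mono) (auto simp: U_def)
      also have "\<dots> = r * r0" by (simp add: exp_minus)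
      finally have "norm (X \<theta> T - r *\<^sub>R \<theta>1) < r * r0" by (simp add: z(1))
      then have "norm (X \<theta> T - r *\<^sub>R \<theta>1) / r < r0" using rx(1) by (simp add: pos_divide_less_eq mult.commute)
      moreover have "\<theta>1 - (1 / r) *\<^sub>R X \<theta> T = - (1 / r) *\<^sub>R (X \<theta> T - r *\<^sub>R \<theta>1)"
        using rx(1) by (simp add: scaleR_diff_right)
      then have "dist \<theta>1 ((1 / r) *\<^sub>R X \<theta> T) = norm (X \<theta> T - r *\<^sub>R \<theta>1) / r"
        using rx(1) by (simp only: dist_norm norm_scaleR) simp
      ultimately have "(1 / r) *\<^sub>R X \<theta> T \<in> ball \<theta>1 r0" by simp
      then have "r *\<^sub>R ((1 / r) *\<^sub>R X \<theta> T) \<in> \<C>" using r0(2) cone(3) rx(1) by blast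
      then have "X \<theta> T \<in> \<C>" using rx(1) by simp
      then have "exp (k * (t - T)) * norm (X \<theta> T) \<le> norm (X \<theta> t)"
        using \<theta> T t by (intro grow sub X_Theta) auto
      moreover have "a \<le> norm (X \<theta> T)"
      proof -
        have "a \<le> exp (- L * T) * norm \<theta>" unfolding a_def using m(2)[OF \<theta>] by simp
        also have "\<dots> \<le> norm (X \<theta> T)" using size(2)[OF \<theta>, of T] T t by simp
        finally show ?thesis .
      qed
      then have "b \<le> exp (k * (t - T)) * norm (X \<theta> T)" unfolding b_def by simp
      ultimately show ?thesis by simp
    qed
    define W where "W = {\<theta> :: 'n param. b - 1 < norm \<theta>}"
    have "open W" unfolding W_def by (intro open_Collect_less continuous_intros)
    \<comment> \<open>The tube radius is capped at 1, so transported mass may lie closer to 0 than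
      the trajectories by at most 1. This explains b - 1.\<close>
    have "measure (\<pi> 0) A / 2 \<le> measure (\<pi> t) (W \<inter> Theta)"
    proof (rule transport_lower_bound[OF t0 A(1) A_Theta, where r = "min e 1" and X = X])
      show "cball (X \<theta> s) (min e 1) \<subseteq> Theta" if "\<theta> \<in> A" "s \<in> {0..t}" for \<theta> s
        using e(2) inZ[OF that] by (auto simp: subset_iff)
      show "ball (X \<theta> t) (min e 1) \<subseteq> W" if "\<theta> \<in> A" for \<theta>
      proof
        fix y assume "y \<in> ball (X \<theta> t) (min e 1)"
        then have "dist (X \<theta> t) y < 1" by simp
        moreover have "norm (X \<theta> t) \<le> norm y + dist (X \<theta> t) y" unfolding dist_norm by (rule norm_triangle_sub)
        ultimately show "y \<in> W" using far[OF that] by (simp add: W_def)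
      qed
    qed (use e(1) X(1,2) \<open>open W\<close> in auto)
    then have "(b - 1)\<^sup>2 * (measure (\<pi> 0) A / 2) \<le> (b - 1)\<^sup>2 * measure (\<pi> t) (W \<inter> Theta)"
      by (rule mult_left_mono) simp
    also have "\<dots> \<le> second_moment (\<pi> t)"
    proof (rule second_moment_lower[OF \<pi>_P2[OF t0]])
      show "W \<inter> Theta \<in> sets (\<pi> t)"
        using borel_open[OF \<open>open W\<close>] borel_open[OF open_Theta]
        by (intro P2_borel_sets[OF \<pi>_P2[OF t0]] sets.Int order_trans[OF Int_lower2 closure_subset])
      show "b - 1 \<le> norm \<theta>" if "\<theta> \<in> W \<inter> Theta" for \<theta> using that by (simp add: W_def)
    qed (use t(2) in \<open>simp add: b_def\<close>)
    finally show ?thesis by (simp add: b_def)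
  qed
  have ex: "filterlim (\<lambda>t. exp (k * (t - T)) * a) at_top at_top"
    using k \<open>a > 0\<close> by real_asymp
  have "filterlim (\<lambda>t. (exp (k * (t - T)) * a - 1)\<^sup>2 * (measure (\<pi> 0) A / 2)) at_top at_top"
    using k \<open>a > 0\<close> A(3) by real_asymp
  then show ?thesis
  proof (rule filterlim_at_top_mono)
    show "\<forall>\<^sub>F t in at_top. (exp (k * (t - T)) * a - 1)\<^sup>2 * (measure (\<pi> 0) A / 2) \<le> second_moment (\<pi> t)"
      using eventually_ge_at_top[of T] ex[unfolded filterlim_at_top, rule_format, of 1]
      by eventually_elim (rule main)
  qed
qed

end

section \<open>The limit field\<close>

context gradient_flow
begin

text \<open>The error is measured relative to the norm: by homogeneity of degree one this is uniform
  convergence on the unit sphere, stated so that it applies on the whole unbounded set.\<close>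

definition limit_field :: "('n param \<Rightarrow> 'n param) \<Rightarrow> bool" where
  "limit_field W \<longleftrightarrow> (\<forall>e>0. \<exists>T\<ge>0. \<forall>t\<ge>T. \<forall>\<theta>\<in>Theta_bar. norm (V t \<theta> - W \<theta>) \<le> e * norm \<theta>)"

lemma normalized_in_Theta_bar: "\<theta> \<in> Theta_bar \<Longrightarrow> \<theta> \<noteq> 0 \<Longrightarrow> \<theta> /\<^sub>R norm \<theta> \<in> sphere 0 1 \<inter> Theta_bar"
  using Theta_bar_scaleR[of \<theta> "inverse (norm \<theta>)"] by simp

lemma V_subsequence:
  assumes \<tau>: "\<And>n. 0 \<le> \<tau> n"
  obtains k W where "strict_mono (k :: nat \<Rightarrow> nat)"
    "\<And>e. e > 0 \<Longrightarrow> \<exists>N. \<forall>n\<ge>N. \<forall>\<theta>\<in>Theta_bar. norm (V (\<tau> (k n)) \<theta> - W \<theta>) \<le> e * norm \<theta>"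
proof -
  let ?S = "sphere 0 1 \<inter> (Theta_bar :: 'n param set)"
  have S: "compact ?S" by (intro compact_Int_closed) auto
  have M: "norm (V (\<tau> n) \<theta>) \<le> L" if "\<theta> \<in> ?S" for n \<theta>
    using V_norm[OF \<tau>, of n \<theta>] that by simp
  have equi: "\<exists>d>0. \<forall>n \<eta>. \<eta> \<in> ?S \<and> norm (\<theta> - \<eta>) < d \<longrightarrow> norm (V (\<tau> n) \<theta> - V (\<tau> n) \<eta>) < e"
    if \<theta>: "\<theta> \<in> ?S" and "0 < e" for \<theta> e
  proof (intro exI[of _ "e / L"] conjI allI impI)
    show "0 < e / L" using \<open>0 < e\<close> L_pos by simp
    fix n \<eta> assume \<eta>: "\<eta> \<in> ?S \<and> norm (\<theta> - \<eta>) < e / L"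
    have "norm (V (\<tau> n) \<theta> - V (\<tau> n) \<eta>) \<le> L * norm (\<theta> - \<eta>)"
      using \<theta> \<eta> by (intro V_lipschitz \<tau>) blast+
    also have "\<dots> < L * (e / L)" using \<eta> L_pos by (intro mult_strict_left_mono) blast+
    finally show "norm (V (\<tau> n) \<theta> - V (\<tau> n) \<eta>) < e" using L_pos by simp
  qed
  obtain h k where k: "strict_mono (k :: nat \<Rightarrow> nat)"
    and lim: "\<And>e. 0 < e \<Longrightarrow> \<exists>N. \<forall>n \<theta>. n \<ge> N \<and> \<theta> \<in> ?S \<longrightarrow> norm (V (\<tau> (k n)) \<theta> - h \<theta>) < e"
    using Arzela_Ascoli[where \<F> = "\<lambda>n. V (\<tau> n)", OF S M equi] by metis
  show thesis
  \<comment> \<open>The homogeneous extension of h; at \<theta> = 0 the factor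
    \<open>norm \<theta>\<close> makes it 0, whatever the value of h there.\<close>
  proof (rule that[OF k, of "\<lambda>\<theta>. norm \<theta> *\<^sub>R h (\<theta> /\<^sub>R norm \<theta>)"])
    fix e :: real assume "e > 0"
    then obtain N where N: "\<And>n \<theta>. n \<ge> N \<Longrightarrow> \<theta> \<in> ?S \<Longrightarrow> norm (V (\<tau> (k n)) \<theta> - h \<theta>) < e"
      using lim by blast
    have "norm (V (\<tau> (k n)) \<theta> - norm \<theta> *\<^sub>R h (\<theta> /\<^sub>R norm \<theta>)) \<le> e * norm \<theta>"
      if n: "n \<ge> N" and \<theta>: "\<theta> \<in> Theta_bar" for n \<theta>
    proof (cases "\<theta> = 0")
      case True
      then show ?thesis using V_0[OF \<tau>, of "k n"] by simp
    next
      case False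
      let ?u = "\<theta> /\<^sub>R norm \<theta>"
      have "V (\<tau> (k n)) \<theta> = V (\<tau> (k n)) (norm \<theta> *\<^sub>R ?u)" using False by simp
      also have "\<dots> = norm \<theta> *\<^sub>R V (\<tau> (k n)) ?u" using False by (intro V_scaleR \<tau>) simp
      finally have "V (\<tau> (k n)) \<theta> - norm \<theta> *\<^sub>R h ?u = norm \<theta> *\<^sub>R (V (\<tau> (k n)) ?u - h ?u)"
        by (simp add: scaleR_diff_right)
      then have "norm (V (\<tau> (k n)) \<theta> - norm \<theta> *\<^sub>R h ?u) = norm \<theta> * norm (V (\<tau> (k n)) ?u - h ?u)" by simp
      also have "\<dots> \<le> norm \<theta> * e"
        using N[OF n normalized_in_Theta_bar[OF \<theta> False]] by (intro mult_left_mono) auto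
      finally show ?thesis by (simp add: mult.commute)
    qed
    then show "\<exists>N. \<forall>n\<ge>N. \<forall>\<theta>\<in>Theta_bar. norm (V (\<tau> (k n)) \<theta> - norm \<theta> *\<^sub>R h (\<theta> /\<^sub>R norm \<theta>)) \<le> e * norm \<theta>"
      by blast
  qed
qed

text \<open>On compact sets norms are bounded, so the relative error becomes uniformly small. The
  potentials converge along with the fields because Euler's identity expresses them through the
  fields.\<close>

lemma limit_pairs_subsequence:
  assumes \<tau>: "\<And>n. 0 \<le> \<tau> n" "filterlim \<tau> at_top sequentially"
    and lim: "\<And>e. e > 0 \<Longrightarrow> \<exists>N. \<forall>n\<ge>N. \<forall>\<theta>\<in>Theta_bar. norm (V (\<tau> n) \<theta> - W \<theta>) \<le> e * norm \<theta>"
  shows "(restrict (\<lambda>\<theta>. \<theta> \<bullet> W \<theta> / 2) Theta_bar, restrict W Theta_bar) \<in> limit_pairs \<l> P \<pi>"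
proof -
  have V_lim: "locally_uniform_limit Theta_bar (\<lambda>n. V (\<tau> n)) (restrict W Theta_bar)"
    unfolding locally_uniform_limit_def
  proof (intro allI impI uniform_limitI)
    fix A and e :: real assume A: "compact A \<and> A \<subseteq> (Theta_bar :: 'n param set)" and "e > 0"
    then obtain R where R: "R > 0" "\<And>\<theta>. \<theta> \<in> A \<Longrightarrow> norm \<theta> \<le> R"
      using compact_imp_bounded[of A] unfolding bounded_pos by blast
    have "e / (2 * R) > 0" using \<open>e > 0\<close> R(1) by simp
    from lim[OF this] obtain N where
      N: "\<And>n \<theta>. n \<ge> N \<Longrightarrow> \<theta> \<in> Theta_bar \<Longrightarrow> norm (V (\<tau> n) \<theta> - W \<theta>) \<le> e / (2 * R) * norm \<theta>" by blast
    have "dist (V (\<tau> n) \<theta>) (restrict W Theta_bar \<theta>) < e" if "n \<ge> N" "\<theta> \<in> A" for n \<theta>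
    proof -
      have \<theta>: "\<theta> \<in> Theta_bar" using A that by blast
      have "norm (V (\<tau> n) \<theta> - W \<theta>) \<le> e / (2 * R) * norm \<theta>" using N[OF that(1) \<theta>] .
      also have "\<dots> \<le> e / (2 * R) * R" using R \<open>e > 0\<close> that(2) by (intro mult_left_mono) auto
      also have "\<dots> < e" using R(1) \<open>e > 0\<close> by simp
      finally show ?thesis using \<theta> by (simp add: dist_norm)
    qed
    then show "\<forall>\<^sub>F n in sequentially. \<forall>\<theta>\<in>A. dist (V (\<tau> n) \<theta>) (restrict W Theta_bar \<theta>) < e"
      unfolding eventually_sequentially by blast
  qed
  have G_lim: "locally_uniform_limit Theta_bar (\<lambda>n. G (\<tau> n)) (restrict (\<lambda>\<theta>. \<theta> \<bullet> W \<theta> / 2) Theta_bar)"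
    unfolding locally_uniform_limit_def
  proof (intro allI impI uniform_limitI)
    fix A and e :: real assume A: "compact A \<and> A \<subseteq> (Theta_bar :: 'n param set)" and "e > 0"
    then obtain R where R: "R > 0" "\<And>\<theta>. \<theta> \<in> A \<Longrightarrow> norm \<theta> \<le> R"
      using compact_imp_bounded[of A] unfolding bounded_pos by blast
    have "e / R\<^sup>2 > 0" using \<open>e > 0\<close> R(1) by simp
    from lim[OF this] obtain N where
      N: "\<And>n \<theta>. n \<ge> N \<Longrightarrow> \<theta> \<in> Theta_bar \<Longrightarrow> norm (V (\<tau> n) \<theta> - W \<theta>) \<le> e / R\<^sup>2 * norm \<theta>" by blast
    have "dist (G (\<tau> n) \<theta>) (restrict (\<lambda>\<theta>. \<theta> \<bullet> W \<theta> / 2) Theta_bar \<theta>) < e" if "n \<ge> N" "\<theta> \<in> A" for n \<theta>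
    proof -
      have \<theta>: "\<theta> \<in> Theta_bar" using A that by blast
      have "\<bar>\<theta> \<bullet> (V (\<tau> n) \<theta> - W \<theta>)\<bar> \<le> norm \<theta> * norm (V (\<tau> n) \<theta> - W \<theta>)" by (rule Cauchy_Schwarz_ineq2)
      also have "\<dots> \<le> R * (e / R\<^sup>2 * R)"
        using R \<open>e > 0\<close> that(2)
        by (intro mult_mono order_trans[OF N[OF that(1) \<theta>]] mult_left_mono) auto
      also have "\<dots> = e" using R(1) by (simp add: power2_eq_square)
      finally have "\<bar>\<theta> \<bullet> V (\<tau> n) \<theta> / 2 - \<theta> \<bullet> W \<theta> / 2\<bar> \<le> e / 2"
        by (simp add: inner_diff_right flip: diff_divide_distrib)
      then show ?thesis using \<theta> \<open>e > 0\<close> by (simp add: dist_real_def G_eq[OF \<tau>(1)])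
    qed
    then show "\<forall>\<^sub>F n in sequentially. \<forall>\<theta>\<in>A. dist (G (\<tau> n) \<theta>) (restrict (\<lambda>\<theta>. \<theta> \<bullet> W \<theta> / 2) Theta_bar \<theta>) < e"
      unfolding eventually_sequentially by blast
  qed
  show ?thesis
    unfolding limit_pairs_def mem_Collect_eq case_prod_conv delta_risk_eq grad_delta_risk_eq
    using V_lim G_lim \<tau> by (intro conjI exI[of _ \<tau>] allI restrict_extensional)
qed

text \<open>If the fields did not converge, some times tending to infinity would stay at a fixed
  relative distance from the limit; compactness extracts a further limit pair from them, which by
  uniqueness is the same one.\<close>

lemma unique_limit:
  assumes "card (limit_pairs \<l> P \<pi>) = 1" and sard: "morse_sard_condition \<l> P \<pi>"
  obtains W where "limit_field W"
    "AE s in lborel. \<forall>\<theta>\<in>sphere 0 1 \<inter> Theta_bar. \<theta> \<bullet> W \<theta> / 2 = s \<longrightarrow> W \<theta> - (\<theta> \<bullet> W \<theta>) *\<^sub>R \<theta> \<noteq> 0"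
proof -
  obtain p where p: "limit_pairs \<l> P \<pi> = {p}" using assms(1) card_1_singletonE by blast
  have lim: "\<exists>k. strict_mono (k :: nat \<Rightarrow> nat) \<and>
      (\<forall>e>0. \<exists>N. \<forall>n\<ge>N. \<forall>\<theta>\<in>Theta_bar. norm (V (\<tau> (k n)) \<theta> - snd p \<theta>) \<le> e * norm \<theta>) \<and>
      fst p = restrict (\<lambda>\<theta>. \<theta> \<bullet> snd p \<theta> / 2) Theta_bar"
    if \<tau>: "\<And>n. 0 \<le> \<tau> n" "filterlim \<tau> at_top sequentially" for \<tau>
  proof -
    obtain k W where k: "strict_mono (k :: nat \<Rightarrow> nat)"
      and W: "\<And>e. e > 0 \<Longrightarrow> \<exists>N. \<forall>n\<ge>N. \<forall>\<theta>\<in>Theta_bar. norm (V (\<tau> (k n)) \<theta> - W \<theta>) \<le> e * norm \<theta>"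
      by (rule V_subsequence[of \<tau>, OF \<tau>(1)]) blast
    have "filterlim (\<lambda>n. \<tau> (k n)) at_top sequentially"
      by (rule filterlim_compose[OF \<tau>(2) filterlim_subseq[OF k]])
    from limit_pairs_subsequence[OF \<tau>(1) this W]
    have "p = (restrict (\<lambda>\<theta>. \<theta> \<bullet> W \<theta> / 2) Theta_bar, restrict W Theta_bar)" by (simp add: p)
    then have "snd p \<theta> = W \<theta>" if "\<theta> \<in> Theta_bar" for \<theta> using that by simp
    moreover have "fst p = restrict (\<lambda>\<theta>. \<theta> \<bullet> snd p \<theta> / 2) Theta_bar"
      unfolding \<open>p = _\<close> by (auto simp: restrict_def)
    ultimately show ?thesis using k W by (intro exI[of _ k]) simp
  qed
  have "limit_field (snd p)"
  proof (rule ccontr)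
    assume "\<not> limit_field (snd p)"
    then obtain e where e: "e > 0" "\<forall>T\<ge>0. \<exists>t\<ge>T. \<exists>\<theta>\<in>Theta_bar. \<not> norm (V t \<theta> - snd p \<theta>) \<le> e * norm \<theta>"
      unfolding limit_field_def by blast
    have "\<forall>n::nat. \<exists>t\<ge>real n. \<exists>\<theta>\<in>Theta_bar. \<not> norm (V t \<theta> - snd p \<theta>) \<le> e * norm \<theta>"
      using e(2) by simp
    from choice[OF this] obtain \<tau> where
      \<tau>0: "\<forall>n::nat. \<tau> n \<ge> real n \<and> (\<exists>\<theta>\<in>Theta_bar. \<not> norm (V (\<tau> n) \<theta> - snd p \<theta>) \<le> e * norm \<theta>)" by (elim exE)
    note \<tau> = conjunct1[OF spec[OF \<tau>0]] conjunct2[OF spec[OF \<tau>0]]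
    have fl: "filterlim \<tau> at_top sequentially"
      by (rule filterlim_at_top_mono[OF filterlim_real_sequentially]) (simp add: \<tau>(1))
    have "0 \<le> \<tau> n" for n using \<tau>(1)[of n] of_nat_0_le_iff order_trans by blast
    from lim[OF this fl] obtain k where k: "strict_mono (k :: nat \<Rightarrow> nat) \<and>
      (\<forall>e>0. \<exists>N. \<forall>n\<ge>N. \<forall>\<theta>\<in>Theta_bar. norm (V (\<tau> (k n)) \<theta> - snd p \<theta>) \<le> e * norm \<theta>) \<and>
      fst p = restrict (\<lambda>\<theta>. \<theta> \<bullet> snd p \<theta> / 2) Theta_bar" by (elim exE)
    from mp[OF spec[OF conjunct1[OF conjunct2[OF k]]] e(1)] obtain N where
      "\<forall>n\<ge>N. \<forall>\<theta>\<in>Theta_bar. norm (V (\<tau> (k n)) \<theta> - snd p \<theta>) \<le> e * norm \<theta>" by (elim exE)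
    then show False using \<tau>(2)[of "k N"] by blast
  qed
  moreover have "AE s in lborel. \<forall>\<theta>\<in>sphere 0 1 \<inter> Theta_bar. \<theta> \<bullet> snd p \<theta> / 2 = s \<longrightarrow> snd p \<theta> - (\<theta> \<bullet> snd p \<theta>) *\<^sub>R \<theta> \<noteq> 0"
  proof -
    \<comment> \<open>The integer times serve as some sequence tending to infinity; the relation
      between the two components of p does not mention the sequence.\<close>
    have fst: "fst p = restrict (\<lambda>\<theta>. \<theta> \<bullet> snd p \<theta> / 2) Theta_bar"
      using lim[of real, OF of_nat_0_le_iff filterlim_real_sequentially] by blast
    have "AE s in lborel. \<forall>\<theta>\<in>sphere 0 1 \<inter> Theta_bar. fst p \<theta> = s \<longrightarrow> snd p \<theta> - (\<theta> \<bullet> snd p \<theta>) *\<^sub>R \<theta> \<noteq> 0"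
      using sard unfolding morse_sard_condition_def p by (simp add: case_prod_unfold)
    then show ?thesis
      by (rule eventually_mono) (simp add: fst)
  qed
  ultimately show thesis by (rule that)
qed

context
  fixes W
  assumes lf: "limit_field W"
begin

lemma limit_field_tendsto: "\<theta> \<in> Theta_bar \<Longrightarrow> ((\<lambda>t. V t \<theta>) \<longlongrightarrow> W \<theta>) at_top"
proof (rule tendstoI)
  fix e :: real assume \<theta>: "\<theta> \<in> Theta_bar" and "e > 0"
  then have pos: "e / (norm \<theta> + 1) > 0" by (simp add: add_nonneg_pos)
  then obtain T where T: "\<forall>t\<ge>T. \<forall>\<theta>'\<in>Theta_bar. norm (V t \<theta>' - W \<theta>') \<le> e / (norm \<theta> + 1) * norm \<theta>'"
    using lf unfolding limit_field_def by blast
  have "dist (V t \<theta>) (W \<theta>) < e" if "t \<ge> T" for t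
  proof -
    have "norm (V t \<theta> - W \<theta>) \<le> e / (norm \<theta> + 1) * norm \<theta>" using T that \<theta> by blast
    also have "\<dots> < e / (norm \<theta> + 1) * (norm \<theta> + 1)"
      using pos by (intro mult_strict_left_mono) auto
    also have "\<dots> = e" using norm_ge_zero[of \<theta>] by (simp add: add_nonneg_eq_0_iff)
    finally show ?thesis by (simp add: dist_norm)
  qed
  then show "\<forall>\<^sub>F t in at_top. dist (V t \<theta>) (W \<theta>) < e"
    unfolding eventually_at_top_linorder by blast
qed

lemma
  assumes "\<theta> \<in> Theta_bar"
  shows limit_field_lipschitz: "\<eta> \<in> Theta_bar \<Longrightarrow> norm (W \<theta> - W \<eta>) \<le> L * norm (\<theta> - \<eta>)"
    and limit_field_norm: "norm (W \<theta>) \<le> L * norm \<theta>"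
    and limit_field_scaleR: "r > 0 \<Longrightarrow> W (r *\<^sub>R \<theta>) = r *\<^sub>R W \<theta>"
    and limit_field_G: "((\<lambda>t. G t \<theta>) \<longlongrightarrow> \<theta> \<bullet> W \<theta> / 2) at_top"
proof -
  note lim = limit_field_tendsto
  have ev: "\<forall>\<^sub>F t in at_top. 0 \<le> (t::real)" by (rule eventually_ge_at_top)
  show "norm (W \<theta> - W \<eta>) \<le> L * norm (\<theta> - \<eta>)" if \<eta>: "\<eta> \<in> Theta_bar"
  proof (rule tendsto_upperbound[OF tendsto_norm[OF tendsto_diff[OF lim lim]]])
    show "\<forall>\<^sub>F t in at_top. norm (V t \<theta> - V t \<eta>) \<le> L * norm (\<theta> - \<eta>)"
      using ev by eventually_elim (intro V_lipschitz assms \<eta>)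
  qed (use assms \<eta> in auto)
  show "norm (W \<theta>) \<le> L * norm \<theta>"
  proof (rule tendsto_upperbound[OF tendsto_norm[OF lim[OF assms]]])
    show "\<forall>\<^sub>F t in at_top. norm (V t \<theta>) \<le> L * norm \<theta>"
      using ev by eventually_elim (rule V_norm)
  qed auto
  show "W (r *\<^sub>R \<theta>) = r *\<^sub>R W \<theta>" if "r > 0"
  proof (rule tendsto_unique[OF _ lim[OF Theta_bar_scaleR[OF assms]]])
    have "\<forall>\<^sub>F t in at_top. r *\<^sub>R V t \<theta> = V t (r *\<^sub>R \<theta>)"
      using ev by eventually_elim (simp add: V_scaleR that)
    then show "((\<lambda>t. V t (r *\<^sub>R \<theta>)) \<longlongrightarrow> r *\<^sub>R W \<theta>) at_top"
      by (rule Lim_transform_eventually[OF tendsto_scaleR[OF tendsto_const lim[OF assms]]])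
  qed auto
  have "\<forall>\<^sub>F t in at_top. \<theta> \<bullet> V t \<theta> / 2 = G t \<theta>"
    using ev by eventually_elim (simp add: G_eq)
  then show "((\<lambda>t. G t \<theta>) \<longlongrightarrow> \<theta> \<bullet> W \<theta> / 2) at_top"
    by (rule Lim_transform_eventually[rotated]) (intro tendsto_intros lim assms, simp)
qed

text \<open>The quadratic Taylor remainder has a constant independent of time, so it survives the
  limit.\<close>

lemma limit_potential_has_derivative:
  assumes \<theta>: "\<theta> \<in> Theta"
  shows "((\<lambda>\<theta>. \<theta> \<bullet> W \<theta> / 2) has_derivative (\<lambda>v. W \<theta> \<bullet> v)) (at \<theta>)"
proof -
  let ?g = "\<lambda>\<theta>. \<theta> \<bullet> W \<theta> / 2"
  have taylor: "norm (?g \<eta> - ?g \<theta> - W \<theta> \<bullet> (\<eta> - \<theta>)) \<le> L * (norm (\<eta> - \<theta>))\<^sup>2" if \<eta>: "\<eta> \<in> Theta" for \<eta>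
  proof (rule tendsto_upperbound)
    have bar: "\<theta> \<in> Theta_bar" "\<eta> \<in> Theta_bar" using \<theta> \<eta> closure_subset by blast+
    show "((\<lambda>t. norm (G t \<eta> - G t \<theta> - V t \<theta> \<bullet> (\<eta> - \<theta>))) \<longlongrightarrow> norm (?g \<eta> - ?g \<theta> - W \<theta> \<bullet> (\<eta> - \<theta>))) at_top"
      by (intro tendsto_norm tendsto_diff limit_field_G bar tendsto_inner tendsto_const limit_field_tendsto)
    show "\<forall>\<^sub>F t in at_top. norm (G t \<eta> - G t \<theta> - V t \<theta> \<bullet> (\<eta> - \<theta>)) \<le> L * (norm (\<eta> - \<theta>))\<^sup>2"
      using eventually_ge_at_top[of 0] by eventually_elim (simp only: real_norm_def G_taylor \<theta> \<eta>)
  qed auto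
  obtain r where r: "r > 0" "ball \<theta> r \<subseteq> Theta" using open_Theta \<theta> open_contains_ball by blast
  show ?thesis
    unfolding has_derivative_at_alt
  proof (intro conjI allI impI bounded_linear_inner_right)
    fix e :: real assume "e > 0"
    show "\<exists>d>0. \<forall>y. norm (y - \<theta>) < d \<longrightarrow> norm (?g y - ?g \<theta> - W \<theta> \<bullet> (y - \<theta>)) \<le> e * norm (y - \<theta>)"
    proof (intro exI[of _ "min r (e / L)"] conjI allI impI)
      show "0 < min r (e / L)" using r(1) \<open>e > 0\<close> L_pos by simp
      fix y assume y: "norm (y - \<theta>) < min r (e / L)"
      then have "y \<in> Theta" using r(2) by (auto simp: dist_norm norm_minus_commute)
      from taylor[OF this] have "norm (?g y - ?g \<theta> - W \<theta> \<bullet> (y - \<theta>)) \<le> (L * norm (y - \<theta>)) * norm (y - \<theta>)"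
        by (simp add: power2_eq_square)
      also have "\<dots> \<le> e * norm (y - \<theta>)"
        using y L_pos by (intro mult_right_mono) (auto simp: field_simps)
      finally show "norm (?g y - ?g \<theta> - W \<theta> \<bullet> (y - \<theta>)) \<le> e * norm (y - \<theta>)" .
    qed
  qed
qed

lemma limit_field_continuous: "continuous_on Theta_bar W"
  using limit_field_lipschitz L_pos
  by (intro lipschitz_on_continuous_on[of L] lipschitz_onI) (simp_all only: dist_norm less_imp_le)

end

end

text \<open>A nonempty open interval is not a Lebesgue null set.\<close>

lemma Morse_level_exists:
  fixes a b :: real
  assumes "AE s in lborel. R s" "a < b"
  obtains s where "a < s" "s < b" "R s"
proof -
  have "\<exists>s. a < s \<and> s < b \<and> R s"
  proof (rule ccontr)
    assume none: "\<nexists>s. a < s \<and> s < b \<and> R s"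
    have "AE s in lborel. s \<notin> {a<..<b}"
      using assms(1) by (rule eventually_mono) (use none in auto)
    then have "{a<..<b} \<in> null_sets lborel" by (subst AE_iff_null_sets) auto
    then show False using assms(2) by (auto simp: null_sets_def)
  qed
  then show thesis using that by blast
qed

section \<open>The invariant cone and the vanishing of the limit potential\<close>

context gradient_flow
begin

text \<open>On the boundary of the cone, at norm 1, the gradient of g(\<theta>) - s |\<theta>|^2 is
  y = W \<theta> - 2 s \<theta>, which is the tangential gradient because \<theta> is orthogonal to
  it. Moving along - W would decrease the function at rate |y|^2 \<ge> c0; replacing W by V changes
  the rate by at most (L + 2 |s|) e < c0.\<close>

lemma limit_cone_invariant:
  assumes lf: "limit_field W" and s: "s < 0" and c0: "c0 > 0"
    and sard: "\<And>\<theta>. \<theta> \<in> sphere 0 1 \<inter> Theta_bar \<Longrightarrow> \<theta> \<bullet> W \<theta> / 2 = s \<Longrightarrow> c0 \<le> (norm (W \<theta> - (\<theta> \<bullet> W \<theta>) *\<^sub>R \<theta>))\<^sup>2"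
    and e: "0 < e" "(L + 2 * \<bar>s\<bar>) * e < c0"
    and close: "\<And>\<tau> \<theta>. \<tau> \<in> {T..t} \<Longrightarrow> \<theta> \<in> Theta_bar \<Longrightarrow> norm (V \<tau> \<theta> - W \<theta>) \<le> e * norm \<theta>"
    and T: "0 \<le> T"
    and c: "\<And>\<tau>. \<tau> \<in> {T..t} \<Longrightarrow> (c has_vector_derivative - V \<tau> (c \<tau>)) (at \<tau> within {T..t})"
      "\<And>\<tau>. \<tau> \<in> {T..t} \<Longrightarrow> c \<tau> \<in> Theta"
    and start: "c T \<bullet> W (c T) / 2 < s * (norm (c T))\<^sup>2"
    and \<tau>: "\<tau> \<in> {T..t}"
  shows "c \<tau> \<bullet> W (c \<tau>) / 2 < s * (norm (c \<tau>))\<^sup>2"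
proof -
  define g where "g \<theta> = \<theta> \<bullet> W \<theta> / 2" for \<theta>
  have "g (c \<tau>) - s * (c \<tau> \<bullet> c \<tau>) < 0"
  proof (rule strict_barrier[OF _ _ _ \<tau>])
    fix r assume r: "r \<in> {T..t}"
    have bar: "c r \<in> Theta_bar" using c(2)[OF r] closure_subset by blast
    have "((g \<circ> c) has_vector_derivative W (c r) \<bullet> - V r (c r)) (at r within {T..t})"
      unfolding g_def
      by (rule vector_derivative_diff_chain_within[OF c(1)[OF r]
          has_derivative_at_withinI[OF limit_potential_has_derivative[OF lf c(2)[OF r]]]])
    then have dg: "((\<lambda>r. g (c r)) has_real_derivative W (c r) \<bullet> - V r (c r)) (at r within {T..t})"
      by (simp add: has_real_derivative_iff_has_vector_derivative comp_def)
    show "((\<lambda>r. g (c r) - s * (c r \<bullet> c r)) has_real_derivative - ((W (c r) - (2 * s) *\<^sub>R c r) \<bullet> V r (c r)))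
        (at r within {T..t})"
      using inner_has_real_derivative[OF c(1)[OF r] c(1)[OF r]]
      by (auto intro!: derivative_eq_intros dg simp: inner_diff_left inner_commute algebra_simps)
    assume zero: "g (c r) - s * (c r \<bullet> c r) = 0"
    \<comment> \<open>Everything is homogeneous, so the contact point may be moved to the unit
      sphere, where the regularity of the level is known.\<close>
    define \<rho> u where "\<rho> = norm (c r)" and "u = c r /\<^sub>R norm (c r)"
    have "c r \<noteq> 0" using c(2)[OF r] zero_notin_Theta by auto
    then have \<rho>: "\<rho> > 0" and cr: "c r = \<rho> *\<^sub>R u" by (simp_all add: \<rho>_def u_def)
    have u: "u \<in> sphere 0 1 \<inter> Theta_bar"
      unfolding u_def by (rule normalized_in_Theta_bar[OF bar \<open>c r \<noteq> 0\<close>])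
    then have nu: "norm u = 1" "u \<bullet> u = 1" by (simp_all add: norm_eq_1)
    have Wc: "W (c r) = \<rho> *\<^sub>R W u" unfolding cr using u \<rho> by (intro limit_field_scaleR[OF lf]) auto
    have Vc: "V r (c r) = \<rho> *\<^sub>R V r u" unfolding cr using r T \<rho> by (intro V_scaleR) auto
    have "\<rho>\<^sup>2 * (u \<bullet> W u / 2) = \<rho>\<^sup>2 * s"
    proof -
      have "c r \<bullet> W (c r) = \<rho>\<^sup>2 * (u \<bullet> W u)" unfolding Wc by (subst cr) (simp add: power2_eq_square)
      moreover have "c r \<bullet> c r = \<rho>\<^sup>2" by (simp add: \<rho>_def power2_norm_eq_inner)
      ultimately show ?thesis using zero by (simp add: g_def)
    qed
    then have gu: "u \<bullet> W u / 2 = s" using \<rho> by simp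
    define y where "y = W u - (2 * s) *\<^sub>R u"
    have uy: "u \<bullet> y = 0" using gu nu by (simp add: y_def inner_diff_right)
    have "c0 \<le> (norm (W u - (u \<bullet> W u) *\<^sub>R u))\<^sup>2" by (rule sard[OF u gu])
    also have "W u - (u \<bullet> W u) *\<^sub>R u = y" using gu by (simp add: y_def mult.commute)
    finally have c0y: "c0 \<le> y \<bullet> y" by (simp add: power2_norm_eq_inner)
    have "norm y \<le> norm (W u) + norm ((2 * s) *\<^sub>R u)" unfolding y_def by (rule norm_triangle_ineq4)
    also have "\<dots> \<le> L + 2 * \<bar>s\<bar>" using limit_field_norm[OF lf, of u] u nu by simp
    finally have ny: "norm y \<le> L + 2 * \<bar>s\<bar>" .
    have "\<bar>y \<bullet> (V r u - W u)\<bar> \<le> norm y * norm (V r u - W u)" by (rule Cauchy_Schwarz_ineq2)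
    also have "\<dots> \<le> (L + 2 * \<bar>s\<bar>) * e"
      using ny close[OF r, of u] u nu L_pos by (intro mult_mono) auto
    finally have "- c0 < y \<bullet> (V r u - W u)" using e(2) by linarith
    moreover have "y \<bullet> V r u = y \<bullet> y + y \<bullet> (V r u - W u)"
    proof -
      have "y \<bullet> W u = y \<bullet> y + (2 * s) * (u \<bullet> y)" by (simp add: y_def inner_diff_left inner_diff_right inner_commute algebra_simps)
      then show ?thesis using uy by (simp add: inner_diff_right)
    qed
    ultimately have "0 < y \<bullet> V r u" using c0y by linarith
    moreover have "(W (c r) - (2 * s) *\<^sub>R c r) \<bullet> V r (c r) = \<rho>\<^sup>2 * (y \<bullet> V r u)"
    proof -
      have "W (c r) - (2 * s) *\<^sub>R c r = \<rho> *\<^sub>R y"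
        unfolding Wc y_def by (subst cr) (simp add: scaleR_diff_right mult.commute)
      then show ?thesis by (simp add: Vc power2_eq_square)
    qed
    ultimately show "- ((W (c r) - (2 * s) *\<^sub>R c r) \<bullet> V r (c r)) < 0" using \<rho> by simp
  next
    show "g (c T) - s * (c T \<bullet> c T) < 0"
      using start by (simp add: g_def power2_norm_eq_inner)
  qed
  then show ?thesis by (simp add: g_def power2_norm_eq_inner)
qed

lemma limit_potential_zero:
  assumes omni: "omni_directional (\<pi> 0)" and lf: "limit_field W"
    and sard: "AE s in lborel. \<forall>\<theta>\<in>sphere 0 1 \<inter> Theta_bar. \<theta> \<bullet> W \<theta> / 2 = s \<longrightarrow> W \<theta> - (\<theta> \<bullet> W \<theta>) *\<^sub>R \<theta> \<noteq> 0"
    and bounded: "\<not> filterlim (\<lambda>t. second_moment (\<pi> t)) at_top at_top"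
    and \<theta>: "\<theta> \<in> Theta_bar"
  shows "\<theta> \<bullet> W \<theta> / 2 = 0"
proof (rule ccontr)
  define g where "g \<theta> = \<theta> \<bullet> W \<theta> / 2" for \<theta>
  assume "\<not> \<theta> \<bullet> W \<theta> / 2 = 0"
  then have "g \<theta> \<noteq> 0" by (simp add: g_def)
  have g_cont: "continuous_on Theta_bar g"
    unfolding g_def by (intro continuous_intros limit_field_continuous[OF lf]) simp
  have g_scale: "g (r *\<^sub>R \<theta>) = r\<^sup>2 * g \<theta>" if "\<theta> \<in> Theta_bar" "r > 0" for r \<theta>
    using limit_field_scaleR[OF lf that] by (simp add: g_def power2_eq_square)
  \<comment> \<open>By continuity a nonzero value on the closure forces one in the open set
    \<open>Theta\<close>, where trajectories and omni-directional cones live.\<close>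
  obtain \<theta>' where \<theta>': "\<theta>' \<in> Theta" "g \<theta>' \<noteq> 0"
    using continuous_constant_on_closure[OF g_cont _ \<theta>, of 0] \<open>g \<theta> \<noteq> 0\<close> by blast
  obtain \<theta>2 where \<theta>2: "\<theta>2 \<in> Theta" "g \<theta>2 < 0"
  proof (cases "g \<theta>' < 0")
    case True
    then show thesis using that \<theta>'(1) by blast
  next
    case False
    \<comment> \<open>Reversing the output weight stays in \<open>Theta\<close> and changes the sign
      of every \<open>G t\<close>, hence of g.\<close>
    define \<eta> where "\<eta> = (- fst \<theta>', snd \<theta>')"
    have \<eta>: "\<eta> \<in> Theta" using \<theta>'(1) by (simp add: \<eta>_def Theta_iff_cone_form cone_form_def)
    have bar: "\<theta>' \<in> Theta_bar" "\<eta> \<in> Theta_bar" using \<theta>'(1) \<eta> closure_subset by blast+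
    have "\<forall>\<^sub>F t in at_top. - G t \<theta>' = G t \<eta>"
      using eventually_ge_at_top[of 0]
    proof eventually_elim
      case (elim t)
      then show ?case
        using bounded_weight.potential_uminus_fst[OF bw, of t "fst \<theta>'" "snd \<theta>'"] by (simp add: \<eta>_def)
    qed
    then have "((\<lambda>t. G t \<eta>) \<longlongrightarrow> - g \<theta>') at_top"
      unfolding g_def by (rule Lim_transform_eventually[OF tendsto_minus[OF limit_field_G[OF lf bar(1)]]])
    then have "g \<eta> = - g \<theta>'"
      using tendsto_unique[OF _ limit_field_G[OF lf bar(2)]] by (simp add: g_def)
    then show thesis using that[OF \<eta>] False \<theta>'(2) by simp
  qed
  have "\<theta>2 \<noteq> 0" using \<theta>2(1) zero_notin_Theta by auto
  define \<theta>1 where "\<theta>1 = inverse (norm \<theta>2) *\<^sub>R \<theta>2"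
  have \<theta>1: "\<theta>1 \<in> Theta" "norm \<theta>1 = 1" "g \<theta>1 < 0"
  proof -
    have "\<theta>2 \<in> Theta_bar" using \<theta>2(1) closure_subset by blast
    then show "g \<theta>1 < 0" unfolding \<theta>1_def using g_scale[of \<theta>2 "inverse (norm \<theta>2)"] \<open>\<theta>2 \<noteq> 0\<close> \<theta>2(2)
      by (simp add: mult_pos_neg)
  qed (use \<theta>2(1) \<open>\<theta>2 \<noteq> 0\<close> Theta_scaleR_iff[of "inverse (norm \<theta>2)" \<theta>2] in \<open>simp_all add: \<theta>1_def\<close>)
  obtain s where s: "g \<theta>1 < s" "s < 0"
    and reg: "\<forall>\<theta>\<in>sphere 0 1 \<inter> Theta_bar. \<theta> \<bullet> W \<theta> / 2 = s \<longrightarrow> W \<theta> - (\<theta> \<bullet> W \<theta>) *\<^sub>R \<theta> \<noteq> 0"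
    using Morse_level_exists[OF sard \<theta>1(3)] by metis
  obtain c0 where c0: "c0 > 0" "\<And>\<theta>. \<theta> \<in> sphere 0 1 \<inter> Theta_bar \<Longrightarrow> \<theta> \<bullet> W \<theta> / 2 = s \<Longrightarrow>
      c0 \<le> (norm (W \<theta> - (\<theta> \<bullet> W \<theta>) *\<^sub>R \<theta>))\<^sup>2"
  proof -
    define Z where "Z = {\<theta> \<in> sphere 0 1 \<inter> Theta_bar. g \<theta> = s}"
    let ?h = "\<lambda>\<theta>. (norm (W \<theta> - (\<theta> \<bullet> W \<theta>) *\<^sub>R \<theta>))\<^sup>2"
    have S: "compact (sphere 0 1 \<inter> (Theta_bar :: 'n param set))" by (intro compact_Int_closed) auto
    have "closed Z"
      unfolding Z_def
      by (rule continuous_closed_preimage_constant[OF continuous_on_subset[OF g_cont] compact_imp_closed[OF S]]) simp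
    then have Z: "compact Z" using compact_Int_closed[OF S, of Z] by (simp add: Z_def Int_absorb1 Collect_mono_iff inf.absorb2 subset_eq)
    show thesis
    proof (cases "Z = {}")
      case True
      \<comment> \<open>An empty level set imposes no condition, so any positive constant
        serves.\<close>
      then show thesis using that[of 1] by (auto simp: Z_def g_def)
    next
      case False
      have "continuous_on Z W" by (rule continuous_on_subset[OF limit_field_continuous[OF lf]]) (auto simp: Z_def)
      then have "continuous_on Z ?h" by (intro continuous_intros)
      from continuous_attains_inf[OF Z False this] obtain z where
        z: "z \<in> Z" "\<forall>\<theta>\<in>Z. ?h z \<le> ?h \<theta>" by (elim bexE)
      have "z \<in> sphere 0 1 \<inter> Theta_bar" "z \<bullet> W z / 2 = s" using z(1) by (simp_all add: Z_def g_def)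
      then have "W z - (z \<bullet> W z) *\<^sub>R z \<noteq> 0" using reg by blast
      then have "?h z > 0" by simp
      then show thesis
      proof (rule that)
        fix \<theta> assume "\<theta> \<in> sphere 0 1 \<inter> Theta_bar" "\<theta> \<bullet> W \<theta> / 2 = s"
        then have "\<theta> \<in> Z" unfolding Z_def g_def by blast
        then show "?h z \<le> ?h \<theta>" using z(2) by blast
      qed
    qed
  qed
  define B where "B = L + 2 * \<bar>s\<bar>"
  have B: "B > 0" using L_pos by (simp add: B_def)
  \<comment> \<open>The first bound leaves half of c0 for the invariance of the cone; the second
    lets the radial growth of the limit field dominate the error.\<close>
  define e where "e = min (c0 / (2 * B)) \<bar>s\<bar>"
  have e: "0 < e" "e \<le> \<bar>s\<bar>" "B * e < c0"
  proof -
    show "0 < e" "e \<le> \<bar>s\<bar>" using c0(1) B s(2) by (auto simp: e_def)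
    have "B * e \<le> B * (c0 / (2 * B))" using B by (intro mult_left_mono) (auto simp: e_def)
    also have "\<dots> < c0" using B c0(1) by simp
    finally show "B * e < c0" .
  qed
  obtain T where T: "0 \<le> T" "\<And>t \<theta>. T \<le> t \<Longrightarrow> \<theta> \<in> Theta_bar \<Longrightarrow> norm (V t \<theta> - W \<theta>) \<le> e * norm \<theta>"
    using lf e(1) unfolding limit_field_def by blast
  define \<C> where "\<C> = {\<theta> \<in> Theta. g \<theta> < s * (norm \<theta>)\<^sup>2}"
  have "filterlim (\<lambda>t. second_moment (\<pi> t)) at_top at_top"
  proof (rule second_moment_escapes[OF omni, where \<C> = \<C> and ?\<theta>1.0 = \<theta>1 and T = T and k = "\<bar>s\<bar>"])
    have "continuous_on Theta (\<lambda>\<theta>. g \<theta> - s * (norm \<theta>)\<^sup>2)"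
      by (intro continuous_intros continuous_on_subset[OF g_cont] closure_subset)
    from continuous_open_preimage[OF this open_Theta open_lessThan[of 0]]
    show "open \<C>" by (simp add: \<C>_def vimage_def Int_def)
    show "\<C> \<subseteq> Theta" by (auto simp: \<C>_def)
    show "r *\<^sub>R \<eta> \<in> \<C>" if \<eta>: "\<eta> \<in> \<C>" and r: "r > 0" for \<eta> and r :: real
    proof -
      have "\<eta> \<in> Theta" using \<eta> by (simp add: \<C>_def)
      then have "\<eta> \<in> Theta_bar" using closure_subset by blast
      moreover have "r\<^sup>2 * g \<eta> < r\<^sup>2 * (s * (norm \<eta>)\<^sup>2)" using \<eta> r by (intro mult_strict_left_mono) (auto simp: \<C>_def)
      ultimately show ?thesis
        using \<open>\<eta> \<in> Theta\<close> r by (simp add: \<C>_def Theta_scaleR_iff g_scale power_mult_distrib mult.left_commute)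
    qed
    show "\<theta>1 \<in> \<C>" using \<theta>1 s by (simp add: \<C>_def)
    fix t c
    assume t: "T \<le> t" and cT: "c T \<in> \<C>"
      and c: "\<And>\<tau>. \<tau> \<in> {T..t} \<Longrightarrow> (c has_vector_derivative - V \<tau> (c \<tau>)) (at \<tau> within {T..t})"
        "\<And>\<tau>. \<tau> \<in> {T..t} \<Longrightarrow> c \<tau> \<in> Theta"
    have inv: "g (c \<tau>) < s * (norm (c \<tau>))\<^sup>2" if "\<tau> \<in> {T..t}" for \<tau>
      unfolding g_def
    proof (rule limit_cone_invariant[OF lf s(2) c0 e(1) _ _ T(1) c _ that])
      show "(L + 2 * \<bar>s\<bar>) * e < c0" using e(3) by (simp add: B_def)
      show "norm (V \<tau> \<theta> - W \<theta>) \<le> e * norm \<theta>" if "\<tau> \<in> {T..t}" "\<theta> \<in> Theta_bar" for \<tau> \<theta>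
        using T(2) that by simp
      show "c T \<bullet> W (c T) / 2 < s * (norm (c T))\<^sup>2" using cT by (simp add: \<C>_def g_def)
    qed
    \<comment> \<open>Inside the cone c W(c) \<le> -2 |s| |c|^2, and the error of the field costs at
      most |s| |c|^2. Hence |c|^2 grows at least at rate 2 |s|.\<close>
    have "exp (2 * \<bar>s\<bar> * (t - T)) * (c T \<bullet> c T) \<le> c t \<bullet> c t"
    proof (rule gronwall_lower[OF t])
      fix \<tau> assume \<tau>: "\<tau> \<in> {T..t}"
      show "((\<lambda>\<tau>. c \<tau> \<bullet> c \<tau>) has_real_derivative - (2 * (c \<tau> \<bullet> V \<tau> (c \<tau>)))) (at \<tau> within {T..t})"
        using inner_has_real_derivative[OF c(1)[OF \<tau>] c(1)[OF \<tau>]] by (simp add: inner_commute)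
      have bar: "c \<tau> \<in> Theta_bar" using c(2)[OF \<tau>] closure_subset by blast
      have "\<bar>c \<tau> \<bullet> (V \<tau> (c \<tau>) - W (c \<tau>))\<bar> \<le> norm (c \<tau>) * norm (V \<tau> (c \<tau>) - W (c \<tau>))"
        by (rule Cauchy_Schwarz_ineq2)
      also have "\<dots> \<le> norm (c \<tau>) * (e * norm (c \<tau>))" using T(2)[of \<tau> "c \<tau>"] \<tau> bar by (intro mult_left_mono) auto
      also have "\<dots> = e * (c \<tau> \<bullet> c \<tau>)" by (simp add: power2_norm_eq_inner[symmetric] power2_eq_square)
      also have "\<dots> \<le> \<bar>s\<bar> * (c \<tau> \<bullet> c \<tau>)" using e(2) by (intro mult_right_mono) auto
      finally have "c \<tau> \<bullet> V \<tau> (c \<tau>) \<le> c \<tau> \<bullet> W (c \<tau>) + \<bar>s\<bar> * (c \<tau> \<bullet> c \<tau>)" by (simp add: inner_diff_right)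
      moreover have "c \<tau> \<bullet> W (c \<tau>) \<le> - 2 * \<bar>s\<bar> * (c \<tau> \<bullet> c \<tau>)"
        using inv[OF \<tau>] s(2) by (simp add: g_def power2_norm_eq_inner)
      ultimately show "2 * \<bar>s\<bar> * (c \<tau> \<bullet> c \<tau>) \<le> - (2 * (c \<tau> \<bullet> V \<tau> (c \<tau>)))" by simp
    qed
    then have "(exp (\<bar>s\<bar> * (t - T)) * norm (c T))\<^sup>2 \<le> (norm (c t))\<^sup>2"
      by (simp add: power_mult_distrib exp_double[symmetric] power2_norm_eq_inner mult.assoc)
    then show "exp (\<bar>s\<bar> * (t - T)) * norm (c T) \<le> norm (c t)" by (rule power2_le_imp_le) simp
  qed (use T(1) s(2) in auto)
  then show False using bounded by simp
qed

end

section \<open>Stationary measures are optimal\<close>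

text \<open>The second moments alone do not make the quadratically growing \<^const>\<open>phi\<close> uniformly integrable. By
  homogeneity, the density \<open>1 + |\<theta>|\<^sup>2\<close> can be traded against contracting the parameters to the unit
  ball, where limits exist; the lost total mass is restored by a dilation.\<close>

lemma P2_network_subsequence:
  fixes \<mu> :: "nat \<Rightarrow> 'n::finite param measure"
  assumes \<mu>: "\<And>n. \<mu> n \<in> P2" and B: "\<And>n. second_moment (\<mu> n) \<le> B"
  obtains r \<mu>' where "strict_mono (r :: nat \<Rightarrow> nat)" "\<mu>' \<in> P2"
    "\<And>x. (\<lambda>n. network (\<mu> (r n)) x) \<longlonglongrightarrow> network \<mu>' x"
proof -
  define S :: "'n param \<Rightarrow> real" where "S \<theta> = sqrt (1 + (norm \<theta>)\<^sup>2)" for \<theta>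
  have S: "S \<theta> > 0" "(S \<theta>)\<^sup>2 = 1 + (norm \<theta>)\<^sup>2" "norm \<theta> \<le> S \<theta>" for \<theta>
    unfolding S_def by (auto simp: add_pos_nonneg intro!: real_le_rsqrt)
  \<comment> \<open>Dividing by S \<theta> contracts the parameters into the unit ball and, by
    homogeneity of degree two, divides \<open>phi\<close> by 1 + |\<theta>|^2, the growth that the
    density w restores.\<close>
  define T :: "'n param \<Rightarrow> 'n param" where "T \<theta> = inverse (S \<theta>) *\<^sub>R \<theta>" for \<theta>
  have [measurable]: "S \<in> borel_measurable borel" "T \<in> borel_measurable borel"
    unfolding S_def[abs_def] T_def[abs_def] by measurable
  define N where "N n = second_moment (\<mu> n)" for n
  have N: "0 \<le> N n" "N n \<le> B" for n using B second_moment_nonneg by (auto simp: N_def)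
  \<comment> \<open>The denominator is the total mass of 1 + |\<theta>|^2, so the reweighted
    measures are probabilities; it reappears as the factor 1 + N n in front of the networks.\<close>
  define w where "w n \<theta> = (1 + (norm \<theta>)\<^sup>2) / (1 + N n)" for n and \<theta> :: "'n param"
  have w: "0 \<le> w n \<theta>" for n \<theta> using N(1)[of n] by (simp add: w_def)
  have [measurable]: "w n \<in> borel_measurable borel" for n unfolding w_def[abs_def] by measurable
  define \<nu> where "\<nu> n = distr (density (\<mu> n) (\<lambda>\<theta>. ennreal (w n \<theta>))) borel T" for n
  have meas: "f \<in> borel_measurable (\<mu> n)" if "f \<in> borel_measurable borel" for f :: "'n param \<Rightarrow> 'b::topological_space" and n
    using measurable_compose[OF P2_id_measurable[OF \<mu>] that] .
  have mT: "T \<in> density (\<mu> n) (\<lambda>\<theta>. ennreal (w n \<theta>)) \<rightarrow>\<^sub>M borel" for n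
    by (simp add: meas)
  have integral_\<nu>: "(LINT \<theta>|\<nu> n. f \<theta>) = (LINT \<theta>|\<mu> n. w n \<theta> * f (T \<theta>))"
    if [measurable]: "f \<in> borel_measurable borel" for f :: "'n param \<Rightarrow> real" and n
  proof -
    have "(LINT \<theta>|\<nu> n. f \<theta>) = (LINT \<theta>|density (\<mu> n) (\<lambda>\<theta>. ennreal (w n \<theta>)). f (T \<theta>))"
      unfolding \<nu>_def by (rule integral_distr[OF mT that])
    also have "\<dots> = (LINT \<theta>|\<mu> n. w n \<theta> *\<^sub>R f (T \<theta>))"
      by (rule integral_density) (simp_all add: meas w)
    finally show ?thesis by simp
  qed
  have prob: "prob_space (\<nu> n)" for n
  proof -
    interpret \<mu>: prob_space "\<mu> n" by (rule P2D(1)[OF \<mu>])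
    have int: "integrable (\<mu> n) (w n)" unfolding w_def using P2D(4)[OF \<mu>[of n]] by simp
    have "1 + (LINT \<theta>|\<mu> n. (norm \<theta>)\<^sup>2) \<noteq> 0"
      using second_moment_nonneg[of "\<mu> n"] unfolding second_moment_def by linarith
    then have "(LINT \<theta>|\<mu> n. w n \<theta>) = 1"
      unfolding w_def using P2D(4)[OF \<mu>[of n]] by (simp add: \<mu>.prob_space N_def second_moment_def)
    then have "(\<integral>\<^sup>+\<theta>. ennreal (w n \<theta>) \<partial>\<mu> n) = 1"
      using nn_integral_eq_integral[OF int] w by simp
    then have "prob_space (density (\<mu> n) (\<lambda>\<theta>. ennreal (w n \<theta>)))"
      by (intro prob_spaceI) (simp add: emeasure_density meas cong: nn_integral_cong_simp)
    then show ?thesis unfolding \<nu>_def by (rule prob_space.prob_space_distr[OF _ mT])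
  qed
  define A where "A = cball 0 1 \<inter> (Theta_bar :: 'n param set)"
  have A: "compact A" "closed A" unfolding A_def by (auto intro!: compact_Int_closed)
  have TA: "T \<theta> \<in> A" if "\<theta> \<in> Theta_bar" for \<theta>
    unfolding A_def T_def using Theta_bar_scaleR[OF that] S[of \<theta>] by (simp add: field_simps)
  have AE_\<nu>: "AE \<theta> in \<nu> n. \<theta> \<in> A" for n
    unfolding \<nu>_def
  proof (subst AE_distr_iff[OF mT])
    show "{x \<in> space borel. x \<in> A} \<in> sets borel" using A(2) by simp
    show "AE \<theta> in density (\<mu> n) (\<lambda>\<theta>. ennreal (w n \<theta>)). T \<theta> \<in> A"
      by (rule AE_I2) (simp add: TA P2D(3)[OF \<mu>])
  qed
  have sets: "sets (\<nu> n) = sets borel" for n by (simp add: \<nu>_def)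
  obtain r1 \<nu>' where
    r1: "strict_mono (r1 :: nat \<Rightarrow> nat)" and \<nu>': "prob_space \<nu>'" "sets \<nu>' = sets borel" "AE \<theta> in \<nu>'. \<theta> \<in> A"
    and conv: "\<And>f :: 'n param \<Rightarrow> real. continuous_on UNIV f \<Longrightarrow> (\<lambda>n. LINT \<theta>|\<nu> (r1 n). f \<theta>) \<longlonglongrightarrow> (LINT \<theta>|\<nu>'. f \<theta>)"
  proof (rule compact_prob_subsequence[OF A(1) prob sets AE_\<nu>])
    fix r \<nu>'
    assume "strict_mono (r :: nat \<Rightarrow> nat)" "prob_space \<nu>'" "sets \<nu>' = sets borel" "AE \<theta> in \<nu>'. \<theta> \<in> A"
      "\<And>f :: 'n param \<Rightarrow> real. continuous_on UNIV f \<Longrightarrow> (\<lambda>n. LINT \<theta>|\<nu> (r n). f \<theta>) \<longlonglongrightarrow> (LINT \<theta>|\<nu>'. f \<theta>)"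
    then show thesis by (rule that)
  qed
  interpret \<nu>': prob_space \<nu>' by (rule \<nu>')
  note [measurable_cong] = \<nu>'(2)
  have "compact {0..B}" by simp
  then have "\<exists>m\<in>{0..B}. \<exists>r. strict_mono (r :: nat \<Rightarrow> nat) \<and> ((\<lambda>n. N (r1 n)) \<circ> r) \<longlonglongrightarrow> m"
    by (rule iffD1[OF compact_def, THEN spec, THEN mp]) (use N in simp)
  then obtain m r2 where m: "m \<in> {0..B}" and r2: "strict_mono (r2 :: nat \<Rightarrow> nat)" and Nm: "((\<lambda>n. N (r1 n)) \<circ> r2) \<longlonglongrightarrow> m"
    by (elim bexE exE conjE)
  \<comment> \<open>The dilation multiplies \<open>phi\<close> by 1 + m, the limit of the factors 1
    + N n. Points outside A are sent to 0, so that G takes values in \<open>Theta_bar\<close>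
    everywhere and not just almost everywhere.\<close>
  define G where "G \<theta> = (if \<theta> \<in> A then sqrt (1 + m) *\<^sub>R \<theta> else 0)" for \<theta>
  have [measurable]: "A \<in> sets borel" using A(2) by simp
  have [measurable]: "G \<in> borel_measurable borel" unfolding G_def[abs_def] by measurable
  have GT: "G \<theta> \<in> Theta_bar" for \<theta>
    using Theta_bar_scaleR[of \<theta> "sqrt (1 + m)"] by (simp add: G_def A_def zero_in_Theta_bar)
  have mG: "G \<in> \<nu>' \<rightarrow>\<^sub>M restrict_space borel Theta_bar"
    by (rule measurable_restrict_space2) (auto simp: GT)
  define \<mu>' where "\<mu>' = distr \<nu>' (restrict_space borel Theta_bar) G"
  have int_\<mu>': "integrable \<mu>' f \<longleftrightarrow> integrable \<nu>' (\<lambda>\<theta>. f (G \<theta>))" "(LINT \<theta>|\<mu>'. f \<theta>) = (LINT \<theta>|\<nu>'. f (G \<theta>))"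
    if [measurable]: "f \<in> borel_measurable borel" for f :: "'n param \<Rightarrow> real"
    unfolding \<mu>'_def using mG measurable_restrict_space1[OF that]
    by (simp_all add: integrable_distr_eq integral_distr)
  have "\<mu>' \<in> P2"
    unfolding P2_def
  proof (intro CollectI conjI)
    show "prob_space \<mu>'" unfolding \<mu>'_def by (rule \<nu>'.prob_space_distr[OF mG])
    show "sets \<mu>' = sets (restrict_space borel Theta_bar)" by (simp add: \<mu>'_def)
    show "integrable \<mu>' (\<lambda>\<theta>. (norm \<theta>)\<^sup>2)"
    proof (subst int_\<mu>'(1))
      have "(norm (G \<theta>))\<^sup>2 \<le> 1 + m" for \<theta>
      proof (cases "\<theta> \<in> A")
        case True
        then have "(norm \<theta>)\<^sup>2 \<le> 1" by (simp add: A_def power_le_one)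
        then have "(1 + m) * (norm \<theta>)\<^sup>2 \<le> (1 + m) * 1" using m by (intro mult_left_mono) auto
        then show ?thesis using True m by (simp add: G_def power_mult_distrib)
      qed (use m in \<open>simp add: G_def\<close>)
      then show "integrable \<nu>' (\<lambda>\<theta>. (norm (G \<theta>))\<^sup>2)"
        by (intro \<nu>'.integrable_const_bound[of _ "1 + m"]) auto
    qed measurable
  qed
  moreover have "(\<lambda>n. network (\<mu> ((r1 \<circ> r2) n)) x) \<longlonglongrightarrow> network \<mu>' x" for x
  proof -
    have net: "network (\<mu> n) x = (1 + N n) * (LINT \<theta>|\<nu> n. phi \<theta> x)" for n
    proof -
      have "w n \<theta> * phi (T \<theta>) x = phi \<theta> x / (1 + N n)" for \<theta>
      proof -
        have "phi (T \<theta>) x = (inverse (S \<theta>))\<^sup>2 * phi \<theta> x" unfolding T_def using S(1) by (intro phi_scaleR) simp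
        then show ?thesis using S(1)[of \<theta>] unfolding w_def S(2)[symmetric] by (simp add: power_inverse)
      qed
      then have "(LINT \<theta>|\<nu> n. phi \<theta> x) = (LINT \<theta>|\<mu> n. phi \<theta> x / (1 + N n))"
        by (subst integral_\<nu>) auto
      then show ?thesis using N(1)[of n] by (simp add: network_def)
    qed
    have "network \<mu>' x = (LINT \<theta>|\<nu>'. phi (G \<theta>) x)"
      unfolding network_def by (rule int_\<mu>'(2)) simp
    also have "\<dots> = (LINT \<theta>|\<nu>'. (1 + m) * phi \<theta> x)"
    proof (rule integral_cong_AE)
      show "AE \<theta> in \<nu>'. phi (G \<theta>) x = (1 + m) * phi \<theta> x"
        using \<nu>'(3)
      proof eventually_elim
        case (elim \<theta>)
        then show ?case using m phi_scaleR[of "sqrt (1 + m)" \<theta> x] by (simp add: G_def)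
      qed
    qed measurable
    finally have net': "network \<mu>' x = (1 + m) * (LINT \<theta>|\<nu>'. phi \<theta> x)" by simp
    have "(\<lambda>n. LINT \<theta>|\<nu> (r1 (r2 n)). phi \<theta> x) \<longlonglongrightarrow> (LINT \<theta>|\<nu>'. phi \<theta> x)"
      using LIMSEQ_subseq_LIMSEQ[OF conv[OF continuous_phi_param] r2] by (simp add: comp_def)
    then show ?thesis
      unfolding net net' comp_def using Nm by (intro tendsto_intros) (simp add: comp_def)
  qed
  ultimately show thesis using that[of "r1 \<circ> r2" \<mu>'] r1 r2 by (simp add: strict_mono_o)
qed

context loss_data
begin

lemma loss_tangent: "partial1 \<l> u y * (v - u) \<le> \<l> v y - \<l> u y"
proof -
  have "convex_on UNIV (\<lambda>u. \<l> u y)" using loss by (simp add: loss_assumption_def)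
  then show ?thesis
    by (rule convex_on_imp_above_tangent) (use loss_has_derivative in auto)
qed

lemma loss_nonneg: "0 \<le> \<l> u y"
  using loss by (simp add: loss_assumption_def)

lemma loss_growth: "\<l> u y \<le> \<l> 0 y + C * \<bar>u\<bar>"
proof -
  have "\<l> u y - \<l> 0 y \<le> partial1 \<l> u y * u" using loss_tangent[of u y 0] by simp
  also have "\<dots> \<le> \<bar>partial1 \<l> u y\<bar> * \<bar>u\<bar>" by (simp add: abs_mult[symmetric])
  also have "\<dots> \<le> C * \<bar>u\<bar>" using partial1_bound by (intro mult_right_mono) auto
  finally show ?thesis by simp
qed

section \<open>Disintegration of the data measure\<close>

lemma marginal_prob: "prob_space (marginal P)"
  unfolding marginal_def by (rule prob_space_distr) simp

lemma sets_marginal[measurable_cong]: "sets (marginal P) = sets borel"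
  by (simp add: marginal_def)

lemma space_marginal[simp]: "space (marginal P) = UNIV"
  by (simp add: marginal_def)

context
  fixes \<kappa> :: "real ^ 'n \<Rightarrow> real measure"
  assumes \<kappa>: "conditional_distribution P \<kappa>"
begin

lemma \<kappa>_measurable: "\<kappa> \<in> borel \<rightarrow>\<^sub>M prob_algebra borel"
  using \<kappa> by (simp add: conditional_distribution_def)

lemma \<kappa>_subprob[measurable]: "\<kappa> \<in> borel \<rightarrow>\<^sub>M subprob_algebra borel"
  using \<kappa>_measurable by (rule measurable_prob_algebraD)

lemma \<kappa>_prob: "prob_space (\<kappa> x)" and \<kappa>_sets[measurable_cong]: "sets (\<kappa> x) = sets borel"
  using measurable_space[OF \<kappa>_measurable, of x] by (auto simp: space_prob_algebra)

text \<open>The conditional law placed on the fibre over x, so that binding it to the marginal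
  yields a measure on pairs.\<close>

definition kernel :: "real ^ 'n \<Rightarrow> ((real ^ 'n) \<times> real) measure" where
  "kernel x = distr (\<kappa> x) (borel \<Otimes>\<^sub>M borel) (\<lambda>y. (x, y))"

lemma kernel_prob: "prob_space (kernel x)"
  unfolding kernel_def by (rule prob_space.prob_space_distr[OF \<kappa>_prob]) simp

lemma kernel_measurable: "kernel \<in> marginal P \<rightarrow>\<^sub>M subprob_algebra (borel \<Otimes>\<^sub>M borel)"
proof -
  have "kernel \<in> borel \<rightarrow>\<^sub>M subprob_algebra (borel \<Otimes>\<^sub>M borel)"
    unfolding kernel_def[abs_def]
    by (rule measurable_distr2[where M = borel]) (simp_all add: case_prod_unfold)
  then show ?thesis by (simp cong: measurable_cong_sets add: sets_marginal)
qed

text \<open>\<open>conditional_distribution\<close> is precisely equality on measurable rectangles,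
  which are stable under intersection and generate the product.\<close>

lemma disintegration: "P = marginal P \<bind> kernel"
proof (rule measure_eqI_generator_eq[OF Int_stable_pair_measure_generator, of borel borel])
  let ?E = "{a \<times> b |a b. a \<in> sets (borel :: (real ^ 'n) measure) \<and> b \<in> sets (borel :: real measure)}"
  have bind_sets: "sets (marginal P \<bind> kernel) = sets (borel \<Otimes>\<^sub>M borel)"
    by (rule sets_bind[OF sets_kernel[OF kernel_measurable]]) auto
  show "?E \<subseteq> Pow UNIV" by simp
  show "sets P = sigma_sets UNIV ?E" unfolding sets_P' sets_pair_measure by simp
  show "sets (marginal P \<bind> kernel) = sigma_sets UNIV ?E" unfolding bind_sets sets_pair_measure by simp
  show "range (\<lambda>i::nat. UNIV) \<subseteq> ?E" by (auto intro!: exI[of _ UNIV])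
  show "(\<Union>i::nat. UNIV) = (UNIV :: ((real ^ 'n) \<times> real) set)" by simp
  show "emeasure P UNIV \<noteq> \<infinity>" by simp
  fix X assume "X \<in> ?E"
  then obtain A B where X: "X = A \<times> B" "A \<in> sets borel" "B \<in> sets borel" by blast
  have "emeasure (marginal P \<bind> kernel) X = (\<integral>\<^sup>+x. emeasure (kernel x) X \<partial>marginal P)"
    using X by (intro emeasure_bind[OF _ kernel_measurable]) auto
  also have "\<dots> = (\<integral>\<^sup>+x. emeasure (\<kappa> x) B * indicator A x \<partial>marginal P)"
  proof (rule nn_integral_cong)
    fix x
    have "emeasure (kernel x) X = emeasure (\<kappa> x) ((\<lambda>y. (x, y)) -` X \<inter> space (\<kappa> x))"
      unfolding kernel_def using X by (intro emeasure_distr) auto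
    also have "(\<lambda>y. (x, y)) -` X \<inter> space (\<kappa> x) = (if x \<in> A then B else {})"
      using sets_eq_imp_space_eq[OF \<kappa>_sets[of x]] by (auto simp: X)
    finally show "emeasure (kernel x) X = emeasure (\<kappa> x) B * indicator A x" by simp
  qed
  also have "\<dots> = emeasure P X"
    using \<kappa> X by (simp add: conditional_distribution_def)
  finally show "emeasure P X = emeasure (marginal P \<bind> kernel) X" by simp
qed

lemma nn_integral_disintegration:
  assumes [measurable]: "f \<in> borel_measurable (borel \<Otimes>\<^sub>M borel)"
  shows "(\<integral>\<^sup>+z. f z \<partial>P) = (\<integral>\<^sup>+x. \<integral>\<^sup>+y. f (x, y) \<partial>\<kappa> x \<partial>marginal P)"
proof -
  have "(\<integral>\<^sup>+z. f z \<partial>P) = (\<integral>\<^sup>+z. f z \<partial>(marginal P \<bind> kernel))"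
    using disintegration by simp
  also have "\<dots> = (\<integral>\<^sup>+x. \<integral>\<^sup>+z. f z \<partial>kernel x \<partial>marginal P)"
    by (rule nn_integral_bind[OF assms kernel_measurable])
  also have "\<dots> = (\<integral>\<^sup>+x. \<integral>\<^sup>+y. f (x, y) \<partial>\<kappa> x \<partial>marginal P)"
    unfolding kernel_def by (intro nn_integral_cong nn_integral_distr) auto
  finally show ?thesis .
qed

lemma integral_disintegration:
  fixes f :: "(real ^ 'n) \<times> real \<Rightarrow> real"
  assumes f[measurable]: "f \<in> borel_measurable (borel \<Otimes>\<^sub>M borel)" and B: "\<And>z. \<bar>f z\<bar> \<le> B"
  shows "(LINT z|P. f z) = (LINT x|marginal P. LINT y|\<kappa> x. f (x, y))"
proof -
  interpret m: prob_space "marginal P" by (rule marginal_prob)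
  have "(LINT z|P. f z) = (LINT z|(marginal P \<bind> kernel). f z)"
    using disintegration by simp
  also have "\<dots> = (LINT x|marginal P. LINT z|kernel x. f z)"
    by (rule integral_bind[OF f _ kernel_measurable, of B 1])
      (use B kernel_prob in \<open>auto simp: prob_space.emeasure_space_1\<close>)
  also have "\<dots> = (LINT x|marginal P. LINT y|\<kappa> x. f (x, y))"
    unfolding kernel_def by (intro Bochner_Integration.integral_cong refl integral_distr) auto
  finally show ?thesis .
qed

text \<open>First-order optimality along all of \<^const>\<open>phi\<close> extends by density to all of \<open>L\<^sup>1\<close>, in particular
  to the conditional mean of the derivative of the loss.\<close>

lemma conditional_derivative_zero:
  assumes \<mu>: "\<mu> \<in> P2" and zero: "\<And>\<theta>. \<theta> \<in> Theta_bar \<Longrightarrow> potential P (q \<mu>) \<theta> = 0"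
  shows "AE x in marginal P. (LINT y|\<kappa> x. q \<mu> (x, y)) = 0"
proof -
  interpret m: prob_space "marginal P" by (rule marginal_prob)
  interpret b: bounded_weight P "q \<mu>" C by (rule bounded_weight[OF \<mu>])
  note [measurable] = measurable_network[OF \<mu>]
  have q[measurable]: "q \<mu> \<in> borel_measurable (borel \<Otimes>\<^sub>M borel)" unfolding q_def[abs_def] by measurable
  define p where "p x = (LINT y|\<kappa> x. q \<mu> (x, y))" for x
  have p[measurable]: "p \<in> borel_measurable borel"
  proof -
    have "p = (\<lambda>x. LINT z|kernel x. q \<mu> z)"
      unfolding p_def[abs_def] kernel_def by (intro ext integral_distr[symmetric]) auto
    moreover have "(\<lambda>x. LINT z|kernel x. q \<mu> z) \<in> borel_measurable (marginal P)"
      by (rule measurable_compose[OF kernel_measurable integral_measurable_subprob_algebra[OF q]])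
    ultimately show ?thesis by (simp cong: measurable_cong_sets add: sets_marginal)
  qed
  have pC: "\<bar>p x\<bar> \<le> C" for x
  proof -
    interpret k: prob_space "\<kappa> x" by (rule \<kappa>_prob)
    have mx: "(\<lambda>y. q \<mu> (x, y)) \<in> borel_measurable (\<kappa> x)" by measurable
    have "integrable (\<kappa> x) (\<lambda>y. q \<mu> (x, y))"
      by (rule k.integrable_const_bound[of _ C]) (use b.q_bound mx in auto)
    then have "norm (p x) \<le> (LINT y|\<kappa> x. C)"
      unfolding p_def using b.q_bound by (intro Bochner_Integration.integral_norm_bound_integral) auto
    then show ?thesis by (simp add: k.prob_space)
  qed
  have int_p: "integrable (marginal P) p" by (rule m.integrable_const_bound[of _ C]) (use pC in auto)
  have int_pP: "integrable P (\<lambda>z. q \<mu> z * p (fst z))"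
  proof (rule integrable_const_bound[of _ "C * C"])
    show "AE z in P. norm (q \<mu> z * p (fst z)) \<le> C * C"
      unfolding real_norm_def abs_mult by (intro AE_I2 mult_mono b.q_bound pC b.C_nonneg abs_ge_zero)
  qed measurable
  \<comment> \<open>The conditional mean p itself is used as test direction: by disintegration the
    integral is that of p^2 over the marginal.\<close>
  have "(LINT z|P. q \<mu> z * p (fst z)) = 0"
  proof (rule ccontr)
    assume nz: "(LINT z|P. q \<mu> z * p (fst z)) \<noteq> 0"
    \<comment> \<open>Small enough that C times the approximation error cannot reach the supposedly
      nonzero integral; C + 1 avoids division by 0.\<close>
    define e where "e = \<bar>LINT z|P. q \<mu> z * p (fst z)\<bar> / (C + 1)"
    have "e > 0" using nz b.C_nonneg by (simp add: e_def)
    have "phi_span_dense P" using data by (simp add: data_assumption_def)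
    then obtain F c where F: "finite F" "F \<subseteq> Theta_bar"
      "(LINT x|marginal P. \<bar>p x - (\<Sum>\<theta>\<in>F. c \<theta> * phi \<theta> x)\<bar>) < e"
      using int_p \<open>e > 0\<close> unfolding phi_span_dense_def by meson
    define h where "h x = p x - (\<Sum>\<theta>\<in>F. c \<theta> * phi \<theta> x)" for x
    have h[measurable]: "h \<in> borel_measurable borel" unfolding h_def by measurable
    have int_phi: "integrable P (\<lambda>z. phi \<theta> (fst z))" for \<theta>
    proof (rule Bochner_Integration.integrable_bound)
      show "integrable P (\<lambda>z. (norm \<theta>)\<^sup>2 * weight (fst z))" using integrable_weight by simp
      show "AE z in P. norm (phi \<theta> (fst z)) \<le> norm ((norm \<theta>)\<^sup>2 * weight (fst z))"
        unfolding real_norm_def by (intro AE_I2 order_trans[OF phi_bound abs_ge_self])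
    qed measurable
    have int_ppP: "integrable P (\<lambda>z. p (fst z))"
      by (rule integrable_const_bound[of _ C]) (use pC in auto)
    have int_h: "integrable P (\<lambda>z. \<bar>h (fst z)\<bar>)"
      unfolding h_def using int_ppP int_phi by (intro integrable_abs Bochner_Integration.integrable_diff Bochner_Integration.integrable_sum integrable_mult_right)
    have "(LINT z|P. q \<mu> z * p (fst z)) = (LINT z|P. q \<mu> z * p (fst z)) - (\<Sum>\<theta>\<in>F. c \<theta> * potential P (q \<mu>) \<theta>)"
    proof -
      have "(\<Sum>\<theta>\<in>F. c \<theta> * potential P (q \<mu>) \<theta>) = (\<Sum>\<theta>\<in>F. c \<theta> * 0)"
        using subsetD[OF F(2)] by (intro sum.cong refl arg_cong2[where f = "(*)"] zero)
      then show ?thesis by simp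
    qed
    also have "\<dots> = (LINT z|P. q \<mu> z * p (fst z) - (\<Sum>\<theta>\<in>F. c \<theta> * (q \<mu> z * phi \<theta> (fst z))))"
      unfolding potential_def using int_pP b.integrable_potential by simp
    also have "\<dots> = (LINT z|P. q \<mu> z *\<^sub>R h (fst z))"
      by (simp add: h_def right_diff_distrib sum_distrib_left mult.left_commute)
    finally have "\<bar>LINT z|P. q \<mu> z * p (fst z)\<bar> \<le> C * (LINT z|P. \<bar>h (fst z)\<bar>)"
      using b.weighted_bound(2)[of "\<lambda>z. h (fst z)", OF _ int_h] by simp
    also have "(LINT z|P. \<bar>h (fst z)\<bar>) = (LINT x|marginal P. \<bar>h x\<bar>)"
      unfolding marginal_def by (rule integral_distr[symmetric]) auto
    also have "C * (LINT x|marginal P. \<bar>h x\<bar>) \<le> C * e"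
      using F(3) b.C_nonneg by (intro mult_left_mono) (auto simp: h_def)
    also have "\<dots> < (C + 1) * e" using \<open>e > 0\<close> by simp
    also have "\<dots> = \<bar>LINT z|P. q \<mu> z * p (fst z)\<bar>" using b.C_nonneg by (simp add: e_def)
    finally show False by simp
  qed
  moreover have "(LINT z|P. q \<mu> z * p (fst z)) = (LINT x|marginal P. LINT y|\<kappa> x. q \<mu> (x, y) * p x)"
  proof -
    have qp: "(\<lambda>z. q \<mu> z * p (fst z)) \<in> borel_measurable (borel \<Otimes>\<^sub>M borel)" by measurable
    have "\<bar>q \<mu> z * p (fst z)\<bar> \<le> C * C" for z
      unfolding abs_mult by (intro mult_mono b.q_bound pC b.C_nonneg abs_ge_zero)
    from integral_disintegration[OF qp this] show ?thesis by simp
  qed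
  ultimately have "(LINT x|marginal P. p x * p x) = 0" by (simp add: p_def)
  moreover have "integrable (marginal P) (\<lambda>x. p x * p x)"
  proof (rule m.integrable_const_bound[of _ "C * C"])
    show "AE x in marginal P. norm (p x * p x) \<le> C * C"
      unfolding real_norm_def abs_mult by (intro AE_I2 mult_mono pC b.C_nonneg abs_ge_zero)
  qed measurable
  ultimately have "AE x in marginal P. p x * p x = 0"
    by (subst (asm) integral_nonneg_eq_0_iff_AE) auto
  then show ?thesis by (simp add: p_def)
qed

text \<open>Convexity places the loss above its tangent at the network value. Integrated over y, the
  linear term has the conditional mean of the derivative as coefficient and vanishes, so the network
  value minimizes the conditional risk. Integrating over x gives the risk.\<close>

lemma
  assumes \<mu>: "\<mu> \<in> P2" and zero: "\<And>\<theta>. \<theta> \<in> Theta_bar \<Longrightarrow> potential P (q \<mu>) \<theta> = 0"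
    and fin: "(\<integral>\<^sup>+(x, y). ennreal (\<l> 0 y) \<partial>P) < \<infinity>"
  shows stationary_optimal: "L1_optimal_predictor \<l> P \<kappa> (network \<mu>)"
    and stationary_risk_minimizing: "risk_minimizing \<l> P \<mu>"
proof -
  interpret m: prob_space "marginal P" by (rule marginal_prob)
  interpret b: bounded_weight P "q \<mu>" C by (rule bounded_weight[OF \<mu>])
  have "(\<integral>\<^sup>+x. \<integral>\<^sup>+y. ennreal (\<l> 0 y) \<partial>\<kappa> x \<partial>marginal P) = (\<integral>\<^sup>+z. ennreal (\<l> 0 (snd z)) \<partial>P)"
    by (subst nn_integral_disintegration) auto
  also have "\<dots> < \<infinity>" using fin by (simp add: case_prod_unfold)
  finally have "(\<integral>\<^sup>+x. \<integral>\<^sup>+y. ennreal (\<l> 0 y) \<partial>\<kappa> x \<partial>marginal P) \<noteq> \<infinity>" by simp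
  moreover have "(\<lambda>x. \<integral>\<^sup>+y. ennreal (\<l> 0 y) \<partial>\<kappa> x) \<in> borel_measurable (marginal P)"
    by (rule nn_integral_measurable_subprob_algebra2[where N = borel]) auto
  \<comment> \<open>Finite risk of the predictor 0 makes \<open>\<l> 0\<close> integrable under
    almost every conditional law; the linear growth bound extends this to every
    \<open>\<l> \<alpha>\<close>, so the tangent inequality may be integrated.\<close>
  ultimately have fin_AE: "AE x in marginal P. (\<integral>\<^sup>+y. ennreal (\<l> 0 y) \<partial>\<kappa> x) \<noteq> \<infinity>"
    by (intro nn_integral_PInf_AE)
  have "AE x in marginal P. (LINT y|\<kappa> x. q \<mu> (x, y)) = 0"
    by (rule conditional_derivative_zero[OF \<mu>]) (rule zero)
  then have opt: "AE x in marginal P. \<forall>\<alpha>. cond_risk \<l> \<kappa> x (network \<mu> x) \<le> cond_risk \<l> \<kappa> x \<alpha>"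
    using fin_AE
  proof eventually_elim
    case (elim x)
    interpret k: prob_space "\<kappa> x" by (rule \<kappa>_prob)
    let ?f = "network \<mu> x"
    have int0: "integrable (\<kappa> x) (\<lambda>y. \<l> 0 y)"
      using elim(2) by (intro integrableI_nonneg) (auto simp: loss_nonneg less_top)
    have int: "integrable (\<kappa> x) (\<lambda>y. \<l> \<alpha> y)" for \<alpha>
    proof (rule Bochner_Integration.integrable_bound)
      show "integrable (\<kappa> x) (\<lambda>y. \<l> 0 y + C * \<bar>\<alpha>\<bar>)" using int0 by simp
      show "AE y in \<kappa> x. norm (\<l> \<alpha> y) \<le> norm (\<l> 0 y + C * \<bar>\<alpha>\<bar>)"
        using loss_growth[of \<alpha>] loss_nonneg[of \<alpha>] by (intro AE_I2) (simp add: order_trans[OF _ abs_ge_self])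
    qed measurable
    have intq: "integrable (\<kappa> x) (\<lambda>y. q \<mu> (x, y))"
      by (rule k.integrable_const_bound[of _ C]) (use b.q_bound in \<open>auto simp: q_def\<close>)
    show ?case
    proof
      fix \<alpha>
      have "(LINT y|\<kappa> x. \<l> ?f y) = (LINT y|\<kappa> x. \<l> ?f y + q \<mu> (x, y) * (\<alpha> - ?f))"
        using int[of ?f] intq elim(1) by simp
      also have "\<dots> \<le> (LINT y|\<kappa> x. \<l> \<alpha> y)"
      proof (rule integral_mono)
        show "integrable (\<kappa> x) (\<lambda>y. \<l> ?f y + q \<mu> (x, y) * (\<alpha> - ?f))" using int[of ?f] intq by simp
        show "\<l> ?f y + q \<mu> (x, y) * (\<alpha> - ?f) \<le> \<l> \<alpha> y" for y
          using loss_tangent[of ?f y \<alpha>] by (simp add: q_def)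
      qed (rule int)
      finally show "cond_risk \<l> \<kappa> x ?f \<le> cond_risk \<l> \<kappa> x \<alpha>"
        unfolding cond_risk_def by (subst (1 2) nn_integral_eq_integral[OF int]) (simp_all add: loss_nonneg ennreal_leI)
    qed
  qed
  have "integrable (marginal P) (network \<mu>)"
  proof (rule Bochner_Integration.integrable_bound)
    have "integrable (marginal P) weight"
      unfolding marginal_def using integrable_weight by (simp add: integrable_distr_eq)
    then show "integrable (marginal P) (\<lambda>x. second_moment \<mu> * weight x)" by simp
    show "network \<mu> \<in> borel_measurable (marginal P)"
      using measurable_network[OF \<mu>] by (simp cong: measurable_cong_sets add: sets_marginal)
    show "AE x in marginal P. norm (network \<mu> x) \<le> norm (second_moment \<mu> * weight x)"
      unfolding real_norm_def by (intro AE_I2 order_trans[OF network_bound[OF \<mu>] abs_ge_self])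
  qed
  then show "L1_optimal_predictor \<l> P \<kappa> (network \<mu>)"
    using opt by (auto simp: L1_optimal_predictor_def is_arg_min_def not_less elim!: eventually_mono)
  have risk: "risk \<l> P \<nu> = (\<integral>\<^sup>+x. cond_risk \<l> \<kappa> x (network \<nu> x) \<partial>marginal P)" if \<nu>: "\<nu> \<in> P2" for \<nu>
  proof -
    note [measurable] = measurable_network[OF \<nu>]
    have "risk \<l> P \<nu> = (\<integral>\<^sup>+z. ennreal (\<l> (network \<nu> (fst z)) (snd z)) \<partial>P)"
      by (simp add: risk_def case_prod_unfold)
    also have "\<dots> = (\<integral>\<^sup>+x. cond_risk \<l> \<kappa> x (network \<nu> x) \<partial>marginal P)"
      by (subst nn_integral_disintegration) (auto simp: cond_risk_def)
    finally show ?thesis .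
  qed
  have "risk \<l> P \<mu> \<le> risk \<l> P \<nu>" if "\<nu> \<in> P2" for \<nu>
    unfolding risk[OF \<mu>] risk[OF that] using opt by (intro nn_integral_mono_AE) (auto elim!: eventually_mono)
  then show "risk_minimizing \<l> P \<mu>"
    using \<mu> by (auto simp: risk_minimizing_def is_arg_min_def not_less)
qed

end

end

theorem corollary3p8:
  fixes \<l> :: "real \<Rightarrow> real \<Rightarrow> real"
    and P :: "((real ^ 'n::finite) \<times> real) measure"
    and \<kappa> :: "real ^ 'n \<Rightarrow> real measure"
    and \<pi>0 :: "'n param measure"
    and \<pi> :: "real \<Rightarrow> 'n param measure"
  assumes "loss_assumption \<l>"
    and "data_assumption P"
    and "conditional_distribution P \<kappa>"
    and "compatibility \<l> P \<kappa>"
    and "\<pi>0 \<in> P2"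
    and "omni_directional \<pi>0"
    and "wasserstein_gradient_flow \<l> P \<pi>0 \<pi>"
    and "morse_sard_condition \<l> P \<pi>"
    and "\<exists>t. (\<forall>n. 0 \<le> t n) \<and> filterlim t at_top sequentially \<and>
           (\<exists>C. \<forall>n::nat. second_moment (\<pi> (t n)) \<le> C)"
    and "card (limit_pairs \<l> P \<pi>) = 1"
  shows "\<exists>\<pi>_inf\<in>P2. (\<exists>fstar. L1_optimal_predictor \<l> P \<kappa> fstar \<and>
             (AE x in marginal P. network \<pi>_inf x = fstar x)) \<and>
           risk_minimizing \<l> P \<pi>_inf"
proof -
  interpret gradient_flow P \<l> \<pi>0 \<pi>
    by unfold_locales (use assms in auto)
  obtain t B where t: "\<And>n. 0 \<le> t n" "filterlim t at_top sequentially" "\<And>n::nat. second_moment (\<pi> (t n)) \<le> B"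
    using assms(9) by blast
  have "\<pi> 0 = \<pi>0" using assms(7) by (simp add: wasserstein_gradient_flow_def)
  then have omni: "omni_directional (\<pi> 0)" using assms(6) by simp
  have bounded: "\<not> filterlim (\<lambda>t. second_moment (\<pi> t)) at_top at_top"
  proof
    assume "filterlim (\<lambda>t. second_moment (\<pi> t)) at_top at_top"
    from filterlim_compose[OF this t(2)] have "\<forall>\<^sub>F n in sequentially. B + 1 \<le> second_moment (\<pi> (t n))"
      by (simp add: filterlim_at_top)
    then obtain n where "B + 1 \<le> second_moment (\<pi> (t n))"
      using eventually_happens'[OF sequentially_bot] by blast
    then show False using t(3)[of n] by simp
  qed
  obtain W where W: "limit_field W"
    "AE s in lborel. \<forall>\<theta>\<in>sphere 0 1 \<inter> Theta_bar. \<theta> \<bullet> W \<theta> / 2 = s \<longrightarrow> W \<theta> - (\<theta> \<bullet> W \<theta>) *\<^sub>R \<theta> \<noteq> 0"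
    using unique_limit[OF assms(10,8)] .
  obtain r \<mu> where r: "strict_mono (r :: nat \<Rightarrow> nat)" and \<mu>: "\<mu> \<in> P2"
    and net: "\<And>x. (\<lambda>n. network (\<pi> (t (r n))) x) \<longlonglongrightarrow> network \<mu> x"
    using P2_network_subsequence[of "\<lambda>n. \<pi> (t n)" B] \<pi>_P2[OF t(1)] t(3) by metis
  \<comment> \<open>Along one sequence of times the first variations have two limits: that of \<mu>,
    by convergence of the networks, and the limit potential, which is zero.\<close>
  have zero: "potential P (q \<mu>) \<theta> = 0" if \<theta>: "\<theta> \<in> Theta_bar" for \<theta>
  proof (rule LIMSEQ_unique)
    show "(\<lambda>n. potential P (q (\<pi> (t (r n)))) \<theta>) \<longlonglongrightarrow> potential P (q \<mu>) \<theta>"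
      by (rule potential_tendsto[OF \<pi>_P2[OF t(1)] \<mu> net])
    have "filterlim (\<lambda>n. t (r n)) at_top sequentially"
      by (rule filterlim_compose[OF t(2) filterlim_subseq[OF r]])
    from filterlim_compose[OF limit_field_G[OF W(1) \<theta>] this]
    show "(\<lambda>n. potential P (q (\<pi> (t (r n)))) \<theta>) \<longlonglongrightarrow> 0"
      by (simp add: limit_potential_zero[OF omni W bounded \<theta>])
  qed
  have fin: "(\<integral>\<^sup>+(x, y). ennreal (\<l> 0 y) \<partial>P) < \<infinity>"
    using assms(4) by (simp add: compatibility_def)
  have "L1_optimal_predictor \<l> P \<kappa> (network \<mu>)"
    by (rule stationary_optimal[OF assms(3) \<mu> _ fin]) (rule zero)
  moreover have "risk_minimizing \<l> P \<mu>"
    by (rule stationary_risk_minimizing[OF assms(3) \<mu> _ fin]) (rule zero)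
  ultimately show ?thesis using \<mu> by auto
qed

end
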